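(* Let $R$ be a commutative Noetherian ring with identity, $\mathfrak{a}$ an ideal of $R$, and $X$ an arbitrary $R$-module with $\operatorname{cd}(\mathfrak{a},X)=1$. Then for all $i\ge 0$, $$\operatorname{Ext}^{i}_{R}(R/\mathfrak{a},H^{1}_{\mathfrak{a}}(X))\cong \operatorname{Ext}^{i+1}_{R}(R/\mathfrak{a},X/\Gamma_{\mathfrak{a}}(X)).$$ In particular, if $X$ is finitely generated, then $H^{i}_{\mathfrak{a}}(X)$ is $\mathfrak{a}$-cofinite for all $i$.
   Context: $\Gamma_{\mathfrak{a}}$ is the $\mathfrak{a}$-torsion functor and $H^{i}_{\mathfrak{a}}(X)$ is the $i$-th ordinary local cohomology module of $X$ with respect to $\mathfrak{a}$. $\operatorname{cd}(\mathfrak{a},X)$ is the largest integer $i$ for which $H^{i}_{\mathfrak{a}}(X)$ is non-zero. An $R$-module $Y$ is $\mathfrak{a}$-cofinite if $\operatorname{Supp}(Y)\subseteq V(\mathfrak{a})$ and $\operatorname{Ext}^{i}_{R}(R/\mathfrak{a},Y)$ is finitely generated for all $i$. *)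

theory Defs
  imports "HOL-Algebra.Module" "HOL-Algebra.Ideal_Product" "HOL-Algebra.Ring_Divisibility" "HOL-Library.Extended_Real"
begin

section \<open>Modules\<close>

text \<open>
  The record type of modules extends that of rings, so each concrete module below also has to fill
  the fields \<open>mult\<close> and \<open>one\<close>. They carry no meaning, and the locale \<open>module\<close> ignores them.
\<close>

definition module_homs ::
  "('a, 'r) ring_scheme \<Rightarrow> ('a, 'm, 'c) module_scheme \<Rightarrow> ('a, 'n, 'd) module_scheme \<Rightarrow> ('m \<Rightarrow> 'n) set"
  where "module_homs R M N =
    {f \<in> carrier M \<rightarrow> carrier N.
       (\<forall>x\<in>carrier M. \<forall>y\<in>carrier M. f (x \<oplus>\<^bsub>M\<^esub> y) = f x \<oplus>\<^bsub>N\<^esub> f y) \<and>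
       (\<forall>r\<in>carrier R. \<forall>x\<in>carrier M. f (r \<odot>\<^bsub>M\<^esub> x) = r \<odot>\<^bsub>N\<^esub> f x)}"

definition module_iso ::
  "('a, 'r) ring_scheme \<Rightarrow> ('a, 'm, 'c) module_scheme \<Rightarrow> ('a, 'n, 'd) module_scheme \<Rightarrow> bool"
  where "module_iso R M N \<longleftrightarrow> (\<exists>f\<in>module_homs R M N. bij_betw f (carrier M) (carrier N))"

definition zero_module :: "('a, 'm, 'c) module_scheme \<Rightarrow> bool"
  where "zero_module M \<longleftrightarrow> carrier M = {\<zero>\<^bsub>M\<^esub>}"

definition finitely_generated :: "('a, 'r) ring_scheme \<Rightarrow> ('a, 'm, 'c) module_scheme \<Rightarrow> bool"
  where "finitely_generated R M \<longleftrightarrow>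
    (\<exists>S. finite S \<and> S \<subseteq> carrier M \<and>
      (\<forall>x\<in>carrier M. \<exists>c\<in>S \<rightarrow> carrier R. x = (\<Oplus>\<^bsub>M\<^esub>s\<in>S. c s \<odot>\<^bsub>M\<^esub> s)))"

definition quotient_module :: "('a, 'm, 'c) module_scheme \<Rightarrow> 'm set \<Rightarrow> ('a, 'm set) module"
  where "quotient_module M N =
    \<lparr>carrier = a_rcosets\<^bsub>M\<^esub> N,
     monoid.mult = (\<lambda>_ _. N), one = N,
     ring.zero = N,
     ring.add = (\<lambda>A B. A <+>\<^bsub>M\<^esub> B),
     smult = (\<lambda>r A. \<Union>x\<in>A. N +>\<^bsub>M\<^esub> (r \<odot>\<^bsub>M\<^esub> x))\<rparr>"

definition ring_as_module :: "('a, 'r) ring_scheme \<Rightarrow> ('a, 'a) module"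
  where "ring_as_module R =
    \<lparr>carrier = carrier R, monoid.mult = monoid.mult R, one = \<one>\<^bsub>R\<^esub>, ring.zero = \<zero>\<^bsub>R\<^esub>, ring.add = ring.add R, smult = monoid.mult R\<rparr>"

text \<open>The \<open>R\<close>-module \<open>R/\<aa>\<close>.\<close>

definition residue_module :: "('a, 'r) ring_scheme \<Rightarrow> 'a set \<Rightarrow> ('a, 'a set) module"
  where "residue_module R \<aa> = quotient_module (ring_as_module R) \<aa>"

text \<open>Elements of the Hom module are cut down to extensional functions, so that two
  homomorphisms that agree on the carrier are equal.\<close>

definition Hom_module ::
  "('a, 'r) ring_scheme \<Rightarrow> ('a, 'm, 'c) module_scheme \<Rightarrow> ('a, 'n, 'd) module_scheme \<Rightarrow> ('a, 'm \<Rightarrow> 'n) module"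
  where "Hom_module R M N =
    \<lparr>carrier = module_homs R M N \<inter> extensional (carrier M),
     monoid.mult = (\<lambda>_ _. \<lambda>x\<in>carrier M. \<zero>\<^bsub>N\<^esub>), one = (\<lambda>x\<in>carrier M. \<zero>\<^bsub>N\<^esub>),
     ring.zero = (\<lambda>x\<in>carrier M. \<zero>\<^bsub>N\<^esub>),
     ring.add = (\<lambda>f g. \<lambda>x\<in>carrier M. f x \<oplus>\<^bsub>N\<^esub> g x),
     smult = (\<lambda>r f. \<lambda>x\<in>carrier M. r \<odot>\<^bsub>N\<^esub> f x)\<rparr>"


section \<open>Injective resolutions and cohomology\<close>

text \<open>
  The extension property of an injective module \<open>E\<close> is required along all monomorphisms
  \<open>A \<rightarrow> B\<close> of modules carried by subsets of \<open>'a + 'e\<close>, since HOL cannot quantify over types.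
  This loses nothing: \<open>R\<close> and its ideals have copies in \<open>'a + 'e\<close>, so by Baer's criterion the
  property then holds along all monomorphisms, in whatever types.
\<close>

definition injective_module :: "('a, 'r) ring_scheme \<Rightarrow> ('a, 'e, 'c) module_scheme \<Rightarrow> bool"
  where "injective_module R E \<longleftrightarrow> module R E \<and>
    (\<forall>(A :: ('a, 'a + 'e) module) (B :: ('a, 'a + 'e) module) f g.
       module R A \<and> module R B \<and>
       f \<in> module_homs R A B \<and> inj_on f (carrier A) \<and> g \<in> module_homs R A E \<longrightarrow>
       (\<exists>h\<in>module_homs R B E. \<forall>x\<in>carrier A. h (f x) = g x))"

text \<open>Exactness of \<open>0 \<rightarrow> M \<rightarrow> I 0 \<rightarrow> I 1 \<rightarrow> \<dots>\<close> with injective \<open>I n\<close>, augmentation \<open>\<epsilon>\<close> and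
  differentials \<open>d\<close>.\<close>

definition injective_resolution ::
  "('a, 'r) ring_scheme \<Rightarrow> ('a, 'm, 'c) module_scheme \<Rightarrow>
   (nat \<Rightarrow> ('a, 'e) module) \<Rightarrow> (nat \<Rightarrow> 'e \<Rightarrow> 'e) \<Rightarrow> ('m \<Rightarrow> 'e) \<Rightarrow> bool"
  where "injective_resolution R M I d \<epsilon> \<longleftrightarrow>
    (\<forall>n. injective_module R (I n)) \<and>
    \<epsilon> \<in> module_homs R M (I 0) \<and>
    (\<forall>n. d n \<in> module_homs R (I n) (I (Suc n))) \<and>
    inj_on \<epsilon> (carrier M) \<and>
    \<epsilon> ` carrier M = a_kernel (I 0) (I 1) (d 0) \<and>
    (\<forall>n. d n ` carrier (I n) = a_kernel (I (Suc n)) (I (Suc (Suc n))) (d (Suc n)))"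

text \<open>
  The type \<open>'a list \<Rightarrow> 'm option\<close> has room for an injective resolution of every \<open>R\<close>-module \<open>M\<close>
  carried by \<open>'m\<close>, for any commutative ring \<open>R\<close> carried by \<open>'a\<close>. Let \<open>\<kappa>\<close> be its cardinality. Then \<open>\<kappa>\<close> is
  infinite, \<open>|'m| \<le> \<kappa>\<close>, and \<open>\<kappa> ^ |'a| = \<kappa>\<close> because \<open>'a list\<close> is infinite and at least as large
  as \<open>'a\<close>. A module \<open>Q\<close> with at most \<open>\<kappa>\<close> elements embeds, as an abelian group, into a divisible
  group \<open>D\<close> with at most \<open>\<kappa>\<close> elements, and therefore as an \<open>R\<close>-module into the injective module
  of additive maps from \<open>R\<close> to \<open>D\<close>, which has at most \<open>\<kappa> ^ |'a| = \<kappa>\<close> elements. Applying this to \<open>M\<close> and then to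
  the successive cokernels yields a resolution. So the choice below selects a genuine
  resolution, and Ext and local cohomology do not depend on it up to isomorphism.
\<close>

definition inj_res ::
  "('a, 'r) ring_scheme \<Rightarrow> ('a, 'm, 'c) module_scheme \<Rightarrow>
   (nat \<Rightarrow> ('a, 'a list \<Rightarrow> 'm option) module) \<times>
   (nat \<Rightarrow> ('a list \<Rightarrow> 'm option) \<Rightarrow> ('a list \<Rightarrow> 'm option))"
  where "inj_res R M = (SOME (I, d). \<exists>\<epsilon>. injective_resolution R M I d \<epsilon>)"

text \<open>Cohomology of a cochain complex \<open>0 \<rightarrow> C 0 \<rightarrow> C 1 \<rightarrow> \<dots>\<close>.\<close>

definition cohomology ::
  "(nat \<Rightarrow> ('a, 'm) module) \<Rightarrow> (nat \<Rightarrow> 'm \<Rightarrow> 'm) \<Rightarrow> nat \<Rightarrow> ('a, 'm set) module"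
  where "cohomology C d i =
    quotient_module ((C i)\<lparr>carrier := a_kernel (C i) (C (Suc i)) (d i)\<rparr>)
      (case i of 0 \<Rightarrow> {\<zero>\<^bsub>C 0\<^esub>} | Suc j \<Rightarrow> d j ` carrier (C j))"

text \<open>Ext as the right derived functor of \<open>Hom(M, -)\<close>.\<close>

definition Ext ::
  "('a, 'r) ring_scheme \<Rightarrow> nat \<Rightarrow> ('a, 'm, 'c) module_scheme \<Rightarrow> ('a, 'n, 'd) module_scheme \<Rightarrow>
   ('a, ('m \<Rightarrow> 'a list \<Rightarrow> 'n option) set) module"
  where "Ext R i M N = (case inj_res R N of (I, d) \<Rightarrow>
    cohomology (\<lambda>n. Hom_module R M (I n)) (\<lambda>n. compose (carrier M) (d n)) i)"


section \<open>Local cohomology\<close>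

definition torsion_submodule ::
  "('a, 'r) ring_scheme \<Rightarrow> 'a set \<Rightarrow> ('a, 'm, 'c) module_scheme \<Rightarrow> 'm set"
  where "torsion_submodule R \<aa> M =
    {x \<in> carrier M. \<exists>n::nat. \<forall>r\<in>\<aa> [^]\<^bsub>ideals_set R\<^esub> n. r \<odot>\<^bsub>M\<^esub> x = \<zero>\<^bsub>M\<^esub>}"

definition torsion_functor ::
  "('a, 'r) ring_scheme \<Rightarrow> 'a set \<Rightarrow> ('a, 'm, 'c) module_scheme \<Rightarrow> ('a, 'm, 'c) module_scheme"
  where "torsion_functor R \<aa> M = M\<lparr>carrier := torsion_submodule R \<aa> M\<rparr>"

text \<open>Local cohomology as the right derived functor of the torsion functor, which acts on
  morphisms by restriction.\<close>

definition local_cohomology ::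
  "('a, 'r) ring_scheme \<Rightarrow> 'a set \<Rightarrow> nat \<Rightarrow> ('a, 'm, 'c) module_scheme \<Rightarrow>
   ('a, ('a list \<Rightarrow> 'm option) set) module"
  where "local_cohomology R \<aa> i M = (case inj_res R M of (I, d) \<Rightarrow>
    cohomology (\<lambda>n. torsion_functor R \<aa> (I n)) d i)"

text \<open>If there is a largest \<open>i\<close> with non-zero local cohomology, this supremum is that \<open>i\<close>.
  Otherwise it is \<open>-\<infinity>\<close> (all modules vanish) or \<open>\<infinity>\<close>.\<close>

definition cd :: "('a, 'r) ring_scheme \<Rightarrow> 'a set \<Rightarrow> ('a, 'm, 'c) module_scheme \<Rightarrow> ereal"
  where "cd R \<aa> M = Sup {ereal (real i) | i. \<not> zero_module (local_cohomology R \<aa> i M)}"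


section \<open>Support and cofiniteness\<close>

definition fraction_rel ::
  "'a set \<Rightarrow> ('a, 'm, 'c) module_scheme \<Rightarrow> (('m \<times> 'a) \<times> ('m \<times> 'a)) set"
  where "fraction_rel S M =
    {((x, s), (y, t)). x \<in> carrier M \<and> s \<in> S \<and> y \<in> carrier M \<and> t \<in> S \<and>
       (\<exists>u\<in>S. u \<odot>\<^bsub>M\<^esub> (t \<odot>\<^bsub>M\<^esub> x) = u \<odot>\<^bsub>M\<^esub> (s \<odot>\<^bsub>M\<^esub> y))}"

text \<open>The module of fractions with denominators in \<open>S\<close>, regarded as an \<open>R\<close>-module.\<close>

definition localization ::
  "('a, 'r) ring_scheme \<Rightarrow> 'a set \<Rightarrow> ('a, 'm, 'c) module_scheme \<Rightarrow> ('a, ('m \<times> 'a) set) module"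
  where "localization R S M =
    \<lparr>carrier = (carrier M \<times> S) // fraction_rel S M,
     monoid.mult = (\<lambda>_ _. fraction_rel S M `` {(\<zero>\<^bsub>M\<^esub>, \<one>\<^bsub>R\<^esub>)}),
     one = fraction_rel S M `` {(\<zero>\<^bsub>M\<^esub>, \<one>\<^bsub>R\<^esub>)},
     ring.zero = fraction_rel S M `` {(\<zero>\<^bsub>M\<^esub>, \<one>\<^bsub>R\<^esub>)},
     ring.add = (\<lambda>A B. \<Union>(x, s)\<in>A. \<Union>(y, t)\<in>B.
       fraction_rel S M `` {((t \<odot>\<^bsub>M\<^esub> x) \<oplus>\<^bsub>M\<^esub> (s \<odot>\<^bsub>M\<^esub> y), s \<otimes>\<^bsub>R\<^esub> t)}),
     smult = (\<lambda>r A. \<Union>(x, s)\<in>A. fraction_rel S M `` {(r \<odot>\<^bsub>M\<^esub> x, s)})\<rparr>"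

definition Supp :: "('a, 'r) ring_scheme \<Rightarrow> ('a, 'm, 'c) module_scheme \<Rightarrow> 'a set set"
  where "Supp R M = {\<pp>. primeideal \<pp> R \<and> \<not> zero_module (localization R (carrier R - \<pp>) M)}"

definition vanishing_locus :: "('a, 'r) ring_scheme \<Rightarrow> 'a set \<Rightarrow> 'a set set"
  where "vanishing_locus R \<aa> = {\<pp>. primeideal \<pp> R \<and> \<aa> \<subseteq> \<pp>}"

definition cofinite_module :: "('a, 'r) ring_scheme \<Rightarrow> 'a set \<Rightarrow> ('a, 'm, 'c) module_scheme \<Rightarrow> bool"
  where "cofinite_module R \<aa> Y \<longleftrightarrow>
    Supp R Y \<subseteq> vanishing_locus R \<aa> \<and>
    (\<forall>i. finitely_generated R (Ext R i (residue_module R \<aa>) Y))"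

end

theory Submission
  imports Defs "HOL-Algebra.IntRing"
begin

text \<open>
  Let \<open>I\<close> be an injective resolution of \<open>X\<close>. Over a Noetherian ring the torsion submodules
  \<open>\<Gamma>(I n)\<close> are injective, hence direct summands, and since higher local cohomology vanishes the
  complements \<open>I n / \<Gamma>(I n)\<close> form an injective resolution of a module \<open>D\<close> (the ideal transform) with
  an exact sequence \<open>0 \<rightarrow> X/\<Gamma>(X) \<rightarrow> D \<rightarrow> H \<rightarrow> 0\<close>, where \<open>H\<close> is the first local cohomology module.
  Elements annihilated by \<open>\<aa>\<close> are torsion, so \<open>Ext i (R/\<aa>) D = 0\<close> for all \<open>i\<close>, and the connecting maps of
  the long exact sequence are isomorphisms. On the level of complexes, the shifted mapping cone of a
  lift of \<open>D \<rightarrow> H\<close> is an injective resolution of \<open>X/\<Gamma>(X)\<close>, and \<open>Hom (R/\<aa>)\<close> only sees its part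
  coming from the resolution of \<open>H\<close>.

  If \<open>X\<close> is finitely generated, the local cohomology modules other than \<open>H\<close> are finitely generated or
  zero, and \<open>Ext i (R/\<aa>) N\<close> is finitely generated for every finitely generated \<open>N\<close>.
\<close>

section \<open>Submodules, homomorphisms and quotients\<close>

text \<open>Ext and local cohomology are taken from one chosen resolution in one fixed type, whereas
  the cone lives in a product type. So the chosen resolution must be shown to exist in its type, and
  independence of the resolution must be proved across types. Baer's criterion makes this possible:
  it tests ideals of \<open>R\<close> only and involves no type of test modules. The only first
  argument of Ext is \<open>R/\<aa>\<close>, and evaluation at the coset of one identifies
  homomorphisms from it with elements killed by \<aa>. The cohomology of such elements, inside any
  resolution, therefore replaces Hom modules in every comparison. Cohomological dimension 1 enters
  through vanishing from degree 2 on, which makes the torsion-free complex exact in positive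
  degrees; the first local cohomology is what remains between \<open>X/\<Gamma>(X)\<close> and
  \<open>D\<close>. The terms of an injective resolution are rarely finitely generated, so
  finiteness of Ext cannot be read off from them. It is obtained by shifting degrees with an ideal
  \<open>b\<close> in the first argument, which forces an induction over all ideals of
  \<open>R\<close> at once.\<close>

lemma module_homsI:
  assumes "\<And>x. x \<in> carrier M \<Longrightarrow> f x \<in> carrier N"
    and "\<And>x y. x \<in> carrier M \<Longrightarrow> y \<in> carrier M \<Longrightarrow> f (x \<oplus>\<^bsub>M\<^esub> y) = f x \<oplus>\<^bsub>N\<^esub> f y"
    and "\<And>r x. r \<in> carrier R \<Longrightarrow> x \<in> carrier M \<Longrightarrow> f (r \<odot>\<^bsub>M\<^esub> x) = r \<odot>\<^bsub>N\<^esub> f x"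
  shows "f \<in> module_homs R M N"
  using assms unfolding module_homs_def by blast

lemma homs_closed: "f \<in> module_homs R M N \<Longrightarrow> x \<in> carrier M \<Longrightarrow> f x \<in> carrier N"
  unfolding module_homs_def by blast

lemma homs_add:
  "f \<in> module_homs R M N \<Longrightarrow> x \<in> carrier M \<Longrightarrow> y \<in> carrier M \<Longrightarrow> f (x \<oplus>\<^bsub>M\<^esub> y) = f x \<oplus>\<^bsub>N\<^esub> f y"
  unfolding module_homs_def by blast

lemma homs_smult:
  "f \<in> module_homs R M N \<Longrightarrow> r \<in> carrier R \<Longrightarrow> x \<in> carrier M \<Longrightarrow> f (r \<odot>\<^bsub>M\<^esub> x) = r \<odot>\<^bsub>N\<^esub> f x"
  unfolding module_homs_def by blast

lemma homs_zero:
  assumes "f \<in> module_homs R M N" "module R M" "module R N"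
  shows "f \<zero>\<^bsub>M\<^esub> = \<zero>\<^bsub>N\<^esub>"
proof -
  interpret M: module R M by fact
  interpret N: module R N by fact
  have "f \<zero>\<^bsub>M\<^esub> = f (\<zero>\<^bsub>R\<^esub> \<odot>\<^bsub>M\<^esub> \<zero>\<^bsub>M\<^esub>)" by simp
  also have "\<dots> = \<zero>\<^bsub>N\<^esub>"
    using assms(1) by (simp add: homs_smult[OF assms(1)] homs_closed[OF assms(1)] del: M.smult_l_null M.smult_r_null)
  finally show ?thesis .
qed

lemma homs_neg:
  assumes "f \<in> module_homs R M N" "module R M" "module R N" "x \<in> carrier M"
  shows "f (\<ominus>\<^bsub>M\<^esub> x) = \<ominus>\<^bsub>N\<^esub> f x"
proof -
  interpret M: module R M by fact
  interpret N: module R N by fact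
  have "f (\<ominus>\<^bsub>M\<^esub> x) \<oplus>\<^bsub>N\<^esub> f x = f (\<ominus>\<^bsub>M\<^esub> x \<oplus>\<^bsub>M\<^esub> x)"
    using homs_add[OF assms(1)] assms(4) by simp
  also have "\<dots> = \<zero>\<^bsub>N\<^esub>" using assms homs_zero by (simp add: M.M.l_neg)
  finally show ?thesis using homs_closed[OF assms(1)] assms(4) by (simp add: N.M.minus_equality)
qed

lemma homs_minus:
  assumes "f \<in> module_homs R M N" "module R M" "module R N" "x \<in> carrier M" "y \<in> carrier M"
  shows "f (x \<ominus>\<^bsub>M\<^esub> y) = f x \<ominus>\<^bsub>N\<^esub> f y"
proof -
  interpret M: module R M by fact
  show ?thesis unfolding a_minus_def
    using assms homs_neg[OF assms(1-3)] homs_add[OF assms(1)] by simp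
qed

lemma homs_comp:
  "f \<in> module_homs R M N \<Longrightarrow> g \<in> module_homs R N P \<Longrightarrow> (\<lambda>x. g (f x)) \<in> module_homs R M P"
  by (rule module_homsI) (simp_all add: homs_closed homs_add homs_smult)

lemma homs_id: "(\<lambda>x. x) \<in> module_homs R M M"
  unfolding module_homs_def by auto

lemma homs_zero_map:
  assumes "module R N"
  shows "(\<lambda>x. \<zero>\<^bsub>N\<^esub>) \<in> module_homs R M N"
proof -
  interpret N: module R N by fact
  show ?thesis by (rule module_homsI) auto
qed

lemma homs_smul:
  assumes "module R N" "f \<in> module_homs R M N" "r \<in> carrier R"
  shows "(\<lambda>x. r \<odot>\<^bsub>N\<^esub> f x) \<in> module_homs R M N"
proof -
  interpret N: module R N by fact
  note c = homs_closed[OF assms(2)]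
  show ?thesis
    by (rule module_homsI)
      (auto simp: c assms(3) homs_add[OF assms(2)] homs_smult[OF assms(2)]
        N.smult_r_distr N.smult_assoc1[symmetric] N.R.m_comm)
qed

lemma homs_diff:
  assumes "module R N" "f \<in> module_homs R M N" "g \<in> module_homs R M N"
  shows "(\<lambda>x. f x \<ominus>\<^bsub>N\<^esub> g x) \<in> module_homs R M N"
proof -
  interpret N: module R N by fact
  note c = homs_closed[OF assms(2)] homs_closed[OF assms(3)]
  show ?thesis
    by (rule module_homsI)
      (auto simp: c a_minus_def homs_add[OF assms(2)] homs_add[OF assms(3)] homs_smult[OF assms(2)]
        homs_smult[OF assms(3)] N.smult_r_distr N.smult_r_minus N.M.minus_add N.M.a_ac)
qed

section \<open>Submodules\<close>

lemma submodule_subset: "submodule H R M \<Longrightarrow> x \<in> H \<Longrightarrow> x \<in> carrier M"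
  using subgroup.subset[of H "add_monoid M"] unfolding submodule_def by auto

lemma submodule_zero: "submodule H R M \<Longrightarrow> \<zero>\<^bsub>M\<^esub> \<in> H"
  using subgroup.one_closed[of H "add_monoid M"] unfolding submodule_def by auto

lemma submodule_add: "submodule H R M \<Longrightarrow> x \<in> H \<Longrightarrow> y \<in> H \<Longrightarrow> x \<oplus>\<^bsub>M\<^esub> y \<in> H"
  using subgroup.m_closed[of H "add_monoid M"] unfolding submodule_def by auto

lemma submodule_smult: "submodule H R M \<Longrightarrow> r \<in> carrier R \<Longrightarrow> x \<in> H \<Longrightarrow> r \<odot>\<^bsub>M\<^esub> x \<in> H"
  by (rule submodule.smult_closed)

lemma submodule_neg: "submodule H R M \<Longrightarrow> x \<in> H \<Longrightarrow> \<ominus>\<^bsub>M\<^esub> x \<in> H"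
  using subgroup.m_inv_closed[of H "add_monoid M"] unfolding submodule_def by (auto simp: a_inv_def)

lemma submodule_minus: "submodule H R M \<Longrightarrow> x \<in> H \<Longrightarrow> y \<in> H \<Longrightarrow> x \<ominus>\<^bsub>M\<^esub> y \<in> H"
  unfolding a_minus_def by (simp add: submodule_add submodule_neg)

lemmas submoduleD = submodule_subset submodule_zero submodule_add submodule_smult submodule_neg
  submodule_minus

text \<open>Scaling by the negative of one supplies the closure under negation that
  \<open>submoduleI\<close> asks for.\<close>

lemma submoduleI':
  assumes "module R M" "\<And>x. x \<in> H \<Longrightarrow> x \<in> carrier M" "\<zero>\<^bsub>M\<^esub> \<in> H"
    "\<And>x y. x \<in> H \<Longrightarrow> y \<in> H \<Longrightarrow> x \<oplus>\<^bsub>M\<^esub> y \<in> H"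
    "\<And>r x. r \<in> carrier R \<Longrightarrow> x \<in> H \<Longrightarrow> r \<odot>\<^bsub>M\<^esub> x \<in> H"
  shows "submodule H R M"
proof -
  interpret M: module R M by fact
  show ?thesis
  proof (rule M.submoduleI)
    fix a assume a: "a \<in> H"
    have "(\<ominus>\<^bsub>R\<^esub> \<one>\<^bsub>R\<^esub>) \<odot>\<^bsub>M\<^esub> a = \<ominus>\<^bsub>M\<^esub> a" using assms(2)[OF a] by (simp add: M.smult_l_minus)
    then show "\<ominus>\<^bsub>M\<^esub> a \<in> H" using assms(5)[of "\<ominus>\<^bsub>R\<^esub> \<one>\<^bsub>R\<^esub>" a] a by simp
  qed (use assms in auto)
qed

lemma restrict_module: "submodule H R M \<Longrightarrow> module R M \<Longrightarrow> module R (M\<lparr>carrier := H\<rparr>)"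
  by (rule submodule.submodule_is_module)

lemma homs_into:
  "f \<in> module_homs R M N \<Longrightarrow> (\<And>x. x \<in> carrier M \<Longrightarrow> f x \<in> H) \<Longrightarrow> f \<in> module_homs R M (N\<lparr>carrier := H\<rparr>)"
  unfolding module_homs_def by auto

lemma homs_out:
  assumes "f \<in> module_homs R M (N\<lparr>carrier := H\<rparr>)" "H \<subseteq> carrier N"
  shows "f \<in> module_homs R M N"
  using assms unfolding module_homs_def by auto

lemma homs_restrict:
  "f \<in> module_homs R M N \<Longrightarrow> H \<subseteq> carrier M \<Longrightarrow> f \<in> module_homs R (M\<lparr>carrier := H\<rparr>) N"
  by (rule module_homsI) (auto simp: homs_closed homs_add homs_smult subset_eq)

lemma submodule_restrict:
  assumes "module R M" "submodule V R M" "submodule W R M" "W \<subseteq> V"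
  shows "submodule W R (M\<lparr>carrier := V\<rparr>)"
  using assms(4) submoduleD[OF assms(3)]
  by (intro submoduleI'[OF restrict_module[OF assms(2,1)]]) auto

lemma submodule_trans:
  assumes "module R M" "submodule V R M" "submodule W R (M\<lparr>carrier := V\<rparr>)"
  shows "submodule W R M"
  using submoduleD(1)[OF assms(2)] submoduleD[OF assms(3)]
  by (intro submoduleI'[OF assms(1)]) auto

lemma submodule_inter:
  assumes "module R M" "submodule V R M" "submodule W R M"
  shows "submodule (V \<inter> W) R M"
  using submoduleD[OF assms(2)] submoduleD[OF assms(3)] by (intro submoduleI'[OF assms(1)]) auto

lemma submodule_vimage:
  assumes "module R M" "module R N" "f \<in> module_homs R M N" "submodule W R N"
  shows "submodule {x \<in> carrier M. f x \<in> W} R M"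
proof -
  interpret M: module R M by fact
  show ?thesis
    using submoduleD[OF assms(4)]
    by (intro submoduleI'[OF assms(1)])
      (auto simp: homs_zero[OF assms(3,1,2)] homs_add[OF assms(3)] homs_smult[OF assms(3)])
qed

lemma submodule_image:
  assumes "module R M" "module R N" "f \<in> module_homs R M N" "submodule V R M"
  shows "submodule (f ` V) R N"
proof (rule submoduleI'[OF assms(2)])
  note V = submoduleD[OF assms(4)]
  fix x assume "x \<in> f ` V" then show "x \<in> carrier N" using V(1) homs_closed[OF assms(3)] by auto
next
  note V = submoduleD[OF assms(4)]
  show "\<zero>\<^bsub>N\<^esub> \<in> f ` V" using V(2) homs_zero[OF assms(3,1,2)] by (metis imageI)
  fix x y assume "x \<in> f ` V" "y \<in> f ` V"
  then obtain x' y' where "x = f x'" "y = f y'" "x' \<in> V" "y' \<in> V" by auto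
  then show "x \<oplus>\<^bsub>N\<^esub> y \<in> f ` V" using V(1,3) homs_add[OF assms(3)] by (metis imageI)
next
  note V = submoduleD[OF assms(4)]
  fix r x assume "r \<in> carrier R" "x \<in> f ` V"
  then obtain x' where "x = f x'" "x' \<in> V" by auto
  then show "r \<odot>\<^bsub>N\<^esub> x \<in> f ` V" using V(1,4) homs_smult[OF assms(3)] \<open>r \<in> carrier R\<close> by (metis imageI)
qed

lemma submodule_zero_set: "module R M \<Longrightarrow> submodule {\<zero>\<^bsub>M\<^esub>} R M"
proof -
  assume "module R M"
  then interpret M: module R M .
  show ?thesis by (intro submoduleI') (auto intro: M.module_axioms)
qed

lemma submodule_carrier: "module R M \<Longrightarrow> submodule (carrier M) R M"
  by (rule module.carrier_is_submodule)

lemma submodule_set_add: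
  assumes "module R M" "submodule V R M" "submodule W R M"
  shows "submodule {x \<oplus>\<^bsub>M\<^esub> y | x y. x \<in> V \<and> y \<in> W} R M"
proof -
  interpret M: module R M by fact
  note V = submoduleD[OF assms(2)] and W = submoduleD[OF assms(3)]
  show ?thesis
  proof (rule submoduleI'[OF assms(1)], goal_cases)
    case 1 then show ?case using V W by auto
  next
    case 2 then show ?case using V(2) W(2) by force
  next
    case (3 x y)
    then obtain a b c d where *: "x = a \<oplus>\<^bsub>M\<^esub> b" "y = c \<oplus>\<^bsub>M\<^esub> d" "a \<in> V" "c \<in> V" "b \<in> W" "d \<in> W" by auto
    then have "x \<oplus>\<^bsub>M\<^esub> y = (a \<oplus>\<^bsub>M\<^esub> c) \<oplus>\<^bsub>M\<^esub> (b \<oplus>\<^bsub>M\<^esub> d)" using V(1) W(1) by (simp add: M.M.a_ac)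
    then show ?case using V(3) W(3) * by blast
  next
    case (4 r x)
    then obtain a b where *: "x = a \<oplus>\<^bsub>M\<^esub> b" "a \<in> V" "b \<in> W" by auto
    then have "r \<odot>\<^bsub>M\<^esub> x = r \<odot>\<^bsub>M\<^esub> a \<oplus>\<^bsub>M\<^esub> r \<odot>\<^bsub>M\<^esub> b" using V(1) W(1) 4 by (simp add: M.smult_r_distr)
    then show ?case using V(4) W(4) * 4 by blast
  qed
qed

text \<open>Of two members of a chain one contains the other, so both summands lie in a common
  member. This gives the upper bound in both applications of Zorn's lemma.\<close>

lemma submodule_Union_chain:
  assumes M: "module R M" and ne: "\<C> \<noteq> {}" and ch: "subset.chain A \<C>"
    and sub: "\<And>G. G \<in> \<C> \<Longrightarrow> submodule G R M"
  shows "submodule (\<Union>\<C>) R M"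
proof (rule submoduleI'[OF M])
  fix x y assume "x \<in> \<Union>\<C>" "y \<in> \<Union>\<C>"
  then obtain G H where GH: "x \<in> G" "y \<in> H" "G \<in> \<C>" "H \<in> \<C>" by auto
  then have "G \<subseteq> H \<or> H \<subseteq> G" using ch unfolding subset.chain_def by auto
  then show "x \<oplus>\<^bsub>M\<^esub> y \<in> \<Union>\<C>"
  proof
    assume "G \<subseteq> H"
    then have "x \<oplus>\<^bsub>M\<^esub> y \<in> H" using GH submoduleD(3)[OF sub[OF GH(4)]] by auto
    then show ?thesis using GH by auto
  next
    assume "H \<subseteq> G"
    then have "x \<oplus>\<^bsub>M\<^esub> y \<in> G" using GH submoduleD(3)[OF sub[OF GH(3)]] by auto
    then show ?thesis using GH by auto
  qed
next
  fix r x assume "r \<in> carrier R" "x \<in> \<Union>\<C>"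
  then obtain G where G: "x \<in> G" "G \<in> \<C>" by auto
  then have "r \<odot>\<^bsub>M\<^esub> x \<in> G" using submoduleD(4)[OF sub[OF G(2)]] \<open>r \<in> carrier R\<close> by simp
  then show "r \<odot>\<^bsub>M\<^esub> x \<in> \<Union>\<C>" using G by auto
next
  obtain G where "G \<in> \<C>" using ne by auto
  then show "\<zero>\<^bsub>M\<^esub> \<in> \<Union>\<C>" using submoduleD(2)[OF sub] by auto
qed (use submoduleD(1)[OF sub] in auto)

lemma homs_eq_iff_diff:
  assumes "module R M" "x \<in> carrier M" "y \<in> carrier M"
  shows "x \<ominus>\<^bsub>M\<^esub> y = \<zero>\<^bsub>M\<^esub> \<longleftrightarrow> x = y"
proof -
  interpret M: module R M by fact
  show ?thesis using assms(2,3) by (metis M.M.minus_eq M.M.r_neg M.M.minus_unique M.M.a_inv_closed M.M.minus_minus M.M.a_comm)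
qed

text \<open>Elements with equal image under \<open>p\<close> differ by an element of its kernel, so
  \<open>g\<close> is constant on the fibres. The map \<open>p\<close> may be any surjection: it is
  later a coset projection, a map onto its image, and a summation map.\<close>

lemma hom_factor:
  assumes M: "module R M" and Q: "module R Q" and N: "module R N"
    and p: "p \<in> module_homs R M Q" "p ` carrier M = carrier Q"
    and g: "g \<in> module_homs R M N"
    and ker: "\<And>x. x \<in> carrier M \<Longrightarrow> p x = \<zero>\<^bsub>Q\<^esub> \<Longrightarrow> g x = \<zero>\<^bsub>N\<^esub>"
  obtains h where "h \<in> module_homs R Q N" "\<And>x. x \<in> carrier M \<Longrightarrow> h (p x) = g x"
proof -
  interpret M: module R M by fact
  interpret Q: module R Q by fact
  interpret N: module R N by fact
  have eq: "g x = g y" if "x \<in> carrier M" "y \<in> carrier M" "p x = p y" for x y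
  proof -
    have "p (x \<ominus>\<^bsub>M\<^esub> y) = \<zero>\<^bsub>Q\<^esub>"
      using that homs_minus[OF p(1) M Q] homs_closed[OF p(1)] homs_eq_iff_diff[OF Q] by simp
    then have "g x \<ominus>\<^bsub>N\<^esub> g y = \<zero>\<^bsub>N\<^esub>" using ker[of "x \<ominus>\<^bsub>M\<^esub> y"] that homs_minus[OF g M N] by simp
    then show ?thesis using that homs_closed[OF g] homs_eq_iff_diff[OF N] by simp
  qed
  define h where "h y = g (inv_into (carrier M) p y)" for y
  have h: "h (p x) = g x" if "x \<in> carrier M" for x
    unfolding h_def using that eq[of "inv_into (carrier M) p (p x)" x] by (simp add: f_inv_into_f inv_into_into)
  have "h \<in> module_homs R Q N"
  proof (rule module_homsI)
    fix y z assume "y \<in> carrier Q" "z \<in> carrier Q"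
    then obtain u v where uv: "y = p u" "z = p v" "u \<in> carrier M" "v \<in> carrier M" using p(2) by (metis imageE)
    then show "h (y \<oplus>\<^bsub>Q\<^esub> z) = h y \<oplus>\<^bsub>N\<^esub> h z"
      using h[of "u \<oplus>\<^bsub>M\<^esub> v"] h[of u] h[of v] homs_add[OF p(1)] homs_add[OF g] by simp
  next
    fix y assume "y \<in> carrier Q"
    then obtain u where uv: "y = p u" "u \<in> carrier M" using p(2) by (metis imageE)
    then show "h y \<in> carrier N" using h homs_closed[OF g] by simp
    fix r assume "r \<in> carrier R"
    then show "h (r \<odot>\<^bsub>Q\<^esub> y) = r \<odot>\<^bsub>N\<^esub> h y"
      using uv h[of "r \<odot>\<^bsub>M\<^esub> u"] h[of u] homs_smult[OF p(1)] homs_smult[OF g] by simp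
  qed
  then show ?thesis using h that by blast
qed

lemma module_add_diff_cancel:
  assumes "module R M" "x \<in> carrier M" "y \<in> carrier M"
  shows "(x \<oplus>\<^bsub>M\<^esub> y) \<ominus>\<^bsub>M\<^esub> x = y"
proof -
  interpret M: module R M by fact
  show ?thesis using assms(2,3) by (simp add: a_minus_def M.M.a_comm[of "x \<oplus>\<^bsub>M\<^esub> y"] M.M.r_neg1)
qed

lemma module_iso_sym:
  assumes M: "module R M" and iso: "module_iso R M N"
  shows "module_iso R N M"
proof -
  interpret M: module R M by fact
  from iso obtain f where f: "f \<in> module_homs R M N" "bij_betw f (carrier M) (carrier N)"
    unfolding module_iso_def by auto
  let ?g = "inv_into (carrier M) f"
  have im: "f ` carrier M = carrier N" and inj: "inj_on f (carrier M)" using f(2) by (auto simp: bij_betw_def)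
  have gf: "?g (f x) = x" if "x \<in> carrier M" for x using inj that by simp
  have "?g \<in> module_homs R N M"
  proof (rule module_homsI)
    fix y z assume "y \<in> carrier N" "z \<in> carrier N"
    then obtain u v where uv: "y = f u" "z = f v" "u \<in> carrier M" "v \<in> carrier M" using im by (metis imageE)
    then show "?g (y \<oplus>\<^bsub>N\<^esub> z) = ?g y \<oplus>\<^bsub>M\<^esub> ?g z"
      using gf[of "u \<oplus>\<^bsub>M\<^esub> v"] homs_add[OF f(1)] gf by simp
  next
    fix y assume "y \<in> carrier N"
    then obtain u where uv: "y = f u" "u \<in> carrier M" using im by (metis imageE)
    then show "?g y \<in> carrier M" using gf by simp
    fix r assume "r \<in> carrier R"
    then show "?g (r \<odot>\<^bsub>N\<^esub> y) = r \<odot>\<^bsub>M\<^esub> ?g y"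
      using uv gf[of "r \<odot>\<^bsub>M\<^esub> u"] gf homs_smult[OF f(1)] by simp
  qed
  then show ?thesis unfolding module_iso_def using bij_betw_inv_into[OF f(2)] by blast
qed

lemma module_iso_trans:
  assumes "module_iso R M N" "module_iso R N P"
  shows "module_iso R M P"
proof -
  from assms obtain f g where "f \<in> module_homs R M N" "bij_betw f (carrier M) (carrier N)"
    "g \<in> module_homs R N P" "bij_betw g (carrier N) (carrier P)" unfolding module_iso_def by auto
  then have "(\<lambda>x. g (f x)) \<in> module_homs R M P" "bij_betw (\<lambda>x. g (f x)) (carrier M) (carrier P)"
    using homs_comp[of f R M N g P] bij_betw_trans[of f _ _ g] by (auto simp: comp_def)
  then show ?thesis unfolding module_iso_def by blast
qed

text \<open>Each surjection factors through the other, and the two factors are mutually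
  inverse.\<close>

lemma module_isoI_surj:
  assumes M: "module R M" and Q: "module R Q" and N: "module R N"
    and p: "p \<in> module_homs R M Q" "p ` carrier M = carrier Q"
    and q: "q \<in> module_homs R M N" "q ` carrier M = carrier N"
    and ker: "\<And>x. x \<in> carrier M \<Longrightarrow> p x = \<zero>\<^bsub>Q\<^esub> \<longleftrightarrow> q x = \<zero>\<^bsub>N\<^esub>"
  shows "module_iso R Q N"
proof -
  obtain h where h: "h \<in> module_homs R Q N" "\<And>x. x \<in> carrier M \<Longrightarrow> h (p x) = q x"
    using hom_factor[OF M Q N p q(1)] ker by metis
  obtain k where k: "k \<in> module_homs R N Q" "\<And>x. x \<in> carrier M \<Longrightarrow> k (q x) = p x"
    using hom_factor[OF M N Q q p(1)] ker by metis
  have "bij_betw h (carrier Q) (carrier N)"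
  proof (rule bij_betw_byWitness[where f' = k])
    show "\<forall>a\<in>carrier Q. k (h a) = a" using p(2) h(2) k(2) by (metis imageE)
    show "\<forall>a'\<in>carrier N. h (k a') = a'" using q(2) h(2) k(2) by (metis imageE)
  qed (use homs_closed[OF h(1)] homs_closed[OF k(1)] in auto)
  then show ?thesis unfolding module_iso_def using h(1) by blast
qed

text \<open>Every axiom passes through \<open>i\<close>, because the operations of \<open>T\<close>
  are computed on preimages. Since \<open>i\<close> may fail to be injective, this covers coset maps
  as well as copies along injections.\<close>

lemma module_image:
  assumes M: "module R M" and c: "carrier T = i ` carrier M"
    and add: "\<And>x y. x \<in> carrier M \<Longrightarrow> y \<in> carrier M \<Longrightarrow> i x \<oplus>\<^bsub>T\<^esub> i y = i (x \<oplus>\<^bsub>M\<^esub> y)"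
    and smult: "\<And>r x. r \<in> carrier R \<Longrightarrow> x \<in> carrier M \<Longrightarrow> r \<odot>\<^bsub>T\<^esub> i x = i (r \<odot>\<^bsub>M\<^esub> x)"
    and zero: "\<zero>\<^bsub>T\<^esub> = i \<zero>\<^bsub>M\<^esub>"
  shows "module R T"
proof -
  interpret M: module R M by (fact M)
  have ex: "\<exists>x'\<in>carrier M. x = i x'" if "x \<in> carrier T" for x using that c by auto
  show ?thesis
  proof (rule moduleI)
    show "cring R" by (rule M.is_cring)
    show "abelian_group T"
    proof (rule abelian_groupI)
      fix x assume "x \<in> carrier T"
      then obtain x' where x: "x = i x'" "x' \<in> carrier M" using ex by blast
      show "\<zero>\<^bsub>T\<^esub> \<oplus>\<^bsub>T\<^esub> x = x" using x by (simp add: zero add)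
      have "i (\<ominus>\<^bsub>M\<^esub> x') \<oplus>\<^bsub>T\<^esub> x = \<zero>\<^bsub>T\<^esub>" using x by (simp add: zero add M.M.l_neg)
      moreover have "i (\<ominus>\<^bsub>M\<^esub> x') \<in> carrier T" using x c by simp
      ultimately show "\<exists>y\<in>carrier T. y \<oplus>\<^bsub>T\<^esub> x = \<zero>\<^bsub>T\<^esub>" by blast
      fix y assume "y \<in> carrier T"
      then obtain y' where y: "y = i y'" "y' \<in> carrier M" using ex by blast
      show "x \<oplus>\<^bsub>T\<^esub> y \<in> carrier T" "x \<oplus>\<^bsub>T\<^esub> y = y \<oplus>\<^bsub>T\<^esub> x" using x y c by (simp_all add: add M.M.a_comm)
      fix z assume "z \<in> carrier T"
      then obtain z' where z: "z = i z'" "z' \<in> carrier M" using ex by blast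
      show "x \<oplus>\<^bsub>T\<^esub> y \<oplus>\<^bsub>T\<^esub> z = x \<oplus>\<^bsub>T\<^esub> (y \<oplus>\<^bsub>T\<^esub> z)" using x y z by (simp add: add M.M.a_assoc)
    qed (use zero c in simp)
  next
    fix a x assume a: "a \<in> carrier R" and "x \<in> carrier T"
    then obtain x' where x: "x = i x'" "x' \<in> carrier M" using ex by blast
    show "a \<odot>\<^bsub>T\<^esub> x \<in> carrier T" using x a c by (simp add: smult)
    fix b assume b: "b \<in> carrier R"
    show "(a \<oplus>\<^bsub>R\<^esub> b) \<odot>\<^bsub>T\<^esub> x = a \<odot>\<^bsub>T\<^esub> x \<oplus>\<^bsub>T\<^esub> b \<odot>\<^bsub>T\<^esub> x"
      using x a b by (simp add: smult add M.smult_l_distr)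
    show "(a \<otimes>\<^bsub>R\<^esub> b) \<odot>\<^bsub>T\<^esub> x = a \<odot>\<^bsub>T\<^esub> (b \<odot>\<^bsub>T\<^esub> x)"
      using x a b by (simp add: smult M.smult_assoc1)
  next
    fix x assume "x \<in> carrier T"
    then obtain x' where x: "x = i x'" "x' \<in> carrier M" using ex by blast
    then show "\<one>\<^bsub>R\<^esub> \<odot>\<^bsub>T\<^esub> x = x" by (simp add: smult)
  next
    fix a x y assume a: "a \<in> carrier R" and "x \<in> carrier T" "y \<in> carrier T"
    then obtain x' y' where x: "x = i x'" "x' \<in> carrier M" "y = i y'" "y' \<in> carrier M" using ex by metis
    then show "a \<odot>\<^bsub>T\<^esub> (x \<oplus>\<^bsub>T\<^esub> y) = a \<odot>\<^bsub>T\<^esub> x \<oplus>\<^bsub>T\<^esub> a \<odot>\<^bsub>T\<^esub> y"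
      using a by (simp add: smult add M.smult_r_distr)
  qed
qed

section \<open>Quotient modules\<close>

context
  fixes R :: "('a, 'r) ring_scheme" and M :: "('a, 'm, 'c) module_scheme" and W
  assumes M: "module R M" and W: "submodule W R M"
begin

interpretation M: module R M by (fact M)

interpretation W: abelian_subgroup W M
  using W by (intro abelian_subgroupI3 additive_subgroupI) (auto simp: submodule_def M.M.abelian_group_axioms)

lemma proj_eq_iff:
  assumes "x \<in> carrier M" "y \<in> carrier M"
  shows "W +>\<^bsub>M\<^esub> x = W +>\<^bsub>M\<^esub> y \<longleftrightarrow> x \<ominus>\<^bsub>M\<^esub> y \<in> W"
proof
  assume "W +>\<^bsub>M\<^esub> x = W +>\<^bsub>M\<^esub> y"
  then have "x \<in> W +>\<^bsub>M\<^esub> y" using W.a_rcos_self[OF assms(1)] by simp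
  then show "x \<ominus>\<^bsub>M\<^esub> y \<in> W" using assms by (simp add: W.a_rcos_module a_minus_def)
next
  assume "x \<ominus>\<^bsub>M\<^esub> y \<in> W"
  then have "x \<in> W +>\<^bsub>M\<^esub> y" using assms by (simp add: W.a_rcos_module a_minus_def)
  then show "W +>\<^bsub>M\<^esub> x = W +>\<^bsub>M\<^esub> y" using W.a_repr_independence' assms by metis
qed

lemma carrier_quotient: "carrier (quotient_module M W) = (\<lambda>x. W +>\<^bsub>M\<^esub> x) ` carrier M"
  unfolding quotient_module_def by (auto simp: A_RCOSETS_def' )

lemma add_quotient:
  "x \<in> carrier M \<Longrightarrow> y \<in> carrier M \<Longrightarrow>
    (W +>\<^bsub>M\<^esub> x) \<oplus>\<^bsub>quotient_module M W\<^esub> (W +>\<^bsub>M\<^esub> y) = W +>\<^bsub>M\<^esub> (x \<oplus>\<^bsub>M\<^esub> y)"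
  unfolding quotient_module_def by (simp add: W.a_rcos_sum)

lemma zero_quotient: "\<zero>\<^bsub>quotient_module M W\<^esub> = W +>\<^bsub>M\<^esub> \<zero>\<^bsub>M\<^esub>"
  unfolding quotient_module_def using W.a_subset by simp

lemma smult_quotient:
  assumes "x \<in> carrier M" "r \<in> carrier R"
  shows "r \<odot>\<^bsub>quotient_module M W\<^esub> (W +>\<^bsub>M\<^esub> x) = W +>\<^bsub>M\<^esub> (r \<odot>\<^bsub>M\<^esub> x)"
proof -
  \<comment> \<open>Scalar multiplication of cosets is defined as a union over all representatives.
    All sets in this union coincide, and \<open>x\<close> itself witnesses that the union is not
    empty.\<close>
  have "W +>\<^bsub>M\<^esub> (r \<odot>\<^bsub>M\<^esub> y) = W +>\<^bsub>M\<^esub> (r \<odot>\<^bsub>M\<^esub> x)" if "y \<in> W +>\<^bsub>M\<^esub> x" for y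
  proof -
    have y: "y \<in> carrier M" using that assms W.a_elemrcos_carrier by (metis M.M.abelian_group_axioms)
    have "y \<ominus>\<^bsub>M\<^esub> x \<in> W" using that y assms by (simp add: W.a_rcos_module a_minus_def)
    then have "r \<odot>\<^bsub>M\<^esub> (y \<ominus>\<^bsub>M\<^esub> x) \<in> W" using submoduleD(4)[OF W] assms by simp
    moreover have "r \<odot>\<^bsub>M\<^esub> (y \<ominus>\<^bsub>M\<^esub> x) = r \<odot>\<^bsub>M\<^esub> y \<ominus>\<^bsub>M\<^esub> r \<odot>\<^bsub>M\<^esub> x"
      using assms y by (simp add: a_minus_def M.smult_r_distr M.smult_r_minus)
    ultimately show ?thesis using assms y by (simp add: proj_eq_iff)
  qed
  moreover have "x \<in> W +>\<^bsub>M\<^esub> x" using assms W.a_rcos_self by simp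
  ultimately have "(\<Union>y\<in>W +>\<^bsub>M\<^esub> x. W +>\<^bsub>M\<^esub> (r \<odot>\<^bsub>M\<^esub> y)) = W +>\<^bsub>M\<^esub> (r \<odot>\<^bsub>M\<^esub> x)"
    by (intro SUP_eq_const) blast+
  then show ?thesis unfolding quotient_module_def by simp
qed

lemma proj_hom: "(\<lambda>x. W +>\<^bsub>M\<^esub> x) \<in> module_homs R M (quotient_module M W)"
  by (rule module_homsI) (auto simp: carrier_quotient add_quotient smult_quotient)

lemma proj_zero_iff: "x \<in> carrier M \<Longrightarrow> W +>\<^bsub>M\<^esub> x = \<zero>\<^bsub>quotient_module M W\<^esub> \<longleftrightarrow> x \<in> W"
  using proj_eq_iff[of x "\<zero>\<^bsub>M\<^esub>"]
  by (metis zero_quotient a_minus_def M.M.add.inv_one a_inv_def M.M.r_zero M.M.zero_closed)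

lemma module_quotient: "module R (quotient_module M W)"
  by (rule module_image[OF M carrier_quotient]) (simp_all add: add_quotient smult_quotient zero_quotient)

end

text \<open>The homomorphism \<open>h\<close> has to be onto only modulo \<open>U\<close>. Chain
  maps that are invertible up to coboundaries have this property.\<close>

lemma quotient_iso:
  assumes M: "module R M" and N: "module R N" and W: "submodule W R M" and U: "submodule U R N"
    and h: "h \<in> module_homs R M N"
    and ker: "\<And>x. x \<in> carrier M \<Longrightarrow> h x \<in> U \<longleftrightarrow> x \<in> W"
    and surj: "\<And>y. y \<in> carrier N \<Longrightarrow> \<exists>x\<in>carrier M. y \<ominus>\<^bsub>N\<^esub> h x \<in> U"
  shows "module_iso R (quotient_module M W) (quotient_module N U)"
proof (rule module_isoI_surj[OF M module_quotient[OF M W] module_quotient[OF N U]])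
  show "(\<lambda>x. W +>\<^bsub>M\<^esub> x) ` carrier M = carrier (quotient_module M W)"
    by (rule carrier_quotient[OF M W, symmetric])
  show "(\<lambda>x. W +>\<^bsub>M\<^esub> x) \<in> module_homs R M (quotient_module M W)" by (rule proj_hom[OF M W])
  show "(\<lambda>x. U +>\<^bsub>N\<^esub> h x) \<in> module_homs R M (quotient_module N U)"
    by (rule homs_comp[OF h proj_hom[OF N U]])
  show "(\<lambda>x. U +>\<^bsub>N\<^esub> h x) ` carrier M = carrier (quotient_module N U)"
    unfolding carrier_quotient[OF N U] using surj homs_closed[OF h] proj_eq_iff[OF N U]
    by (auto simp: image_iff)
  fix x assume x: "x \<in> carrier M"
  then show "W +>\<^bsub>M\<^esub> x = \<zero>\<^bsub>quotient_module M W\<^esub> \<longleftrightarrow> U +>\<^bsub>N\<^esub> h x = \<zero>\<^bsub>quotient_module N U\<^esub>"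
    using proj_zero_iff[OF M W x] proj_zero_iff[OF N U homs_closed[OF h x]] ker by simp
qed

section \<open>Direct products of two modules\<close>

definition prod_module ::
  "('a, 'm, 'c) module_scheme \<Rightarrow> ('a, 'n, 'd) module_scheme \<Rightarrow> ('a, 'm \<times> 'n) module"
  where "prod_module M N =
    \<lparr>carrier = carrier M \<times> carrier N,
     monoid.mult = (\<lambda>_ _. (\<zero>\<^bsub>M\<^esub>, \<zero>\<^bsub>N\<^esub>)), one = (\<zero>\<^bsub>M\<^esub>, \<zero>\<^bsub>N\<^esub>), ring.zero = (\<zero>\<^bsub>M\<^esub>, \<zero>\<^bsub>N\<^esub>),
     ring.add = (\<lambda>p q. (fst p \<oplus>\<^bsub>M\<^esub> fst q, snd p \<oplus>\<^bsub>N\<^esub> snd q)),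
     smult = (\<lambda>r p. (r \<odot>\<^bsub>M\<^esub> fst p, r \<odot>\<^bsub>N\<^esub> snd p))\<rparr>"

lemma prod_module_simps [simp]:
  "carrier (prod_module M N) = carrier M \<times> carrier N"
  "\<zero>\<^bsub>prod_module M N\<^esub> = (\<zero>\<^bsub>M\<^esub>, \<zero>\<^bsub>N\<^esub>)"
  "p \<oplus>\<^bsub>prod_module M N\<^esub> q = (fst p \<oplus>\<^bsub>M\<^esub> fst q, snd p \<oplus>\<^bsub>N\<^esub> snd q)"
  "r \<odot>\<^bsub>prod_module M N\<^esub> p = (r \<odot>\<^bsub>M\<^esub> fst p, r \<odot>\<^bsub>N\<^esub> snd p)"
  unfolding prod_module_def by simp_all

lemma module_prod:
  assumes "module R M" "module R N"
  shows "module R (prod_module M N)"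
proof -
  interpret M: module R M by fact
  interpret N: module R N by fact
  show ?thesis
  proof (rule moduleI)
    show "abelian_group (prod_module M N)"
    proof (rule abelian_groupI)
      fix x assume "x \<in> carrier (prod_module M N)"
      then have "(\<ominus>\<^bsub>M\<^esub> fst x, \<ominus>\<^bsub>N\<^esub> snd x) \<oplus>\<^bsub>prod_module M N\<^esub> x = \<zero>\<^bsub>prod_module M N\<^esub>"
        "(\<ominus>\<^bsub>M\<^esub> fst x, \<ominus>\<^bsub>N\<^esub> snd x) \<in> carrier (prod_module M N)"
        by (auto simp: M.M.l_neg N.M.l_neg)
      then show "\<exists>y\<in>carrier (prod_module M N). y \<oplus>\<^bsub>prod_module M N\<^esub> x = \<zero>\<^bsub>prod_module M N\<^esub>" by blast
    qed (auto simp: M.M.a_ac N.M.a_ac)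
  qed (auto simp: M.is_cring M.smult_l_distr N.smult_l_distr M.smult_r_distr N.smult_r_distr
      M.smult_assoc1 N.smult_assoc1)
qed

lemma fst_hom: "fst \<in> module_homs R (prod_module M N) M"
  and snd_hom: "snd \<in> module_homs R (prod_module M N) N"
  by (auto intro!: module_homsI)

lemma prod_module_minus:
  assumes "module R M" "module R N" "p \<in> carrier M \<times> carrier N" "q \<in> carrier M \<times> carrier N"
  shows "p \<ominus>\<^bsub>prod_module M N\<^esub> q = (fst p \<ominus>\<^bsub>M\<^esub> fst q, snd p \<ominus>\<^bsub>N\<^esub> snd q)"
  using assms homs_minus[OF fst_hom[of R M N] module_prod[OF assms(1,2)] assms(1), of p q]
    homs_minus[OF snd_hom[of R M N] module_prod[OF assms(1,2)] assms(2), of p q]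
  by (metis prod.collapse prod_module_simps(1))

lemma homs_pair:
  "f \<in> module_homs R P M \<Longrightarrow> g \<in> module_homs R P N \<Longrightarrow> (\<lambda>x. (f x, g x)) \<in> module_homs R P (prod_module M N)"
  by (rule module_homsI) (auto simp: homs_closed homs_add homs_smult)

text \<open>Moves a module to a prescribed type along an injection: to \<open>'a + 'e\<close>, where
  \<open>injective_module\<close> tests the extension property, and to
  \<open>'a list \<Rightarrow> 'm option\<close>, where resolutions are chosen.\<close>

definition transport_module ::
  "('m \<Rightarrow> 'n) \<Rightarrow> ('a, 'm, 'c) module_scheme \<Rightarrow> ('a, 'n) module"
  where "transport_module i M = (let j = inv_into (carrier M) i in
    \<lparr>carrier = i ` carrier M,
     monoid.mult = (\<lambda>_ _. i \<zero>\<^bsub>M\<^esub>), one = i \<zero>\<^bsub>M\<^esub>, ring.zero = i \<zero>\<^bsub>M\<^esub>,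
     ring.add = (\<lambda>x y. i (j x \<oplus>\<^bsub>M\<^esub> j y)), smult = (\<lambda>r x. i (r \<odot>\<^bsub>M\<^esub> j x))\<rparr>)"

context
  fixes R :: "('a, 'r) ring_scheme" and M :: "('a, 'm, 'c) module_scheme" and i :: "'m \<Rightarrow> 'n"
  assumes M: "module R M" and i: "inj_on i (carrier M)"
begin

lemma carrier_transport: "carrier (transport_module i M) = i ` carrier M"
  unfolding transport_module_def by (simp add: Let_def)

lemma module_transport: "module R (transport_module i M)"
  by (rule module_image[OF M carrier_transport]) (simp_all add: transport_module_def Let_def i)

lemma transport_hom: "i \<in> module_homs R M (transport_module i M)"
  by (rule module_homsI) (simp_all add: transport_module_def Let_def i)

lemma transport_inv_hom: "inv_into (carrier M) i \<in> module_homs R (transport_module i M) M"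
proof -
  interpret M: module R M by (fact M)
  show ?thesis
    by (rule module_homsI) (auto simp: transport_module_def Let_def i)
qed

end

section \<open>The ring as a module over itself\<close>

lemma ring_as_module_simps [simp]:
  "carrier (ring_as_module R) = carrier R" "\<zero>\<^bsub>ring_as_module R\<^esub> = \<zero>\<^bsub>R\<^esub>"
  "x \<oplus>\<^bsub>ring_as_module R\<^esub> y = x \<oplus>\<^bsub>R\<^esub> y" "x \<odot>\<^bsub>ring_as_module R\<^esub> y = x \<otimes>\<^bsub>R\<^esub> y"
  unfolding ring_as_module_def by simp_all

lemma module_ring_as_module:
  assumes "cring R"
  shows "module R (ring_as_module R)"
proof -
  interpret R: cring R by fact
  show ?thesis
  proof (rule moduleI[OF assms])
    show "abelian_group (ring_as_module R)"
    proof (rule abelian_groupI)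
      fix x assume "x \<in> carrier (ring_as_module R)"
      then have "\<ominus>\<^bsub>R\<^esub> x \<in> carrier (ring_as_module R)"
        "\<ominus>\<^bsub>R\<^esub> x \<oplus>\<^bsub>ring_as_module R\<^esub> x = \<zero>\<^bsub>ring_as_module R\<^esub>" by (simp_all add: R.l_neg)
      then show "\<exists>y\<in>carrier (ring_as_module R). y \<oplus>\<^bsub>ring_as_module R\<^esub> x = \<zero>\<^bsub>ring_as_module R\<^esub>" by blast
    qed (simp_all add: R.a_ac)
  qed (simp_all add: R.l_distr R.r_distr R.m_assoc)
qed

text \<open>Commutativity makes a submodule closed under multiplication from both sides. The
  equivalence lets preimages under module maps serve as ideals.\<close>

lemma ideal_iff_submodule:
  assumes "cring R"
  shows "ideal J R \<longleftrightarrow> submodule J R (ring_as_module R)"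
proof -
  interpret R: cring R by fact
  show ?thesis
  proof
    assume "ideal J R"
    then interpret J: ideal J R .
    show "submodule J R (ring_as_module R)"
      by (rule submoduleI'[OF module_ring_as_module[OF assms]]) (auto simp: J.I_l_closed)
  next
    assume J: "submodule J R (ring_as_module R)"
    note J = submoduleD[OF J] J
    show "ideal J R"
    proof (rule idealI)
      have *: "\<ominus>\<^bsub>R\<^esub> a \<in> J" if "a \<in> J" for a
        using J(4)[of "\<ominus>\<^bsub>R\<^esub> \<one>\<^bsub>R\<^esub>" a] J(1)[of a] that by (simp add: R.l_minus)
      show "subgroup J (add_monoid R)"
        using J(1-3) * by (intro subgroup.intro) (auto simp: a_inv_def)
      fix a x assume "a \<in> J" "x \<in> carrier R"
      then show "x \<otimes>\<^bsub>R\<^esub> a \<in> J" "a \<otimes>\<^bsub>R\<^esub> x \<in> J" using J(1)[of a] J(4)[of x a] by (simp_all add: R.m_comm)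
    qed (rule R.ring_axioms)
  qed
qed

lemma mult_hom:
  assumes "module R M" "x \<in> carrier M"
  shows "(\<lambda>r. r \<odot>\<^bsub>M\<^esub> x) \<in> module_homs R (ring_as_module R) M"
proof -
  interpret M: module R M by fact
  show ?thesis by (rule module_homsI) (auto simp: assms M.smult_l_distr M.smult_assoc1)
qed

text \<open>This is \<open>V + Rx\<close>, the enlargement by one generator. It is compared with a
  maximal submodule after each use of Zorn's lemma, and it drives the inductions over
  generators.\<close>

definition add_cyclic where
  "add_cyclic R M V x = {v \<oplus>\<^bsub>M\<^esub> r \<odot>\<^bsub>M\<^esub> x | v r. v \<in> V \<and> r \<in> carrier R}"

lemma add_cyclic:
  assumes M: "module R M" and V: "submodule V R M" and x: "x \<in> carrier M"
  shows "submodule (add_cyclic R M V x) R M" "V \<subseteq> add_cyclic R M V x" "x \<in> add_cyclic R M V x"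
proof -
  interpret M: module R M by fact
  note mR = module_ring_as_module[OF M.is_cring]
  have "add_cyclic R M V x = {v \<oplus>\<^bsub>M\<^esub> q | v q. v \<in> V \<and> q \<in> (\<lambda>r. r \<odot>\<^bsub>M\<^esub> x) ` carrier (ring_as_module R)}"
    unfolding add_cyclic_def by auto
  then show "submodule (add_cyclic R M V x) R M"
    using submodule_set_add[OF M V submodule_image[OF mR M mult_hom[OF M x] submodule_carrier[OF mR]]] by simp
  have *: "v \<oplus>\<^bsub>M\<^esub> r \<odot>\<^bsub>M\<^esub> x \<in> add_cyclic R M V x" if "v \<in> V" "r \<in> carrier R" for v r
    unfolding add_cyclic_def using that by blast
  show "V \<subseteq> add_cyclic R M V x"
  proof
    fix v assume v: "v \<in> V"
    then show "v \<in> add_cyclic R M V x" using *[OF v M.R.zero_closed] x submoduleD(1)[OF V v] by simp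
  qed
  show "x \<in> add_cyclic R M V x" using *[OF submoduleD(2)[OF V] M.R.one_closed] x by simp
qed

section \<open>Injective modules\<close>

text \<open>Baer's criterion, with the extension to \<open>R\<close> recorded by the image
  \<open>e\<close> of one. Only ideals of \<open>R\<close> are tested, so modules of all types can
  be treated alike.\<close>

definition baer :: "('a, 'r) ring_scheme \<Rightarrow> ('a, 'e, 'c) module_scheme \<Rightarrow> bool"
  where "baer R E \<longleftrightarrow> module R E \<and>
    (\<forall>J \<phi>. submodule J R (ring_as_module R) \<and> \<phi> \<in> module_homs R ((ring_as_module R)\<lparr>carrier := J\<rparr>) E \<longrightarrow>
      (\<exists>e\<in>carrier E. \<forall>j\<in>J. \<phi> j = j \<odot>\<^bsub>E\<^esub> e))"

lemma baerD1: "baer R E \<Longrightarrow> module R E"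
  unfolding baer_def by blast

lemma baerD2:
  assumes "baer R E" "submodule J R (ring_as_module R)"
    "\<phi> \<in> module_homs R ((ring_as_module R)\<lparr>carrier := J\<rparr>) E"
  obtains e where "e \<in> carrier E" "\<And>j. j \<in> J \<Longrightarrow> \<phi> j = j \<odot>\<^bsub>E\<^esub> e"
  using assms unfolding baer_def by blast

text \<open>Zorn's lemma is applied to the graphs of partial extensions, which are submodules of
  \<open>C \<times> E\<close> meeting \<open>0 \<times> E\<close> trivially.\<close>

lemma baer_extend:
  assumes E: "baer R E" and C: "module R C" and N: "submodule N R C"
    and g: "g \<in> module_homs R (C\<lparr>carrier := N\<rparr>) E"
  obtains h where "h \<in> module_homs R C E" "\<And>x. x \<in> N \<Longrightarrow> h x = g x"
proof -
  note mE = baerD1[OF E]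
  interpret C: module R C by (fact C)
  interpret E: module R E by (fact mE)
  define P where "P = prod_module C E"
  have P: "module R P" unfolding P_def by (rule module_prod[OF C mE])
  interpret P: module R P by (fact P)
  note N' = submoduleD[OF N]
  define G0 where "G0 = (\<lambda>x. (x, g x)) ` N"
  define A where "A = {G. submodule G R P \<and> (\<forall>e. (\<zero>\<^bsub>C\<^esub>, e) \<in> G \<longrightarrow> e = \<zero>\<^bsub>E\<^esub>) \<and> G0 \<subseteq> G}"
  have "(\<lambda>x. (x, g x)) \<in> module_homs R (C\<lparr>carrier := N\<rparr>) P"
    unfolding P_def using homs_pair[OF homs_restrict[OF homs_id[of R C], of N] g] N'(1) by auto
  then have "submodule G0 R P"
    unfolding G0_def using submodule_image[OF restrict_module[OF N C] P _ submodule_carrier[OF restrict_module[OF N C]]]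
    by simp
  then have G0: "G0 \<in> A" unfolding A_def G0_def using homs_zero[OF g restrict_module[OF N C] mE] by auto
  have "\<exists>G\<in>A. \<forall>X\<in>A. G \<subseteq> X \<longrightarrow> X = G"
  proof (rule subset_Zorn_nonempty)
    show "A \<noteq> {}" using G0 by auto
    fix \<C> assume ne: "\<C> \<noteq> {}" and ch: "subset.chain A \<C>"
    then have sub: "submodule G R P" "\<forall>e. (\<zero>\<^bsub>C\<^esub>, e) \<in> G \<longrightarrow> e = \<zero>\<^bsub>E\<^esub>" "G0 \<subseteq> G" if "G \<in> \<C>" for G
      using that unfolding subset.chain_def A_def by auto
    have "submodule (\<Union>\<C>) R P"
      using submodule_Union_chain[OF P ne ch] sub(1) unfolding A_def by blast
    then show "\<Union>\<C> \<in> A" unfolding A_def using sub ne by blast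
  qed
  then obtain G where GA: "G \<in> A" and max: "\<And>X. X \<in> A \<Longrightarrow> G \<subseteq> X \<Longrightarrow> X = G" by blast
  have G: "submodule G R P" and G_zero: "\<And>e. (\<zero>\<^bsub>C\<^esub>, e) \<in> G \<Longrightarrow> e = \<zero>\<^bsub>E\<^esub>" and G0_sub: "G0 \<subseteq> G"
    using GA unfolding A_def by auto
  note G' = submoduleD[OF G]
  have G_car: "x \<in> carrier C" "e \<in> carrier E" if "(x, e) \<in> G" for x e
    using G'(1)[OF that] unfolding P_def by auto
  have G_add: "(x \<oplus>\<^bsub>C\<^esub> y, e \<oplus>\<^bsub>E\<^esub> f) \<in> G" if "(x, e) \<in> G" "(y, f) \<in> G" for x e y f
    using G'(3)[OF that] unfolding P_def by simp
  have G_smult: "(r \<odot>\<^bsub>C\<^esub> x, r \<odot>\<^bsub>E\<^esub> e) \<in> G" if "(x, e) \<in> G" "r \<in> carrier R" for x e r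
    using G'(4)[OF that(2,1)] unfolding P_def by simp
  have G_sv: "e = f" if "(x, e) \<in> G" "(x, f) \<in> G" for x e f
  proof -
    have "(x \<ominus>\<^bsub>C\<^esub> x, e \<ominus>\<^bsub>E\<^esub> f) \<in> G"
      using G'(6)[OF that] G_car[OF that(1)] G_car[OF that(2)] unfolding P_def
      by (simp add: prod_module_minus[OF C mE])
    then have "e \<ominus>\<^bsub>E\<^esub> f = \<zero>\<^bsub>E\<^esub>" using G_zero G_car[OF that(1)] homs_eq_iff_diff[OF C, of x x] by simp
    then show ?thesis using homs_eq_iff_diff[OF mE] G_car that by blast
  qed
  define D where "D = fst ` G"
  have D: "submodule D R C" unfolding D_def
    using submodule_image[OF P C _ G] fst_hom[of R C E] P_def by simp
  \<comment> \<open>By \<open>G_sv\<close> there is one value above each point of \<open>D\<close>,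
    so \<open>v\<close> is the map on \<open>D\<close> with graph \<open>G\<close>.\<close>
  define v where "v x = (SOME e. (x, e) \<in> G)" for x
  have v: "(x, v x) \<in> G" if "x \<in> D" for x
  proof -
    have "\<exists>e. (x, e) \<in> G" using that unfolding D_def by auto
    then show ?thesis unfolding v_def by (rule someI_ex)
  qed
  have v_eq: "v x = e" if "(x, e) \<in> G" for x e
  proof -
    have "x \<in> D" unfolding D_def using that by force
    then show ?thesis using G_sv that v by blast
  qed
  have v_hom: "v \<in> module_homs R (C\<lparr>carrier := D\<rparr>) E"
    using v G_car(2) by (intro module_homsI) (auto intro!: v_eq G_add G_smult)
  have "x \<in> D" if x: "x \<in> carrier C" for x
  proof -
    \<comment> \<open>The scalars that carry \<open>x\<close> into the domain \<open>D\<close> form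
      an ideal. Baer's criterion for it yields a value \<open>e\<close> that can consistently be
      given to \<open>x\<close>.\<close>
    define J where "J = {r \<in> carrier R. r \<odot>\<^bsub>C\<^esub> x \<in> D}"
    have J: "submodule J R (ring_as_module R)" unfolding J_def
      using submodule_vimage[OF module_ring_as_module[OF C.is_cring] C mult_hom[OF C x] D] by simp
    have "(\<lambda>r. v (r \<odot>\<^bsub>C\<^esub> x)) \<in> module_homs R ((ring_as_module R)\<lparr>carrier := J\<rparr>) E"
    proof (rule homs_comp[OF _ v_hom])
      have "J \<subseteq> carrier (ring_as_module R)" unfolding J_def by auto
      then show "(\<lambda>r. r \<odot>\<^bsub>C\<^esub> x) \<in> module_homs R ((ring_as_module R)\<lparr>carrier := J\<rparr>) (C\<lparr>carrier := D\<rparr>)"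
        by (intro homs_into homs_restrict mult_hom C x) (auto simp: J_def)
    qed
    then obtain e where e: "e \<in> carrier E" "\<And>j. j \<in> J \<Longrightarrow> v (j \<odot>\<^bsub>C\<^esub> x) = j \<odot>\<^bsub>E\<^esub> e"
      by (rule baerD2[OF E J]) blast
    have xe: "(x, e) \<in> carrier P" unfolding P_def using x e by simp
    define X where "X = add_cyclic R P G (x, e)"
    have X: "submodule X R P" and GX: "G \<subseteq> X" and xeX: "(x, e) \<in> X"
      unfolding X_def by (rule add_cyclic[OF P G xe])+
    \<comment> \<open>Above zero the enlarged graph contains only zero: if \<open>y + rx\<close>
      vanishes, then \<open>r\<close> lies in \<open>J\<close>, and the choice of \<open>e\<close>
      makes \<open>d + re\<close> vanish as well.\<close>
    have "f = \<zero>\<^bsub>E\<^esub>" if "(\<zero>\<^bsub>C\<^esub>, f) \<in> X" for f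
    proof -
      from that obtain y d r where yd: "(y, d) \<in> G" "r \<in> carrier R"
        "\<zero>\<^bsub>C\<^esub> = y \<oplus>\<^bsub>C\<^esub> r \<odot>\<^bsub>C\<^esub> x" "f = d \<oplus>\<^bsub>E\<^esub> r \<odot>\<^bsub>E\<^esub> e"
        unfolding X_def add_cyclic_def P_def by auto
      note yc = G_car[OF yd(1)]
      have y: "r \<odot>\<^bsub>C\<^esub> x = (\<ominus>\<^bsub>R\<^esub> \<one>\<^bsub>R\<^esub>) \<odot>\<^bsub>C\<^esub> y"
        using yd(2,3) yc x by (simp add: C.smult_l_minus) (metis C.M.minus_equality C.M.a_comm C.smult_closed C.M.minus_minus)
      have m: "((\<ominus>\<^bsub>R\<^esub> \<one>\<^bsub>R\<^esub>) \<odot>\<^bsub>C\<^esub> y, (\<ominus>\<^bsub>R\<^esub> \<one>\<^bsub>R\<^esub>) \<odot>\<^bsub>E\<^esub> d) \<in> G" using G_smult[OF yd(1)] by simp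
      then have "r \<in> J" unfolding J_def D_def using yd(2) y by force
      then have "r \<odot>\<^bsub>E\<^esub> e = (\<ominus>\<^bsub>R\<^esub> \<one>\<^bsub>R\<^esub>) \<odot>\<^bsub>E\<^esub> d" using e(2)[OF \<open>r \<in> J\<close>] v_eq[OF m] y by metis
      then show ?thesis using yd(4) yc by (simp add: E.smult_l_minus E.M.r_neg)
    qed
    then have "X \<in> A" unfolding A_def using X GX G0_sub by auto
    then have "X = G" using max GX by blast
    then show "x \<in> D" using xeX unfolding D_def by force
  qed
  then have "D = carrier C" using submoduleD(1)[OF D] by blast
  then have "v \<in> module_homs R C E" using v_hom by simp
  moreover have "v x = g x" if "x \<in> N" for x using v_eq G0_sub that unfolding G0_def by auto
  ultimately show ?thesis using that by blast
qed

text \<open>For injective \<open>f\<close> the kernel condition is automatic and this is the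
  extension property. In general \<open>g\<close> factors through the image of \<open>f\<close> and
  is extended from there.\<close>

lemma baer_factor:
  assumes E: "baer R E" and B: "module R B" and C: "module R C"
    and f: "f \<in> module_homs R B C" and g: "g \<in> module_homs R B E"
    and ker: "\<And>x. x \<in> carrier B \<Longrightarrow> f x = \<zero>\<^bsub>C\<^esub> \<Longrightarrow> g x = \<zero>\<^bsub>E\<^esub>"
  obtains h where "h \<in> module_homs R C E" "\<And>x. x \<in> carrier B \<Longrightarrow> h (f x) = g x"
proof -
  let ?N = "f ` carrier B"
  have N: "submodule ?N R C" by (rule submodule_image[OF B C f submodule_carrier[OF B]])
  have fN: "f \<in> module_homs R B (C\<lparr>carrier := ?N\<rparr>)" by (rule homs_into[OF f]) simp
  obtain k where k: "k \<in> module_homs R (C\<lparr>carrier := ?N\<rparr>) E" "\<And>x. x \<in> carrier B \<Longrightarrow> k (f x) = g x"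
    using hom_factor[OF B restrict_module[OF N C] baerD1[OF E] fN _ g] ker by auto
  obtain h where "h \<in> module_homs R C E" "\<And>x. x \<in> ?N \<Longrightarrow> h x = k x"
    using baer_extend[OF E C N k(1)] by blast
  then show ?thesis using k(2) that by (metis imageI)
qed

text \<open>From the definition to Baer's criterion: \<open>R\<close> and the ideal \<open>J\<close>
  are copied into \<open>'a + 'e\<close> along \<open>Inl\<close>, and the extension of the map on
  \<open>J\<close> is evaluated at one. The converse is an instance of
  \<open>baer_factor\<close>.\<close>

lemma injective_module_iff_baer:
  fixes R :: "('a, 'r) ring_scheme" and E :: "('a, 'e, 'c) module_scheme"
  shows "injective_module R E \<longleftrightarrow> baer R E"
proof
  assume E: "baer R E"
  have "\<exists>h\<in>module_homs R B E. \<forall>x\<in>carrier A. h (f x) = g x"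
    if "module R A" "module R B" "f \<in> module_homs R A B" "inj_on f (carrier A)" "g \<in> module_homs R A E"
    for A B :: "('a, 'a + 'e) module" and f g
  proof -
    interpret A: module R A by (rule that)
    have "g x = \<zero>\<^bsub>E\<^esub>" if x: "x \<in> carrier A" "f x = \<zero>\<^bsub>B\<^esub>" for x
    proof -
      have "f x = f \<zero>\<^bsub>A\<^esub>" using x homs_zero[OF \<open>f \<in> _\<close> \<open>module R A\<close> \<open>module R B\<close>] by simp
      then have "x = \<zero>\<^bsub>A\<^esub>" using x \<open>inj_on f (carrier A)\<close> by (simp add: inj_on_eq_iff)
      then show ?thesis using homs_zero[OF \<open>g \<in> _\<close> \<open>module R A\<close> baerD1[OF E]] by simp
    qed
    then show ?thesis using baer_factor[OF E that(1,2,3,5)] by metis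
  qed
  then show "injective_module R E" unfolding injective_module_def using baerD1[OF E] by blast
next
  assume E: "injective_module R E"
  then have mE: "module R E" unfolding injective_module_def by blast
  interpret E: module R E by (fact mE)
  show "baer R E" unfolding baer_def
  proof (intro conjI allI impI mE, elim conjE)
    fix J \<phi> assume J: "submodule J R (ring_as_module R)"
      and \<phi>: "\<phi> \<in> module_homs R ((ring_as_module R)\<lparr>carrier := J\<rparr>) E"
    let ?R = "ring_as_module R" let ?J = "(ring_as_module R)\<lparr>carrier := J\<rparr>" let ?i = "Inl :: 'a \<Rightarrow> 'a + 'e"
    have mR: "module R ?R" by (rule module_ring_as_module[OF E.is_cring])
    have mJ: "module R ?J" by (rule restrict_module[OF J mR])
    have sub: "J \<subseteq> carrier ?R" using submoduleD(1)[OF J] by auto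
    have inj: "inj_on ?i S" for S by simp
    define A where "A = transport_module ?i ?J"
    define B where "B = transport_module ?i ?R"
    let ?k = "inv_into (carrier ?J) ?i"
    have k: "?k \<in> module_homs R A ?J" unfolding A_def by (rule transport_inv_hom[OF mJ inj])
    have k_eq: "?k (Inl j) = j" if "j \<in> J" for j using that inv_into_f_f[OF inj, of j "carrier ?J"] by simp
    have cA: "carrier A = Inl ` J" unfolding A_def using carrier_transport[OF mJ inj] by simp
    have f: "(\<lambda>x. ?i (?k x)) \<in> module_homs R A B" unfolding B_def
      by (rule homs_comp[OF k homs_restrict[OF transport_hom[OF mR inj] sub]])
    have "(\<lambda>x. \<phi> (?k x)) \<in> module_homs R A E" by (rule homs_comp[OF k \<phi>])
    moreover have "inj_on (\<lambda>x. ?i (?k x)) (carrier A)" unfolding cA by (auto simp: inj_on_def k_eq)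
    moreover have "module R A" "module R B" unfolding A_def B_def
      by (rule module_transport[OF mJ inj] module_transport[OF mR inj])+
    ultimately obtain h where h: "h \<in> module_homs R B E" "\<forall>x\<in>carrier A. h (?i (?k x)) = \<phi> (?k x)"
      using E f unfolding injective_module_def by blast
    have h': "(\<lambda>r. h (?i r)) \<in> module_homs R ?R E"
      by (rule homs_comp[OF _ h(1)]) (simp add: B_def transport_hom[OF mR inj])
    have "\<phi> j = j \<odot>\<^bsub>E\<^esub> h (Inl \<one>\<^bsub>R\<^esub>)" if "j \<in> J" for j
    proof -
      have "\<phi> j = h (Inl j)" using h(2) cA that k_eq by auto
      also have "\<dots> = h (Inl (j \<otimes>\<^bsub>R\<^esub> \<one>\<^bsub>R\<^esub>))" using sub that by auto
      also have "\<dots> = j \<odot>\<^bsub>E\<^esub> h (Inl \<one>\<^bsub>R\<^esub>)" using homs_smult[OF h', of j "\<one>\<^bsub>R\<^esub>"] sub that by auto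
      finally show ?thesis .
    qed
    moreover have "h (Inl \<one>\<^bsub>R\<^esub>) \<in> carrier E" using homs_closed[OF h', of "\<one>\<^bsub>R\<^esub>"] by simp
    ultimately show "\<exists>e\<in>carrier E. \<forall>j\<in>J. \<phi> j = j \<odot>\<^bsub>E\<^esub> e" by blast
  qed
qed

section \<open>Torsion\<close>

lemma ideal_power:
  assumes "ring R" "ideal \<aa> R"
  shows "ideal (\<aa> [^]\<^bsub>ideals_set R\<^esub> (n::nat)) R"
proof (induction n)
  interpret ring R by fact
  case 0 show ?case by (simp add: nat_pow_def ideals_set_def oneideal)
next
  interpret ring R by fact
  case (Suc n) then show ?case using assms(2) ideal_prod_is_ideal by (simp add: nat_pow_def ideals_set_def)
qed

lemma power_in_ideal_power:
  assumes "cring R" "ideal \<aa> R" "x \<in> \<aa>"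
  shows "x [^]\<^bsub>R\<^esub> (n::nat) \<in> \<aa> [^]\<^bsub>ideals_set R\<^esub> n"
proof (induction n)
  interpret cring R by fact
  case 0 show ?case by (simp add: nat_pow_def ideals_set_def)
next
  case (Suc n) then show ?case using assms(3) by (simp add: nat_pow_def ideals_set_def ideal_prod.prod)
qed

context
  fixes R :: "('a, 'r) ring_scheme" and \<aa> :: "'a set" and M :: "('a, 'm, 'c) module_scheme"
  assumes ideal: "ideal \<aa> R" and M: "module R M"
begin

interpretation M: module R M by (fact M)

private definition killed :: "nat \<Rightarrow> 'm \<Rightarrow> bool"
  where "killed n x \<longleftrightarrow> (\<forall>r\<in>\<aa> [^]\<^bsub>ideals_set R\<^esub> n. r \<odot>\<^bsub>M\<^esub> x = \<zero>\<^bsub>M\<^esub>)"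

private lemma torsion_killed: "x \<in> torsion_submodule R \<aa> M \<longleftrightarrow> x \<in> carrier M \<and> (\<exists>n. killed n x)"
  unfolding torsion_submodule_def killed_def by simp

private lemma pow_carrier: "r \<in> \<aa> [^]\<^bsub>ideals_set R\<^esub> (n::nat) \<Longrightarrow> r \<in> carrier R"
  using ideal_power[OF M.R.ring_axioms ideal] by (rule ideal.Icarr)

private lemma a_carrier: "r \<in> \<aa> \<Longrightarrow> r \<in> carrier R"
  using ideal by (rule ideal.Icarr)

text \<open>The ideal \<open>\<aa>^(n+1)\<close> consists of sums of products of an element of
  \<open>\<aa>^n\<close> and one of \<aa>. The recursion reduces statements about exponents to the
  elements \<open>r x\<close> with \<open>r\<close> in \<aa>.\<close>

private lemma killed_Suc:
  assumes "x \<in> carrier M"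
  shows "killed (Suc n) x \<longleftrightarrow> (\<forall>r\<in>\<aa>. killed n (r \<odot>\<^bsub>M\<^esub> x))"
proof
  assume "killed (Suc n) x"
  then show "\<forall>r\<in>\<aa>. killed n (r \<odot>\<^bsub>M\<^esub> x)"
    unfolding killed_def using assms
    by (auto simp: nat_pow_def ideals_set_def M.smult_assoc1[symmetric] a_carrier
        pow_carrier[unfolded nat_pow_def ideals_set_def, simplified] intro: ideal_prod.prod)
next
  assume *: "\<forall>r\<in>\<aa>. killed n (r \<odot>\<^bsub>M\<^esub> x)"
  \<comment> \<open>Induction over the generation of the product ideal. Membership in the carrier is
    carried along because the sum case needs distributivity.\<close>
  have "t \<in> carrier R \<and> t \<odot>\<^bsub>M\<^esub> x = \<zero>\<^bsub>M\<^esub>" if "t \<in> ideal_prod R (\<aa> [^]\<^bsub>ideals_set R\<^esub> n) \<aa>" for t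
    using that
  proof induction
    case (prod i j)
    then show ?case using * assms by (simp add: killed_def M.smult_assoc1 a_carrier pow_carrier)
  next
    case (sum s t)
    then show ?case using assms by (simp add: M.smult_l_distr)
  qed
  then show "killed (Suc n) x" unfolding killed_def by (simp add: nat_pow_def ideals_set_def)
qed

private lemma killed_smult: "killed n x \<Longrightarrow> x \<in> carrier M \<Longrightarrow> r \<in> carrier R \<Longrightarrow> killed n (r \<odot>\<^bsub>M\<^esub> x)"
  unfolding killed_def
  by (metis M.smult_assoc1 M.R.m_comm M.smult_r_null pow_carrier)

private lemma killed_mono:
  assumes "killed n x" "x \<in> carrier M" "n \<le> m"
  shows "killed m x"
  using assms(3) by (induction rule: dec_induct) (use assms in \<open>auto simp: killed_Suc killed_smult a_carrier\<close>)

private lemma killed_zero: "killed n \<zero>\<^bsub>M\<^esub>"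
  unfolding killed_def using pow_carrier by simp

private lemma killed_submodule: "submodule {x \<in> carrier M. killed n x} R M"
  by (rule submoduleI'[OF M])
    (auto simp: killed_zero killed_smult, auto simp: killed_def M.smult_r_distr pow_carrier)

lemma torsion_submodule: "submodule (torsion_submodule R \<aa> M) R M"
proof (rule submoduleI'[OF M])
  fix x y assume "x \<in> torsion_submodule R \<aa> M" "y \<in> torsion_submodule R \<aa> M"
  then obtain m n where "killed m x" "killed n y" and c: "x \<in> carrier M" "y \<in> carrier M"
    unfolding torsion_killed by auto
  then have "killed (max m n) x" "killed (max m n) y" using killed_mono by auto
  then have "killed (max m n) (x \<oplus>\<^bsub>M\<^esub> y)" using submoduleD(3)[OF killed_submodule, of x _ y] c by auto
  then show "x \<oplus>\<^bsub>M\<^esub> y \<in> torsion_submodule R \<aa> M" unfolding torsion_killed using c by auto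
next
  fix r x assume "r \<in> carrier R" "x \<in> torsion_submodule R \<aa> M"
  then show "r \<odot>\<^bsub>M\<^esub> x \<in> torsion_submodule R \<aa> M" unfolding torsion_killed using killed_smult by blast
qed (use killed_zero in \<open>auto simp: torsion_killed\<close>)

lemma torsion_power:
  assumes "x \<in> torsion_submodule R \<aa> M" "r \<in> \<aa>"
  obtains n :: nat where "(r [^]\<^bsub>R\<^esub> n) \<odot>\<^bsub>M\<^esub> x = \<zero>\<^bsub>M\<^esub>"
  using assms power_in_ideal_power[OF M.is_cring ideal] unfolding torsion_submodule_def by blast

lemma torsionI_annihilated:
  assumes "x \<in> carrier M" "\<And>r. r \<in> \<aa> \<Longrightarrow> r \<odot>\<^bsub>M\<^esub> x = \<zero>\<^bsub>M\<^esub>"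
  shows "x \<in> torsion_submodule R \<aa> M"
proof -
  have "killed 0 \<zero>\<^bsub>M\<^esub>" by (rule killed_zero)
  then have "killed (Suc 0) x" using assms by (simp add: killed_Suc)
  then show ?thesis using torsion_killed assms(1) by blast
qed

context
  fixes S
  assumes S: "finite S" "S \<subseteq> carrier R" "\<aa> = Idl\<^bsub>R\<^esub> S"
begin

text \<open>With \<open>N\<close> at least the exponent of every generator, the scalars
  \<open>r\<close> for which \<open>\<aa>^N\<close> kills \<open>r x\<close> form an ideal. It
  contains \<open>S\<close>, hence \<aa>, so \<open>N + 1\<close> is an exponent for
  \<open>x\<close>.\<close>

lemma torsionI_generators:
  assumes x: "x \<in> carrier M" and "\<And>s. s \<in> S \<Longrightarrow> s \<odot>\<^bsub>M\<^esub> x \<in> torsion_submodule R \<aa> M"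
  shows "x \<in> torsion_submodule R \<aa> M"
proof -
  from assms(2) have "\<forall>s\<in>S. \<exists>n. killed n (s \<odot>\<^bsub>M\<^esub> x)" unfolding torsion_killed by blast
  then obtain n where n: "\<And>s. s \<in> S \<Longrightarrow> killed (n s) (s \<odot>\<^bsub>M\<^esub> x)" by metis
  \<comment> \<open>The 0 keeps the maximum defined when \<open>S\<close> is empty.\<close>
  define N where "N = Max (insert 0 (n ` S))"
  have N: "killed N (s \<odot>\<^bsub>M\<^esub> x)" if "s \<in> S" for s
  proof (rule killed_mono[OF n[OF that]])
    show "n s \<le> N" unfolding N_def using that S(1) by (intro Max_ge) auto
  qed (use that x S(2) in blast)
  let ?K = "{r \<in> carrier (ring_as_module R). r \<odot>\<^bsub>M\<^esub> x \<in> {y \<in> carrier M. killed N y}}"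
  have "submodule ?K R (ring_as_module R)"
    by (rule submodule_vimage[OF module_ring_as_module[OF M.is_cring] M mult_hom[OF M x] killed_submodule])
  then have "ideal ?K R" by (simp add: ideal_iff_submodule[OF M.is_cring])
  moreover have "S \<subseteq> ?K" using S(2) N x by auto
  ultimately have "\<aa> \<subseteq> ?K" unfolding S(3) by (rule M.R.genideal_minimal)
  then have "killed (Suc N) x" using x by (auto simp: killed_Suc)
  then show ?thesis using torsion_killed x by blast
qed

text \<open>Induction on the sum of the exponents takes the place of a pigeonhole count of
  monomials: multiplying \<open>x\<close> by a generator lowers the exponent of that generator by
  one, and an exponent 0 means that \<open>x\<close> is zero.\<close>

lemma torsionI_generator_powers:
  assumes x: "x \<in> carrier M" and "\<And>s. s \<in> S \<Longrightarrow> \<exists>k::nat. (s [^]\<^bsub>R\<^esub> k) \<odot>\<^bsub>M\<^esub> x = \<zero>\<^bsub>M\<^esub>"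
  shows "x \<in> torsion_submodule R \<aa> M"
proof -
  from assms(2) obtain k :: "'a \<Rightarrow> nat"
    where "\<And>s. s \<in> S \<Longrightarrow> (s [^]\<^bsub>R\<^esub> k s) \<odot>\<^bsub>M\<^esub> x = \<zero>\<^bsub>M\<^esub>" by metis
  then show ?thesis using x
  proof (induction "sum k S" arbitrary: k x rule: less_induct)
    case less
    show ?case
    proof (cases "\<exists>s\<in>S. k s = 0")
      case True
      then have "x = \<zero>\<^bsub>M\<^esub>" using less.prems by force
      then show ?thesis using submoduleD(2)[OF torsion_submodule] by simp
    next
      case False
      show ?thesis
      proof (rule torsionI_generators[OF less.prems(2)])
        fix s assume s: "s \<in> S"
        then have sc: "s \<in> carrier R" using S(2) by blast
        define k' where "k' = k(s := k s - 1)"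
        have ks: "k s = Suc (k' s)" unfolding k'_def using False s by simp
        have "sum k' S < sum k S"
          by (rule sum_strict_mono_ex1[OF S(1)]) (use s ks in \<open>auto simp: k'_def intro!: bexI[of _ s]\<close>)
        moreover have "(t [^]\<^bsub>R\<^esub> k' t) \<odot>\<^bsub>M\<^esub> (s \<odot>\<^bsub>M\<^esub> x) = \<zero>\<^bsub>M\<^esub>" if t: "t \<in> S" for t
        proof -
          have tc: "t \<in> carrier R" using t S(2) by blast
          show ?thesis
          proof (cases "t = s")
            case True
            then show ?thesis using less.prems(1)[OF s] ks sc less.prems(2)
              by (simp add: M.smult_assoc1[symmetric])
          next
            case False
            then have "k' t = k t" unfolding k'_def by simp
            then have "(t [^]\<^bsub>R\<^esub> k' t) \<odot>\<^bsub>M\<^esub> (s \<odot>\<^bsub>M\<^esub> x) = s \<odot>\<^bsub>M\<^esub> ((t [^]\<^bsub>R\<^esub> k t) \<odot>\<^bsub>M\<^esub> x)"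
              using sc tc less.prems(2) by (simp add: M.smult_assoc1[symmetric] M.R.m_comm)
            then show ?thesis using less.prems(1)[OF t] sc by simp
          qed
        qed
        ultimately show "s \<odot>\<^bsub>M\<^esub> x \<in> torsion_submodule R \<aa> M" using less.hyps sc less.prems(2) by blast
      qed
    qed
  qed
qed

end

end

lemma torsion_hom:
  assumes "ideal \<aa> R" "module R M" "module R N" "f \<in> module_homs R M N"
    and "x \<in> torsion_submodule R \<aa> M"
  shows "f x \<in> torsion_submodule R \<aa> N"
proof -
  interpret M: module R M by fact
  from assms(5) obtain n :: nat where n: "\<forall>r\<in>\<aa> [^]\<^bsub>ideals_set R\<^esub> n. r \<odot>\<^bsub>M\<^esub> x = \<zero>\<^bsub>M\<^esub>" "x \<in> carrier M"
    unfolding torsion_submodule_def by auto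
  have "r \<odot>\<^bsub>N\<^esub> f x = \<zero>\<^bsub>N\<^esub>" if "r \<in> \<aa> [^]\<^bsub>ideals_set R\<^esub> n" for r
  proof -
    have "r \<in> carrier R" using ideal.Icarr[OF ideal_power[OF M.R.ring_axioms assms(1)] that] .
    then show ?thesis using n that homs_smult[OF assms(4)] homs_zero[OF assms(4,2,3)] by metis
  qed
  then show ?thesis unfolding torsion_submodule_def using homs_closed[OF assms(4)] n(2) by blast
qed

text \<open>If \<open>c\<close> is maximal among the ideals with \<open>c \<inter> J = ker \<phi>\<close>, then \<open>\<phi>\<close> extends to \<open>R/c\<close>, and
  every element of \<open>\<aa>\<close> has a power in \<open>c\<close>. This replaces the usual appeal to Artin-Rees.\<close>

lemma baer_torsion:
  assumes noeth: "noetherian_ring R" and ideal: "ideal \<aa> R" and E: "baer R E"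
  shows "baer R (torsion_functor R \<aa> E)"
proof -
  let ?T = "torsion_submodule R \<aa> E" and ?R = "ring_as_module R"
  note mE = baerD1[OF E]
  interpret E: module R E by (fact mE)
  have T: "submodule ?T R E" by (rule torsion_submodule[OF ideal mE])
  have mT: "module R (E\<lparr>carrier := ?T\<rparr>)" by (rule restrict_module[OF T mE])
  have mR: "module R ?R" by (rule module_ring_as_module[OF E.is_cring])
  interpret Rm: module R ?R by (fact mR)
  obtain S where S: "S \<subseteq> carrier R" "finite S" "\<aa> = Idl\<^bsub>R\<^esub> S"
    using noetherian_ring.finetely_gen[OF noeth ideal] by blast
  have S_sub: "S \<subseteq> \<aa>" unfolding S(3) by (rule E.R.genideal_self[OF S(1)])
  have "\<exists>e\<in>?T. \<forall>j\<in>J. \<phi> j = j \<odot>\<^bsub>E\<^esub> e"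
    if J: "submodule J R ?R" and \<phi>: "\<phi> \<in> module_homs R (?R\<lparr>carrier := J\<rparr>) (E\<lparr>carrier := ?T\<rparr>)" for J \<phi>
  proof -
    have mJ: "module R (?R\<lparr>carrier := J\<rparr>)" by (rule restrict_module[OF J mR])
    have \<phi>E: "\<phi> \<in> module_homs R (?R\<lparr>carrier := J\<rparr>) E"
      by (rule homs_out[OF \<phi>]) (use submoduleD(1)[OF T] in auto)
    define b where "b = {x \<in> J. \<phi> x = \<zero>\<^bsub>E\<^esub>}"
    have "submodule {x \<in> carrier (?R\<lparr>carrier := J\<rparr>). \<phi> x \<in> {\<zero>\<^bsub>E\<^esub>}} R (?R\<lparr>carrier := J\<rparr>)"
      by (rule submodule_vimage[OF mJ mE \<phi>E submodule_zero_set[OF mE]])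
    then have b: "submodule b R ?R" using submodule_trans[OF mR J] by (simp add: b_def)
    define A where "A = {c. submodule c R ?R \<and> c \<inter> J = b}"
    have "\<exists>c\<in>A. \<forall>X\<in>A. c \<subseteq> X \<longrightarrow> X = c"
    proof (rule subset_Zorn_nonempty)
      have "b \<in> A" using b by (auto simp: A_def b_def)
      then show "A \<noteq> {}" by auto
      fix \<C> assume ne: "\<C> \<noteq> {}" and ch: "subset.chain A \<C>"
      then have sub: "submodule c R ?R" "c \<inter> J = b" if "c \<in> \<C>" for c
        using that unfolding subset.chain_def A_def by auto
      have "\<Union>\<C> \<inter> J = b" using ne sub(2) by blast
      then show "\<Union>\<C> \<in> A" unfolding A_def using submodule_Union_chain[OF mR ne ch] sub(1) by blast
    qed
    then obtain c where cA: "c \<in> A" and max: "\<And>X. X \<in> A \<Longrightarrow> c \<subseteq> X \<Longrightarrow> X = c" by blast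
    have c: "submodule c R ?R" and cJ: "c \<inter> J = b" using cA unfolding A_def by auto
    note c' = submoduleD[OF c, simplified]
    have pow: "\<exists>k::nat. x [^]\<^bsub>R\<^esub> k \<in> c" if xa: "x \<in> \<aa>" for x
    proof -
      have x: "x \<in> carrier R" using ideal.Icarr[OF ideal xa] .
      \<comment> \<open>The ideals \<open>(c : x^k)\<close> increase with \<open>k\<close>. The
        exponent at which they become stationary is the one whose power lies in
        \<open>c\<close>.\<close>
      define Q where "Q k = {r \<in> carrier R. r \<otimes>\<^bsub>R\<^esub> x [^]\<^bsub>R\<^esub> k \<in> c}" for k :: nat
      have "submodule (Q k) R ?R" for k
        using submodule_vimage[OF mR mR mult_hom[OF mR, of "x [^]\<^bsub>R\<^esub> k"] c] x unfolding Q_def by simp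
      then have "ideal (Q k) R" for k by (simp add: ideal_iff_submodule[OF E.is_cring])
      moreover have Q_Suc: "Q k \<subseteq> Q (Suc k)" for k
      proof
        fix r assume r: "r \<in> Q k"
        have "r \<otimes>\<^bsub>R\<^esub> x [^]\<^bsub>R\<^esub> Suc k = x \<otimes>\<^bsub>R\<^esub> (r \<otimes>\<^bsub>R\<^esub> x [^]\<^bsub>R\<^esub> k)"
          using r x by (simp add: Q_def E.R.m_ac)
        then show "r \<in> Q (Suc k)" using r x c'(4)[of x] by (simp add: Q_def)
      qed
      then have Q_mono: "Q i \<subseteq> Q j" if "i \<le> j" for i j using that by (rule lift_Suc_mono_le)
      then have "subset.chain {I. ideal I R} (range Q)"
        unfolding subset.chain_def using calculation nat_le_linear by (auto; blast)
      then have "\<Union>(range Q) \<in> range Q"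
        using noetherian_ring.ideal_chain_is_trivial[OF noeth] by blast
      then obtain k where "\<Union>(range Q) = Q k" by auto
      then have k: "Q n \<subseteq> Q k" for n by blast
      have xk: "x [^]\<^bsub>R\<^esub> k \<in> carrier ?R" using x by simp
      define X where "X = add_cyclic R ?R c (x [^]\<^bsub>R\<^esub> k)"
      have X: "submodule X R ?R" and cX: "c \<subseteq> X" and xX: "x [^]\<^bsub>R\<^esub> k \<in> X"
        unfolding X_def by (rule add_cyclic[OF mR c xk])+
      \<comment> \<open>This says that \<open>c + R x^k\<close> still meets \<open>J\<close> in
        \<open>b\<close> only, so maximality forces \<open>x^k\<close> into
        \<open>c\<close>.\<close>
      have "y \<in> b" if y: "y \<in> X" "y \<in> J" for y
      proof -
        from y(1) obtain p r where pr: "p \<in> c" "r \<in> carrier R" "y = p \<oplus>\<^bsub>R\<^esub> r \<otimes>\<^bsub>R\<^esub> x [^]\<^bsub>R\<^esub> k"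
          unfolding X_def add_cyclic_def by auto
        \<comment> \<open>Torsion of the values enters here: some \<open>x^n\<close> kills
          \<open>\<phi> y\<close>, so \<open>x^n y\<close> lies in the kernel \<open>b\<close>,
          hence in \<open>c\<close>. Subtracting \<open>x^n p\<close> leaves
          \<open>r x^(n+k)\<close> in \<open>c\<close>, and stationarity lowers the exponent to
          \<open>k\<close>.\<close>
        have "\<phi> y \<in> ?T" using homs_closed[OF \<phi>, of y] y(2) by simp
        then obtain n :: nat where n: "(x [^]\<^bsub>R\<^esub> n) \<odot>\<^bsub>E\<^esub> \<phi> y = \<zero>\<^bsub>E\<^esub>"
          using torsion_power[OF ideal mE] xa by blast
        have xn: "x [^]\<^bsub>R\<^esub> n \<in> carrier R" using x by simp
        have yc: "y \<in> carrier R" and pc: "p \<in> carrier R" using submoduleD(1)[OF J] y(2) c'(1) pr(1) by auto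
        have "\<phi> (x [^]\<^bsub>R\<^esub> n \<otimes>\<^bsub>R\<^esub> y) = \<zero>\<^bsub>E\<^esub>" using homs_smult[OF \<phi>E xn, of y] y(2) n by simp
        then have "x [^]\<^bsub>R\<^esub> n \<otimes>\<^bsub>R\<^esub> y \<in> b" unfolding b_def using submoduleD(4)[OF J xn y(2)] by simp
        then have *: "x [^]\<^bsub>R\<^esub> n \<otimes>\<^bsub>R\<^esub> y \<ominus>\<^bsub>?R\<^esub> x [^]\<^bsub>R\<^esub> n \<otimes>\<^bsub>R\<^esub> p \<in> c"
          using cJ c'(4)[OF xn pr(1)] submoduleD(6)[OF c] by blast
        have "x [^]\<^bsub>R\<^esub> n \<otimes>\<^bsub>R\<^esub> y \<ominus>\<^bsub>?R\<^esub> x [^]\<^bsub>R\<^esub> n \<otimes>\<^bsub>R\<^esub> p = x [^]\<^bsub>R\<^esub> n \<odot>\<^bsub>?R\<^esub> (y \<ominus>\<^bsub>?R\<^esub> p)"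
          using homs_minus[OF homs_smul[OF mR homs_id xn] mR mR, of y p] yc pc by simp
        also have "y \<ominus>\<^bsub>?R\<^esub> p = r \<otimes>\<^bsub>R\<^esub> x [^]\<^bsub>R\<^esub> k"
          using module_add_diff_cancel[OF mR, of p "r \<otimes>\<^bsub>R\<^esub> x [^]\<^bsub>R\<^esub> k"] pr x pc by simp
        finally have "r \<otimes>\<^bsub>R\<^esub> x [^]\<^bsub>R\<^esub> (n + k) \<in> c"
          using * pr(2) x by (simp add: E.R.nat_pow_mult[symmetric] E.R.m_ac)
        then have "r \<in> Q k" using k[of "n + k"] pr(2) unfolding Q_def by auto
        then have "y \<in> c" using pr(1,3) c'(3) unfolding Q_def by simp
        then show ?thesis using cJ y(2) by blast
      qed
      then have "X \<in> A" unfolding A_def using X cX cJ by blast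
      then have "X = c" using max cX by blast
      then show ?thesis using xX by blast
    qed
    let ?Q = "quotient_module ?R c"
    note mQ = module_quotient[OF mR c]
    obtain h where h: "h \<in> module_homs R ?Q E" "\<And>j. j \<in> J \<Longrightarrow> h (c +>\<^bsub>?R\<^esub> j) = \<phi> j"
    proof (rule baer_factor[OF E mJ mQ homs_restrict[OF proj_hom[OF mR c]] \<phi>E])
      show "J \<subseteq> carrier ?R" using submoduleD(1)[OF J] by blast
      fix x assume "x \<in> carrier (?R\<lparr>carrier := J\<rparr>)" "c +>\<^bsub>?R\<^esub> x = \<zero>\<^bsub>?Q\<^esub>"
      then have "x \<in> J" "x \<in> c" using proj_zero_iff[OF mR c, of x] submoduleD(1)[OF J] by auto
      then show "\<phi> x = \<zero>\<^bsub>E\<^esub>" using cJ unfolding b_def by blast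
    qed auto
    define e where "e = h (c +>\<^bsub>?R\<^esub> \<one>\<^bsub>R\<^esub>)"
    have hom: "(\<lambda>x. h (c +>\<^bsub>?R\<^esub> x)) \<in> module_homs R ?R E" by (rule homs_comp[OF proj_hom[OF mR c] h(1)])
    have e: "e \<in> carrier E" unfolding e_def using homs_closed[OF hom] by simp
    have he: "h (c +>\<^bsub>?R\<^esub> r) = r \<odot>\<^bsub>E\<^esub> e" if "r \<in> carrier R" for r
      unfolding e_def using homs_smult[OF hom that, of "\<one>\<^bsub>R\<^esub>"] that by simp
    \<comment> \<open>The element \<open>e\<close> is the image of the coset of one, so it is killed
      by the powers of the generators that lie in \<open>c\<close>.\<close>
    have "e \<in> ?T"
    proof (rule torsionI_generator_powers[OF ideal mE S(2,1,3) e])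
      fix s assume s: "s \<in> S"
      then obtain k :: nat where "s [^]\<^bsub>R\<^esub> k \<in> c" using pow S_sub by blast
      then have "(s [^]\<^bsub>R\<^esub> k) \<odot>\<^bsub>E\<^esub> e = \<zero>\<^bsub>E\<^esub>"
        using he[of "s [^]\<^bsub>R\<^esub> k"] proj_zero_iff[OF mR c, of "s [^]\<^bsub>R\<^esub> k"] s S(1) homs_zero[OF h(1) mQ mE]
        by auto
      then show "\<exists>k::nat. (s [^]\<^bsub>R\<^esub> k) \<odot>\<^bsub>E\<^esub> e = \<zero>\<^bsub>E\<^esub>" by blast
    qed
    moreover have "\<forall>j\<in>J. \<phi> j = j \<odot>\<^bsub>E\<^esub> e" using h(2) he submoduleD(1)[OF J] by force
    ultimately show ?thesis by blast
  qed
  then show ?thesis unfolding baer_def torsion_functor_def using mT by auto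
qed

section \<open>Comparison of injective resolutions\<close>

text \<open>The type of the terms is left open, so that the chosen resolutions, the torsion-free
  complements and the cone are all instances.\<close>

locale inj_resolution =
  fixes R :: "('a, 'r) ring_scheme" and M :: "('a, 'm, 'c) module_scheme"
    and I :: "nat \<Rightarrow> ('a, 'e) module" and d and \<epsilon>
  assumes M: "module R M" and res: "injective_resolution R M I d \<epsilon>"
begin

lemma baer: "baer R (I n)"
  using res unfolding injective_resolution_def by (simp add: injective_module_iff_baer)

lemma module: "module R (I n)"
  by (rule baerD1[OF baer])

lemma d_hom: "d n \<in> module_homs R (I n) (I (Suc n))"
  and aug_hom: "\<epsilon> \<in> module_homs R M (I 0)"
  and aug_inj: "inj_on \<epsilon> (carrier M)"
  using res unfolding injective_resolution_def by simp_all

lemma aug_zero_iff: "x \<in> carrier M \<Longrightarrow> \<epsilon> x = \<zero>\<^bsub>I 0\<^esub> \<longleftrightarrow> x = \<zero>\<^bsub>M\<^esub>"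
proof -
  interpret M: module R M by (rule M)
  show "x \<in> carrier M \<Longrightarrow> ?thesis"
    using inj_onD[OF aug_inj, of x "\<zero>\<^bsub>M\<^esub>"] homs_zero[OF aug_hom M module] by auto
qed

lemma exact0: "x \<in> carrier (I 0) \<Longrightarrow> d 0 x = \<zero>\<^bsub>I (Suc 0)\<^esub> \<longleftrightarrow> x \<in> \<epsilon> ` carrier M"
  using res unfolding injective_resolution_def by (simp add: a_kernel_def')

lemma exact: "x \<in> carrier (I (Suc n)) \<Longrightarrow> d (Suc n) x = \<zero>\<^bsub>I (Suc (Suc n))\<^esub> \<longleftrightarrow> x \<in> d n ` carrier (I n)"
  using res unfolding injective_resolution_def by (simp add: a_kernel_def')

lemma d_d: "x \<in> carrier (I n) \<Longrightarrow> d (Suc n) (d n x) = \<zero>\<^bsub>I (Suc (Suc n))\<^esub>"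
  using exact[of "d n x" n] homs_closed[OF d_hom, of x n] by blast

lemma d_aug: "x \<in> carrier M \<Longrightarrow> d 0 (\<epsilon> x) = \<zero>\<^bsub>I (Suc 0)\<^esub>"
  using exact0[of "\<epsilon> x"] homs_closed[OF aug_hom, of x] by blast

text \<open>The comparison theorem, with exactness on the side of the source and injectivity on the
  side of the target. The target is any complex of injectives, in a type of its own.\<close>

lemma lift:
  fixes J :: "nat \<Rightarrow> ('a, 'f) module" and \<delta>
  assumes baerJ: "\<And>n. baer R (J n)"
    and \<delta>: "\<And>n. \<delta> n \<in> module_homs R (J n) (J (Suc n))"
    and \<delta>\<delta>: "\<And>n x. x \<in> carrier (J n) \<Longrightarrow> \<delta> (Suc n) (\<delta> n x) = \<zero>\<^bsub>J (Suc (Suc n))\<^esub>"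
    and f: "f \<in> module_homs R M (J 0)"
    and \<delta>f: "\<And>x. x \<in> carrier M \<Longrightarrow> \<delta> 0 (f x) = \<zero>\<^bsub>J (Suc 0)\<^esub>"
  obtains \<phi> where "\<And>n. \<phi> n \<in> module_homs R (I n) (J n)"
    "\<And>n x. x \<in> carrier (I n) \<Longrightarrow> \<phi> (Suc n) (d n x) = \<delta> n (\<phi> n x)"
    "\<And>x. x \<in> carrier M \<Longrightarrow> \<phi> 0 (\<epsilon> x) = f x"
proof -
  \<comment> \<open>The invariant for the successive choices:
    \<open>\<delta> n \<circ> \<phi> n\<close> vanishes on the kernel of \<open>d n\<close>, so it
    factors through \<open>d n\<close> and gives the next map.\<close>
  define P where "P n \<phi> \<longleftrightarrow> \<phi> \<in> module_homs R (I n) (J n) \<and>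
    (\<forall>x\<in>carrier (I n). d n x = \<zero>\<^bsub>I (Suc n)\<^esub> \<longrightarrow> \<delta> n (\<phi> x) = \<zero>\<^bsub>J (Suc n)\<^esub>) \<and>
    (n = 0 \<longrightarrow> (\<forall>x\<in>carrier M. \<phi> (\<epsilon> x) = f x))" for n \<phi>
  define Q where "Q n \<phi> \<psi> \<longleftrightarrow> (\<forall>x\<in>carrier (I n). \<psi> (d n x) = \<delta> n (\<phi> x))"
    for n and \<phi> \<psi> :: "'e \<Rightarrow> 'f"
  have "\<exists>\<phi>. P 0 \<phi>"
  proof -
    obtain \<phi> where \<phi>: "\<phi> \<in> module_homs R (I 0) (J 0)" "\<And>x. x \<in> carrier M \<Longrightarrow> \<phi> (\<epsilon> x) = f x"
    proof (rule baer_factor[OF baerJ M module aug_hom f])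
      show "\<And>x. x \<in> carrier M \<Longrightarrow> \<epsilon> x = \<zero>\<^bsub>I 0\<^esub> \<Longrightarrow> f x = \<zero>\<^bsub>J 0\<^esub>"
        using aug_zero_iff homs_zero[OF f M baerD1[OF baerJ]] by simp
    qed blast
    then have "P 0 \<phi>" unfolding P_def using exact0 \<delta>f by auto
    then show ?thesis by blast
  qed
  moreover have "\<exists>\<psi>. P (Suc n) \<psi> \<and> Q n \<phi> \<psi>" if "P n \<phi>" for n \<phi>
  proof -
    have \<phi>: "\<phi> \<in> module_homs R (I n) (J n)"
      and ker: "\<And>x. x \<in> carrier (I n) \<Longrightarrow> d n x = \<zero>\<^bsub>I (Suc n)\<^esub> \<Longrightarrow> \<delta> n (\<phi> x) = \<zero>\<^bsub>J (Suc n)\<^esub>"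
      using that unfolding P_def by auto
    obtain \<psi> where \<psi>: "\<psi> \<in> module_homs R (I (Suc n)) (J (Suc n))"
      "\<And>x. x \<in> carrier (I n) \<Longrightarrow> \<psi> (d n x) = \<delta> n (\<phi> x)"
      using baer_factor[OF baerJ module module d_hom homs_comp[OF \<phi> \<delta>] ker] by blast
    then have "P (Suc n) \<psi> \<and> Q n \<phi> \<psi>"
      unfolding P_def Q_def using exact \<delta>\<delta> homs_closed[OF \<phi>] by auto
    then show ?thesis by blast
  qed
  ultimately obtain \<phi> where "\<And>n. P n (\<phi> n)" "\<And>n. Q n (\<phi> n) (\<phi> (Suc n))"
    using dependent_nat_choice[of P Q] by metis
  then show ?thesis using that[of \<phi>] unfolding P_def Q_def by blast
qed

text \<open>This is the uniqueness of lifts up to homotopy. It is applied to the difference between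
  the identity and an endomorphism that lifts it.\<close>

lemma homotopy:
  fixes J :: "nat \<Rightarrow> ('a, 'f) module" and \<delta>
  assumes baerJ: "\<And>n. baer R (J n)"
    and \<delta>: "\<And>n. \<delta> n \<in> module_homs R (J n) (J (Suc n))"
    and \<delta>\<delta>: "\<And>n x. x \<in> carrier (J n) \<Longrightarrow> \<delta> (Suc n) (\<delta> n x) = \<zero>\<^bsub>J (Suc (Suc n))\<^esub>"
    and \<theta>: "\<And>n. \<theta> n \<in> module_homs R (I n) (J n)"
    and chain: "\<And>n x. x \<in> carrier (I n) \<Longrightarrow> \<theta> (Suc n) (d n x) = \<delta> n (\<theta> n x)"
    and aug: "\<And>x. x \<in> carrier M \<Longrightarrow> \<theta> 0 (\<epsilon> x) = \<zero>\<^bsub>J 0\<^esub>"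
  obtains s where "\<And>n. s n \<in> module_homs R (I (Suc n)) (J n)"
    "\<And>x. x \<in> carrier (I 0) \<Longrightarrow> \<theta> 0 x = s 0 (d 0 x)"
    "\<And>n x. x \<in> carrier (I (Suc n)) \<Longrightarrow> \<theta> (Suc n) x = s (Suc n) (d (Suc n) x) \<oplus>\<^bsub>J (Suc n)\<^esub> \<delta> n (s n x)"
proof -
  note mJ = baerD1[OF baerJ]
  \<comment> \<open>Together with the chain map property this invariant makes
    \<open>\<theta> (Suc n) - \<delta> n \<circ> s n\<close> vanish on the image of
    \<open>d n\<close>, which is the kernel of \<open>d (Suc n)\<close>. Hence the next
    \<open>s\<close> exists.\<close>
  define P where "P n s \<longleftrightarrow> s \<in> module_homs R (I (Suc n)) (J n) \<and>
    (\<forall>x\<in>carrier (I n). \<delta> n (\<theta> n x) = \<delta> n (s (d n x))) \<and>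
    (n = 0 \<longrightarrow> (\<forall>x\<in>carrier (I 0). \<theta> 0 x = s (d 0 x)))" for n s
  define Q where "Q n s s' \<longleftrightarrow> (\<forall>x\<in>carrier (I (Suc n)). \<theta> (Suc n) x = s' (d (Suc n) x) \<oplus>\<^bsub>J (Suc n)\<^esub> \<delta> n (s x))"
    for n and s s' :: "'e \<Rightarrow> 'f"
  have "\<exists>s. P 0 s"
  proof -
    obtain s where s: "s \<in> module_homs R (I (Suc 0)) (J 0)" "\<And>x. x \<in> carrier (I 0) \<Longrightarrow> s (d 0 x) = \<theta> 0 x"
      by (rule baer_factor[OF baerJ module module d_hom \<theta>[of 0]]) (use exact0 aug in auto)
    then have "P 0 s" unfolding P_def by auto
    then show ?thesis by blast
  qed
  moreover have "\<exists>s'. P (Suc n) s' \<and> Q n s s'" if "P n s" for n s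
  proof -
    interpret J: module R "J (Suc n)" by (rule mJ)
    interpret J2: module R "J (Suc (Suc n))" by (rule mJ)
    have s: "s \<in> module_homs R (I (Suc n)) (J n)"
      and eq: "\<And>x. x \<in> carrier (I n) \<Longrightarrow> \<delta> n (\<theta> n x) = \<delta> n (s (d n x))"
      using that unfolding P_def by auto
    have \<delta>s: "(\<lambda>x. \<delta> n (s x)) \<in> module_homs R (I (Suc n)) (J (Suc n))" by (rule homs_comp[OF s \<delta>])
    obtain s' where s': "s' \<in> module_homs R (I (Suc (Suc n))) (J (Suc n))"
      "\<And>x. x \<in> carrier (I (Suc n)) \<Longrightarrow> s' (d (Suc n) x) = \<theta> (Suc n) x \<ominus>\<^bsub>J (Suc n)\<^esub> \<delta> n (s x)"
    proof (rule baer_factor[OF baerJ module module d_hom homs_diff[OF mJ \<theta> \<delta>s]])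
      fix x assume "x \<in> carrier (I (Suc n))" "d (Suc n) x = \<zero>\<^bsub>I (Suc (Suc n))\<^esub>"
      then obtain y where y: "x = d n y" "y \<in> carrier (I n)" using exact by auto
      then have "\<theta> (Suc n) x = \<delta> n (s x)" using chain eq by simp
      then show "\<theta> (Suc n) x \<ominus>\<^bsub>J (Suc n)\<^esub> \<delta> n (s x) = \<zero>\<^bsub>J (Suc n)\<^esub>"
        using homs_closed[OF \<delta>s] \<open>x \<in> _\<close> by (simp add: a_minus_def J.M.r_neg)
    qed blast
    have Q: "Q n s s'" unfolding Q_def
    proof
      fix x assume x: "x \<in> carrier (I (Suc n))"
      show "\<theta> (Suc n) x = s' (d (Suc n) x) \<oplus>\<^bsub>J (Suc n)\<^esub> \<delta> n (s x)"
        using s'(2)[OF x] homs_closed[OF \<theta> x] homs_closed[OF \<delta>s x]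
        by (simp add: a_minus_def J.M.a_assoc J.M.l_neg)
    qed
    have "\<delta> (Suc n) (\<theta> (Suc n) x) = \<delta> (Suc n) (s' (d (Suc n) x))" if x: "x \<in> carrier (I (Suc n))" for x
      using Q x homs_add[OF \<delta>, of "s' (d (Suc n) x)" "Suc n" "\<delta> n (s x)"] homs_closed[OF \<delta>s x]
        homs_closed[OF s'(1) homs_closed[OF d_hom x]] \<delta>\<delta>[OF homs_closed[OF s x]]
        homs_closed[OF \<delta>[of "Suc n"], of "s' (d (Suc n) x)"]
      unfolding Q_def by simp
    then have "P (Suc n) s'" unfolding P_def using s' by auto
    then show ?thesis using Q by blast
  qed
  ultimately obtain s where "\<And>n. P n (s n)" "\<And>n. Q n (s n) (s (Suc n))"
    using dependent_nat_choice[of P Q] by metis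
  then show ?thesis using that[of s] unfolding P_def Q_def by blast
qed

end

section \<open>Ext as cohomology of annihilated elements\<close>

text \<open>For an ideal \<aa> and a module \<open>E\<close> this is a copy of
  \<open>Hom(R/\<aa>, E)\<close>, by evaluation at the coset of one.\<close>

definition annihilated :: "'a set \<Rightarrow> ('a, 'm, 'c) module_scheme \<Rightarrow> 'm set"
  where "annihilated \<aa> E = {x \<in> carrier E. \<forall>r\<in>\<aa>. r \<odot>\<^bsub>E\<^esub> x = \<zero>\<^bsub>E\<^esub>}"

lemma annihilated_submodule:
  assumes "module R E" "\<aa> \<subseteq> carrier R"
  shows "submodule (annihilated \<aa> E) R E"
proof -
  interpret E: module R E by fact
  show ?thesis
  proof (rule submoduleI'[OF assms(1)])
    fix r x assume rx: "r \<in> carrier R" "x \<in> annihilated \<aa> E"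
    have "s \<odot>\<^bsub>E\<^esub> (r \<odot>\<^bsub>E\<^esub> x) = r \<odot>\<^bsub>E\<^esub> (s \<odot>\<^bsub>E\<^esub> x)" if "s \<in> \<aa>" for s
    proof -
      have "s \<in> carrier R" "x \<in> carrier E" using that assms(2) rx by (auto simp: annihilated_def)
      then show ?thesis using rx(1) by (simp add: E.smult_assoc1[symmetric] E.R.m_comm)
    qed
    then show "r \<odot>\<^bsub>E\<^esub> x \<in> annihilated \<aa> E" using rx by (simp add: annihilated_def)
  qed (use assms(2) in \<open>auto simp: annihilated_def E.smult_r_distr subset_eq\<close>)
qed

lemma annihilated_hom:
  assumes "module R E" "module R F" "f \<in> module_homs R E F" "\<aa> \<subseteq> carrier R" "x \<in> annihilated \<aa> E"
  shows "f x \<in> annihilated \<aa> F"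
proof -
  have "r \<odot>\<^bsub>F\<^esub> f x = \<zero>\<^bsub>F\<^esub>" if "r \<in> \<aa>" for r
    using assms that homs_smult[OF assms(3), of r x] homs_zero[OF assms(3,1,2)] by (auto simp: annihilated_def)
  then show ?thesis using assms homs_closed[OF assms(3)] by (simp add: annihilated_def)
qed

definition ann_cocycles where
  "ann_cocycles \<aa> I d i = {x \<in> annihilated \<aa> (I i). d i x = \<zero>\<^bsub>I (Suc i)\<^esub>}"

definition ann_coboundaries where
  "ann_coboundaries \<aa> I d i = (case i of 0 \<Rightarrow> {\<zero>\<^bsub>I 0\<^esub>} | Suc j \<Rightarrow> d j ` annihilated \<aa> (I j))"

text \<open>A model of Ext with first argument \<open>R/\<aa>\<close>, in which the function modules
  \<open>Hom(R/\<aa>, I)\<close> are replaced by submodules of the terms of \<open>I\<close>. It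
  makes sense for resolutions in every type.\<close>

definition ann_cohomology where
  "ann_cohomology \<aa> I d i =
    quotient_module ((I i)\<lparr>carrier := ann_cocycles \<aa> I d i\<rparr>) (ann_coboundaries \<aa> I d i)"

context inj_resolution
begin

context
  fixes \<aa> :: "'a set"
  assumes \<aa>: "\<aa> \<subseteq> carrier R"
begin

lemma cocycles_submodule: "submodule (ann_cocycles \<aa> I d i) R (I i)"
proof -
  have "ann_cocycles \<aa> I d i = annihilated \<aa> (I i) \<inter> {x \<in> carrier (I i). d i x \<in> {\<zero>\<^bsub>I (Suc i)\<^esub>}}"
    unfolding ann_cocycles_def annihilated_def by auto
  then show ?thesis
    using submodule_inter[OF module annihilated_submodule[OF module \<aa>]
        submodule_vimage[OF module module d_hom submodule_zero_set[OF module]]] by simp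
qed

lemma coboundaries_submodule: "submodule (ann_coboundaries \<aa> I d i) R (I i)"
  unfolding ann_coboundaries_def
  using submodule_zero_set[OF module] submodule_image[OF module module d_hom annihilated_submodule[OF module \<aa>]]
  by (auto split: nat.split)

lemma coboundaries_subset: "ann_coboundaries \<aa> I d i \<subseteq> ann_cocycles \<aa> I d i"
proof (cases i)
  case 0
  then show ?thesis using submoduleD(2)[OF cocycles_submodule[of 0]] by (simp add: ann_coboundaries_def)
next
  case (Suc j)
  then show ?thesis
    using annihilated_hom[OF module module d_hom \<aa>] d_d[of _ j]
    by (auto simp: ann_coboundaries_def ann_cocycles_def) (simp add: annihilated_def)
qed

lemma coboundaries_hom:
  fixes J :: "nat \<Rightarrow> ('a, 'f) module"
  assumes mJ: "\<And>n. module R (J n)"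
    and \<theta>: "\<And>n. \<theta> n \<in> module_homs R (I n) (J n)"
    and chain: "\<And>n x. x \<in> carrier (I n) \<Longrightarrow> \<theta> (Suc n) (d n x) = \<delta> n (\<theta> n x)"
    and x: "x \<in> ann_coboundaries \<aa> I d i"
  shows "\<theta> i x \<in> ann_coboundaries \<aa> J \<delta> i"
proof (cases i)
  case 0
  then show ?thesis using x homs_zero[OF \<theta> module mJ, of 0] by (simp add: ann_coboundaries_def)
next
  case (Suc j)
  then obtain y where y: "x = d j y" "y \<in> annihilated \<aa> (I j)" using x by (auto simp: ann_coboundaries_def)
  then have "\<theta> i x = \<delta> j (\<theta> j y)" using Suc chain by (simp add: annihilated_def)
  then show ?thesis using annihilated_hom[OF module mJ \<theta> \<aa> y(2)] Suc by (simp add: ann_coboundaries_def)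
qed

lemma cocycles_hom:
  fixes J :: "nat \<Rightarrow> ('a, 'f) module"
  assumes mJ: "\<And>n. module R (J n)"
    and \<theta>: "\<And>n. \<theta> n \<in> module_homs R (I n) (J n)"
    and chain: "\<And>n x. x \<in> carrier (I n) \<Longrightarrow> \<theta> (Suc n) (d n x) = \<delta> n (\<theta> n x)"
    and x: "x \<in> ann_cocycles \<aa> I d i"
  shows "\<theta> i x \<in> ann_cocycles \<aa> J \<delta> i"
proof -
  have "\<delta> i (\<theta> i x) = \<theta> (Suc i) (d i x)" using chain[of x i] x by (simp add: ann_cocycles_def annihilated_def)
  also have "\<dots> = \<zero>\<^bsub>J (Suc i)\<^esub>" using x homs_zero[OF \<theta> module mJ] by (simp add: ann_cocycles_def)
  finally show ?thesis
    using annihilated_hom[OF module mJ \<theta> \<aa>] x by (simp add: ann_cocycles_def)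
qed

text \<open>The homotopy between \<open>\<theta>\<close> and the identity is linear, so it preserves
  annihilated elements. On a cocycle only its coboundary term survives.\<close>

lemma null_homotopic_cocycle:
  assumes \<theta>: "\<And>n. \<theta> n \<in> module_homs R (I n) (I n)"
    and chain: "\<And>n x. x \<in> carrier (I n) \<Longrightarrow> \<theta> (Suc n) (d n x) = d n (\<theta> n x)"
    and aug: "\<And>x. x \<in> carrier M \<Longrightarrow> \<theta> 0 (\<epsilon> x) = \<epsilon> x"
    and x: "x \<in> ann_cocycles \<aa> I d i"
  shows "x \<ominus>\<^bsub>I i\<^esub> \<theta> i x \<in> ann_coboundaries \<aa> I d i"
proof -
  interpret Ii: module R "I i" by (rule module)
  define \<eta> where "\<eta> n x = x \<ominus>\<^bsub>I n\<^esub> \<theta> n x" for n x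
  have \<eta>: "\<eta> n \<in> module_homs R (I n) (I n)" for n
    unfolding \<eta>_def by (rule homs_diff[OF module homs_id \<theta>])
  have chain': "\<eta> (Suc n) (d n x) = d n (\<eta> n x)" if "x \<in> carrier (I n)" for n x
    unfolding \<eta>_def using that chain homs_minus[OF d_hom module module] homs_closed[OF \<theta>] by simp
  have aug': "\<eta> 0 (\<epsilon> x) = \<zero>\<^bsub>I 0\<^esub>" if "x \<in> carrier M" for x
    unfolding \<eta>_def using that aug homs_closed[OF aug_hom] homs_eq_iff_diff[OF module] by simp
  obtain s where s: "\<And>n. s n \<in> module_homs R (I (Suc n)) (I n)"
    "\<And>x. x \<in> carrier (I 0) \<Longrightarrow> \<eta> 0 x = s 0 (d 0 x)"
    "\<And>n x. x \<in> carrier (I (Suc n)) \<Longrightarrow> \<eta> (Suc n) x = s (Suc n) (d (Suc n) x) \<oplus>\<^bsub>I (Suc n)\<^esub> d n (s n x)"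
    using homotopy[OF baer d_hom d_d \<eta> chain' aug'] by blast
  have xc: "x \<in> carrier (I i)" and xa: "x \<in> annihilated \<aa> (I i)" and dx: "d i x = \<zero>\<^bsub>I (Suc i)\<^esub>"
    using x by (auto simp: ann_cocycles_def annihilated_def)
  have "\<eta> i x \<in> ann_coboundaries \<aa> I d i"
  proof (cases i)
    case 0
    then show ?thesis using s(2)[of x] xc dx homs_zero[OF s(1) module module, of 0]
      by (simp add: ann_coboundaries_def)
  next
    case (Suc j)
    interpret Sj: module R "I (Suc j)" by (rule module)
    have c: "d j (s j x) \<in> carrier (I i)" using Suc xc homs_closed[OF d_hom] homs_closed[OF s(1)] by simp
    then have "\<eta> i x = d j (s j x)"
      using s(3)[of x j] xc dx homs_zero[OF s(1) module module, of i] unfolding Suc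
      by (simp add: Sj.M.l_zero)
    moreover have "s j x \<in> annihilated \<aa> (I j)"
      using annihilated_hom[OF module module s(1)[of j] \<aa>, of x] xa Suc by simp
    ultimately show ?thesis using Suc by (simp add: ann_coboundaries_def)
  qed
  then show ?thesis by (simp add: \<eta>_def)
qed

lemma module_ann_cohomology: "module R (ann_cohomology \<aa> I d i)"
  unfolding ann_cohomology_def
  by (intro module_quotient submodule_restrict restrict_module module cocycles_submodule
      coboundaries_submodule coboundaries_subset)

end

end

text \<open>Lifts of the identity of \<open>M\<close> in both directions compose to maps homotopic
  to the identity. One composite shows that \<open>\<phi>\<close> reflects coboundaries, the other
  that it is onto modulo coboundaries.\<close>

lemma ann_cohomology_iso:
  fixes R :: "('a, 'r) ring_scheme" and I :: "nat \<Rightarrow> ('a, 'e) module" and J :: "nat \<Rightarrow> ('a, 'f) module"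
  assumes I: "inj_resolution R M I d \<epsilon>" and J: "inj_resolution R M J \<delta> \<eta>" and \<aa>: "\<aa> \<subseteq> carrier R"
  shows "module_iso R (ann_cohomology \<aa> I d i) (ann_cohomology \<aa> J \<delta> i)"
proof -
  interpret I: inj_resolution R M I d \<epsilon> by fact
  interpret J: inj_resolution R M J \<delta> \<eta> by fact
  obtain \<phi> where \<phi>: "\<And>n. \<phi> n \<in> module_homs R (I n) (J n)"
    "\<And>n x. x \<in> carrier (I n) \<Longrightarrow> \<phi> (Suc n) (d n x) = \<delta> n (\<phi> n x)"
    "\<And>x. x \<in> carrier M \<Longrightarrow> \<phi> 0 (\<epsilon> x) = \<eta> x"
    using I.lift[OF J.baer J.d_hom J.d_d J.aug_hom J.d_aug] by blast
  obtain \<psi> where \<psi>: "\<And>n. \<psi> n \<in> module_homs R (J n) (I n)"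
    "\<And>n x. x \<in> carrier (J n) \<Longrightarrow> \<psi> (Suc n) (\<delta> n x) = d n (\<psi> n x)"
    "\<And>x. x \<in> carrier M \<Longrightarrow> \<psi> 0 (\<eta> x) = \<epsilon> x"
    using J.lift[OF I.baer I.d_hom I.d_d I.aug_hom I.d_aug] by blast
  have \<psi>\<phi>: "x \<ominus>\<^bsub>I i\<^esub> \<psi> i (\<phi> i x) \<in> ann_coboundaries \<aa> I d i" if "x \<in> ann_cocycles \<aa> I d i" for x
    by (rule I.null_homotopic_cocycle[OF \<aa> homs_comp[OF \<phi>(1) \<psi>(1)] _ _ that])
      (simp_all add: \<phi> \<psi> homs_closed[OF \<phi>(1)])
  have \<phi>\<psi>: "x \<ominus>\<^bsub>J i\<^esub> \<phi> i (\<psi> i x) \<in> ann_coboundaries \<aa> J \<delta> i" if "x \<in> ann_cocycles \<aa> J \<delta> i" for x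
    by (rule J.null_homotopic_cocycle[OF \<aa> homs_comp[OF \<psi>(1) \<phi>(1)] _ _ that])
      (simp_all add: \<phi> \<psi> homs_closed[OF \<psi>(1)])
  let ?Z = "ann_cocycles \<aa> I d i" and ?Z' = "ann_cocycles \<aa> J \<delta> i"
  have Z: "submodule ?Z R (I i)" and Z': "submodule ?Z' R (J i)"
    by (rule I.cocycles_submodule[OF \<aa>] J.cocycles_submodule[OF \<aa>])+
  have mZ: "module R ((I i)\<lparr>carrier := ?Z\<rparr>)" and mZ': "module R ((J i)\<lparr>carrier := ?Z'\<rparr>)"
    by (rule restrict_module[OF Z I.module] restrict_module[OF Z' J.module])+
  have Bsub: "submodule (ann_coboundaries \<aa> I d i) R ((I i)\<lparr>carrier := ?Z\<rparr>)"
    by (rule submodule_restrict[OF I.module Z I.coboundaries_submodule[OF \<aa>] I.coboundaries_subset[OF \<aa>]])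
  have Bsub': "submodule (ann_coboundaries \<aa> J \<delta> i) R ((J i)\<lparr>carrier := ?Z'\<rparr>)"
    by (rule submodule_restrict[OF J.module Z' J.coboundaries_submodule[OF \<aa>] J.coboundaries_subset[OF \<aa>]])
  have id': "(\<lambda>x. x) \<in> module_homs R ((J i)\<lparr>carrier := ?Z'\<rparr>) (J i)"
    by (rule homs_restrict[OF homs_id]) (use submoduleD(1)[OF Z'] in blast)
  show ?thesis unfolding ann_cohomology_def
  proof (rule quotient_iso[OF mZ mZ' Bsub Bsub', of "\<phi> i"])
    show "\<phi> i \<in> module_homs R ((I i)\<lparr>carrier := ?Z\<rparr>) ((J i)\<lparr>carrier := ?Z'\<rparr>)"
      using I.cocycles_hom[OF \<aa> J.module \<phi>(1,2)] submoduleD(1)[OF Z]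
      by (intro homs_into[OF homs_restrict[OF \<phi>(1)]]) auto
    fix x assume "x \<in> carrier ((I i)\<lparr>carrier := ?Z\<rparr>)"
    then have x: "x \<in> ?Z" by simp
    show "\<phi> i x \<in> ann_coboundaries \<aa> J \<delta> i \<longleftrightarrow> x \<in> ann_coboundaries \<aa> I d i"
    proof
      assume "\<phi> i x \<in> ann_coboundaries \<aa> J \<delta> i"
      then have 1: "\<psi> i (\<phi> i x) \<in> ann_coboundaries \<aa> I d i"
        using J.coboundaries_hom[OF \<aa> I.module \<psi>(1,2), of "\<phi> i x" i] by blast
      interpret Ii: module R "I i" by (rule I.module)
      have c: "x \<in> carrier (I i)" "\<psi> i (\<phi> i x) \<in> carrier (I i)"
        using x submoduleD(1)[OF Z] homs_closed[OF \<psi>(1)] homs_closed[OF \<phi>(1)] by auto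
      then have "x = (x \<ominus>\<^bsub>I i\<^esub> \<psi> i (\<phi> i x)) \<oplus>\<^bsub>I i\<^esub> \<psi> i (\<phi> i x)"
        by (simp add: a_minus_def Ii.M.a_assoc Ii.M.l_neg)
      then show "x \<in> ann_coboundaries \<aa> I d i"
        using 1 \<psi>\<phi>[OF x] submoduleD(3)[OF I.coboundaries_submodule[OF \<aa>]] by metis
    next
      show "x \<in> ann_coboundaries \<aa> I d i \<Longrightarrow> \<phi> i x \<in> ann_coboundaries \<aa> J \<delta> i"
        by (rule I.coboundaries_hom[OF \<aa> J.module \<phi>(1,2)])
    qed
  next
    fix y assume "y \<in> carrier ((J i)\<lparr>carrier := ?Z'\<rparr>)"
    then have y: "y \<in> ?Z'" by simp
    have 1: "\<psi> i y \<in> ?Z" by (rule J.cocycles_hom[OF \<aa> I.module \<psi>(1,2) y])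
    have 2: "\<phi> i (\<psi> i y) \<in> ?Z'" by (rule I.cocycles_hom[OF \<aa> J.module \<phi>(1,2) 1])
    \<comment> \<open>The additive inverse depends on the carrier of the record, so the two
      differences have to be identified through the inclusion.\<close>
    have "y \<ominus>\<^bsub>(J i)\<lparr>carrier := ?Z'\<rparr>\<^esub> \<phi> i (\<psi> i y) = y \<ominus>\<^bsub>J i\<^esub> \<phi> i (\<psi> i y)"
      using homs_minus[OF id' mZ' J.module, of y "\<phi> i (\<psi> i y)"] y 2 by simp
    then show "\<exists>x\<in>carrier ((I i)\<lparr>carrier := ?Z\<rparr>).
        y \<ominus>\<^bsub>(J i)\<lparr>carrier := ?Z'\<rparr>\<^esub> \<phi> i x \<in> ann_coboundaries \<aa> J \<delta> i"
      using 1 \<phi>\<psi>[OF y] by (intro bexI[of _ "\<psi> i y"]) auto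
  qed
qed

text \<open>An annihilated element \<open>e\<close> corresponds to the homomorphism that sends the
  coset of \<open>r\<close> to \<open>r e\<close>. This correspondence \<open>h\<close> commutes
  with the differentials, so it matches cocycles and coboundaries, and the module axioms for Ext are
  inherited along it.\<close>

lemma Ext_iso_ann:
  fixes R :: "('a, 'r) ring_scheme" and N :: "('a, 'n, 'd) module_scheme"
  assumes ideal: "ideal \<aa> R" and Id: "inj_res R N = (I, d)" and I: "inj_resolution R N I d \<epsilon>"
  shows "module R (Ext R i (residue_module R \<aa>) N)"
    and "module_iso R (ann_cohomology \<aa> I d i) (Ext R i (residue_module R \<aa>) N)"
proof -
  interpret I: inj_resolution R N I d \<epsilon> by fact
  interpret N: module R N by (rule I.M)
  let ?R = "ring_as_module R" and ?Q = "residue_module R \<aa>"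
  have mR: "module R ?R" by (rule module_ring_as_module[OF N.is_cring])
  have sa: "submodule \<aa> R ?R" using ideal ideal_iff_submodule[OF N.is_cring] by simp
  have \<aa>: "\<aa> \<subseteq> carrier R" using submoduleD(1)[OF sa] by auto
  let ?p = "\<lambda>r. \<aa> +>\<^bsub>?R\<^esub> r"
  have mQ: "module R ?Q" unfolding residue_module_def by (rule module_quotient[OF mR sa])
  have p: "?p \<in> module_homs R ?R ?Q" unfolding residue_module_def by (rule proj_hom[OF mR sa])
  have cQ: "carrier ?Q = ?p ` carrier R" unfolding residue_module_def using carrier_quotient[OF mR sa] by simp
  define u where "u = ?p \<one>\<^bsub>R\<^esub>"
  have uQ: "u \<in> carrier ?Q" unfolding u_def cQ by simp
  \<comment> \<open>The choice picks a representative of the coset \<open>q\<close>; by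
    \<open>h_p\<close> the value is the same for all of them. The restriction makes
    \<open>h n e\<close> extensional, as \<open>Hom_module\<close> demands.\<close>
  define h where "h n e = restrict (\<lambda>q. (SOME r. r \<in> carrier R \<and> q = ?p r) \<odot>\<^bsub>I n\<^esub> e) (carrier ?Q)" for n e
  let ?A = "\<lambda>n. annihilated \<aa> (I n)"
  have h_p: "h n e (?p r) = r \<odot>\<^bsub>I n\<^esub> e" if e: "e \<in> ?A n" and r: "r \<in> carrier R" for n e r
  proof -
    interpret E: module R "I n" by (rule I.module)
    define s where "s = (SOME s. s \<in> carrier R \<and> ?p r = ?p s)"
    have s: "s \<in> carrier R \<and> ?p r = ?p s" unfolding s_def by (rule someI[of _ r]) (use r in simp)
    have ec: "e \<in> carrier (I n)" using e by (simp add: annihilated_def)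
    have "s \<ominus>\<^bsub>?R\<^esub> r \<in> \<aa>" using s r proj_eq_iff[OF mR sa, of s r] by simp
    then have "(s \<ominus>\<^bsub>?R\<^esub> r) \<odot>\<^bsub>I n\<^esub> e = \<zero>\<^bsub>I n\<^esub>" using e by (simp add: annihilated_def)
    then have "s \<odot>\<^bsub>I n\<^esub> e \<ominus>\<^bsub>I n\<^esub> r \<odot>\<^bsub>I n\<^esub> e = \<zero>\<^bsub>I n\<^esub>"
      using homs_minus[OF mult_hom[OF I.module ec] mR I.module, of s r] s r by simp
    then have "s \<odot>\<^bsub>I n\<^esub> e = r \<odot>\<^bsub>I n\<^esub> e" using homs_eq_iff_diff[OF I.module, of "s \<odot>\<^bsub>I n\<^esub> e" n] s r ec by simp
    moreover have "h n e (?p r) = s \<odot>\<^bsub>I n\<^esub> e" unfolding h_def s_def using r cQ by simp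
    ultimately show ?thesis by simp
  qed
  have h_ext: "h n e \<in> extensional (carrier ?Q)" for n e unfolding h_def by simp
  have h_u: "h n e u = e" if e: "e \<in> ?A n" for n e
  proof -
    interpret E: module R "I n" by (rule I.module)
    show ?thesis unfolding u_def using h_p[OF e] e by (simp add: annihilated_def)
  qed
  have h_eqI: "f = h n e" if "f \<in> extensional (carrier ?Q)" "e \<in> ?A n" "\<And>r. r \<in> carrier R \<Longrightarrow> f (?p r) = r \<odot>\<^bsub>I n\<^esub> e"
    for f n e
    by (rule extensionalityI[OF that(1) h_ext]) (use cQ that h_p[OF that(2)] in auto)
  have pr: "?p r = r \<odot>\<^bsub>?Q\<^esub> u" if "r \<in> carrier R" for r
    using homs_smult[OF p that, of "\<one>\<^bsub>R\<^esub>"] that by (simp add: u_def)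
  have ann_u: "r \<odot>\<^bsub>?Q\<^esub> u = \<zero>\<^bsub>?Q\<^esub>" if "r \<in> \<aa>" for r
    using pr[of r] that \<aa> proj_zero_iff[OF mR sa, of r] by (auto simp: residue_module_def)
  have h_hom: "h n e \<in> module_homs R ?Q (I n)" if e: "e \<in> ?A n" for n e
  proof -
    interpret E: module R "I n" by (rule I.module)
    have ec: "e \<in> carrier (I n)" using e by (simp add: annihilated_def)
    show ?thesis
    proof (rule module_homsI)
      fix x y assume "x \<in> carrier ?Q" "y \<in> carrier ?Q"
      then obtain r s where rs: "x = ?p r" "y = ?p s" "r \<in> carrier R" "s \<in> carrier R" unfolding cQ by auto
      have "x \<oplus>\<^bsub>?Q\<^esub> y = ?p (r \<oplus>\<^bsub>R\<^esub> s)" using rs homs_add[OF p, of r s] by simp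
      then show "h n e (x \<oplus>\<^bsub>?Q\<^esub> y) = h n e x \<oplus>\<^bsub>I n\<^esub> h n e y"
        using rs h_p[OF e] ec by (simp add: E.smult_l_distr)
    next
      fix x assume "x \<in> carrier ?Q"
      then obtain r where rs: "x = ?p r" "r \<in> carrier R" unfolding cQ by auto
      show "h n e x \<in> carrier (I n)" using rs h_p[OF e] ec by simp
      fix s assume s: "s \<in> carrier R"
      have "s \<odot>\<^bsub>?Q\<^esub> x = ?p (s \<otimes>\<^bsub>R\<^esub> r)" using rs s homs_smult[OF p, of s r] by simp
      then show "h n e (s \<odot>\<^bsub>?Q\<^esub> x) = s \<odot>\<^bsub>I n\<^esub> h n e x"
        using rs s h_p[OF e] ec by (simp add: E.smult_assoc1)
    qed
  qed
  let ?H = "\<lambda>n. Hom_module R ?Q (I n)" and ?D = "\<lambda>n. compose (carrier ?Q) (d n)"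
  have cH: "carrier (?H n) = h n ` ?A n" for n
  proof
    show "h n ` ?A n \<subseteq> carrier (?H n)" using h_hom h_ext by (auto simp: Hom_module_def)
    show "carrier (?H n) \<subseteq> h n ` ?A n"
    proof
      fix f assume "f \<in> carrier (?H n)"
      then have f: "f \<in> module_homs R ?Q (I n)" "f \<in> extensional (carrier ?Q)" by (auto simp: Hom_module_def)
      \<comment> \<open>Evaluation at \<open>u\<close>, the coset of one, inverts
        \<open>h n\<close>. Its values are annihilated because \<aa> kills \<open>u\<close>.\<close>
      have fu: "f u \<in> ?A n"
        using homs_closed[OF f(1) uQ] homs_smult[OF f(1) _ uQ] ann_u \<aa> homs_zero[OF f(1) mQ I.module]
        by (auto simp: annihilated_def) (metis subsetD)
      have "f = h n (f u)" by (rule h_eqI[OF f(2) fu]) (simp add: pr homs_smult[OF f(1) _ uQ])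
      then show "f \<in> h n ` ?A n" using fu by blast
    qed
  qed
  have h_add: "h n x \<oplus>\<^bsub>?H n\<^esub> h n y = h n (x \<oplus>\<^bsub>I n\<^esub> y)" if xy: "x \<in> ?A n" "y \<in> ?A n" for n x y
  proof (rule h_eqI)
    interpret E: module R "I n" by (rule I.module)
    show "h n x \<oplus>\<^bsub>?H n\<^esub> h n y \<in> extensional (carrier ?Q)" by (simp add: Hom_module_def)
    show "x \<oplus>\<^bsub>I n\<^esub> y \<in> ?A n" using submoduleD(3)[OF annihilated_submodule[OF I.module \<aa>] xy] .
    fix r assume "r \<in> carrier R"
    then show "(h n x \<oplus>\<^bsub>?H n\<^esub> h n y) (?p r) = r \<odot>\<^bsub>I n\<^esub> (x \<oplus>\<^bsub>I n\<^esub> y)"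
      using h_p[OF xy(1)] h_p[OF xy(2)] cQ xy by (simp add: Hom_module_def E.smult_r_distr annihilated_def)
  qed
  have h_smult: "r \<odot>\<^bsub>?H n\<^esub> h n x = h n (r \<odot>\<^bsub>I n\<^esub> x)" if r: "r \<in> carrier R" and x: "x \<in> ?A n" for n r x
  proof (rule h_eqI)
    interpret E: module R "I n" by (rule I.module)
    show "r \<odot>\<^bsub>?H n\<^esub> h n x \<in> extensional (carrier ?Q)" by (simp add: Hom_module_def)
    show "r \<odot>\<^bsub>I n\<^esub> x \<in> ?A n" using submoduleD(4)[OF annihilated_submodule[OF I.module \<aa>] r x] .
    fix s assume "s \<in> carrier R"
    then show "(r \<odot>\<^bsub>?H n\<^esub> h n x) (?p s) = s \<odot>\<^bsub>I n\<^esub> (r \<odot>\<^bsub>I n\<^esub> x)"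
      using h_p[OF x] cQ x r by (simp add: Hom_module_def annihilated_def E.smult_assoc1[symmetric] N.R.m_comm)
  qed
  have zA: "\<zero>\<^bsub>I n\<^esub> \<in> ?A n" for n using submoduleD(2)[OF annihilated_submodule[OF I.module \<aa>]] .
  have h_zero: "\<zero>\<^bsub>?H n\<^esub> = h n \<zero>\<^bsub>I n\<^esub>" for n
  proof (rule h_eqI[OF _ zA])
    interpret E: module R "I n" by (rule I.module)
    show "\<zero>\<^bsub>?H n\<^esub> \<in> extensional (carrier ?Q)" by (simp add: Hom_module_def)
    fix r assume "r \<in> carrier R"
    then show "\<zero>\<^bsub>?H n\<^esub> (?p r) = r \<odot>\<^bsub>I n\<^esub> \<zero>\<^bsub>I n\<^esub>" using cQ by (simp add: Hom_module_def)
  qed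
  have dA: "d n x \<in> ?A (Suc n)" if "x \<in> ?A n" for n x
    by (rule annihilated_hom[OF I.module I.module I.d_hom \<aa> that])
  have h_d: "?D n (h n x) = h (Suc n) (d n x)" if x: "x \<in> ?A n" for n x
  proof (rule h_eqI[OF _ dA[OF x]])
    show "?D n (h n x) \<in> extensional (carrier ?Q)" by (simp add: compose_def)
    fix r assume r: "r \<in> carrier R"
    then have "?D n (h n x) (?p r) = d n (h n x (?p r))" using cQ by (simp add: compose_def)
    then show "?D n (h n x) (?p r) = r \<odot>\<^bsub>I (Suc n)\<^esub> d n x"
      using h_p[OF x r] homs_smult[OF I.d_hom r, of x n] x by (simp add: annihilated_def)
  qed
  have h_inj: "x = y" if "h n x = h n y" "x \<in> ?A n" "y \<in> ?A n" for n x y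
    using h_u that by metis
  let ?Z = "ann_cocycles \<aa> I d i" and ?B = "ann_coboundaries \<aa> I d i"
  have Z_A: "x \<in> ?A i" if "x \<in> ?Z" for x using that by (simp add: ann_cocycles_def)
  have B_A: "x \<in> ?A i" if "x \<in> ?B" for x using that I.coboundaries_subset[OF \<aa>] Z_A by blast
  have ker: "a_kernel (?H i) (?H (Suc i)) (?D i) = h i ` ?Z"
  proof -
    have "?D i (h i x) = \<zero>\<^bsub>?H (Suc i)\<^esub> \<longleftrightarrow> x \<in> ?Z" if "x \<in> ?A i" for x
      using h_d[OF that] h_zero[of "Suc i"] h_inj[of "Suc i" "d i x" "\<zero>\<^bsub>I (Suc i)\<^esub>"] dA[OF that] zA that
      by (auto simp: ann_cocycles_def)
    then show ?thesis unfolding a_kernel_def' cH using Z_A by auto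
  qed
  have bdr: "(case i of 0 \<Rightarrow> {\<zero>\<^bsub>?H 0\<^esub>} | Suc j \<Rightarrow> ?D j ` carrier (?H j)) = h i ` ?B"
  proof (cases i)
    case 0 then show ?thesis by (simp add: h_zero ann_coboundaries_def)
  next
    case (Suc j)
    then show ?thesis using h_d[of _ j] by (auto simp: cH ann_coboundaries_def image_image)
  qed
  let ?M = "(I i)\<lparr>carrier := ?Z\<rparr>" and ?N = "(?H i)\<lparr>carrier := h i ` ?Z\<rparr>"
  have Ext: "Ext R i ?Q N = quotient_module ?N (h i ` ?B)"
    unfolding Ext_def Id cohomology_def by (simp add: ker bdr)
  have mM: "module R ?M" by (rule restrict_module[OF I.cocycles_submodule[OF \<aa>] I.module])
  have B: "submodule ?B R ?M"
    by (rule submodule_restrict[OF I.module I.cocycles_submodule[OF \<aa>] I.coboundaries_submodule[OF \<aa>]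
          I.coboundaries_subset[OF \<aa>]])
  have mN: "module R ?N"
    by (rule module_image[OF mM, of ?N "h i"]) (simp_all add: h_add h_smult h_zero Z_A)
  have hM: "h i \<in> module_homs R ?M ?N"
    by (rule module_homsI) (simp_all add: h_add h_smult Z_A)
  have BN: "submodule (h i ` ?B) R ?N" by (rule submodule_image[OF mM mN hM B])
  show "module R (Ext R i ?Q N)" unfolding Ext by (rule module_quotient[OF mN BN])
  show "module_iso R (ann_cohomology \<aa> I d i) (Ext R i ?Q N)"
    unfolding Ext ann_cohomology_def
  proof (rule quotient_iso[OF mM mN B BN hM])
    fix x assume "x \<in> carrier ?M"
    then have x: "x \<in> ?A i" using Z_A by simp
    then show "h i x \<in> h i ` ?B \<longleftrightarrow> x \<in> ?B" using h_inj[of i x] B_A by blast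
  next
    fix y assume y: "y \<in> carrier ?N"
    then obtain x where x: "x \<in> ?Z" "y = h i x" by auto
    then have "y \<ominus>\<^bsub>?N\<^esub> h i x = \<zero>\<^bsub>?N\<^esub>" using homs_eq_iff_diff[OF mN, of y y] y by simp
    then have "y \<ominus>\<^bsub>?N\<^esub> h i x \<in> h i ` ?B" using submoduleD(2)[OF BN] by simp
    then show "\<exists>x\<in>carrier ?M. y \<ominus>\<^bsub>?N\<^esub> h i x \<in> h i ` ?B" using x(1) by (intro bexI[of _ x]) simp_all
  qed
qed

section \<open>Enough injectives\<close>

text \<open>Apply Baer's criterion after \<open>g\<close> and carry the resulting element back with
  \<open>f\<close>. The retracts in question are isomorphic copies and direct summands.\<close>

lemma baer_retract:
  assumes E: "baer R E" and F: "module R F"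
    and f: "f \<in> module_homs R E F" and g: "g \<in> module_homs R F E"
    and fg: "\<And>x. x \<in> carrier F \<Longrightarrow> f (g x) = x"
  shows "baer R F"
  unfolding baer_def
proof (intro conjI allI impI F, elim conjE)
  fix J \<phi> assume J: "submodule J R (ring_as_module R)"
    and \<phi>: "\<phi> \<in> module_homs R ((ring_as_module R)\<lparr>carrier := J\<rparr>) F"
  obtain e where e: "e \<in> carrier E" "\<And>j. j \<in> J \<Longrightarrow> g (\<phi> j) = j \<odot>\<^bsub>E\<^esub> e"
    using baerD2[OF E J homs_comp[OF \<phi> g]] by blast
  have "\<phi> j = j \<odot>\<^bsub>F\<^esub> f e" if "j \<in> J" for j
    using fg[of "\<phi> j"] e(2)[OF that] homs_closed[OF \<phi>, of j] homs_smult[OF f _ e(1), of j] submoduleD(1)[OF J that] that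
    by simp
  then show "\<exists>e\<in>carrier F. \<forall>j\<in>J. \<phi> j = j \<odot>\<^bsub>F\<^esub> e" using homs_closed[OF f e(1)] by blast
qed

text \<open>Keeps only the additive group of \<open>G\<close>, so that facts about modules, used
  over the integers, serve for abelian groups.\<close>

definition int_module :: "('g, 'c) ring_scheme \<Rightarrow> (int, 'g) module"
  where "int_module G = \<lparr>carrier = carrier G, monoid.mult = (\<lambda>_ _. \<zero>\<^bsub>G\<^esub>), one = \<zero>\<^bsub>G\<^esub>,
    ring.zero = \<zero>\<^bsub>G\<^esub>, ring.add = ring.add G, smult = add_pow G\<rparr>"

lemma int_module_simps [simp]:
  "carrier (int_module G) = carrier G" "\<zero>\<^bsub>int_module G\<^esub> = \<zero>\<^bsub>G\<^esub>"
  "x \<oplus>\<^bsub>int_module G\<^esub> y = x \<oplus>\<^bsub>G\<^esub> y" "k \<odot>\<^bsub>int_module G\<^esub> x = add_pow G k x"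
  unfolding int_module_def by simp_all

lemma module_int_module:
  assumes "abelian_group G"
  shows "module \<Z> (int_module G)"
proof -
  interpret G: abelian_group G by fact
  show ?thesis
  proof (rule moduleI[OF int_is_cring])
    show "abelian_group (int_module G)"
    proof (rule abelian_groupI)
      fix x assume "x \<in> carrier (int_module G)"
      then have "\<ominus>\<^bsub>G\<^esub> x \<in> carrier (int_module G)" "\<ominus>\<^bsub>G\<^esub> x \<oplus>\<^bsub>int_module G\<^esub> x = \<zero>\<^bsub>int_module G\<^esub>"
        by (simp_all add: G.l_neg)
      then show "\<exists>y\<in>carrier (int_module G). y \<oplus>\<^bsub>int_module G\<^esub> x = \<zero>\<^bsub>int_module G\<^esub>" by blast
    qed (simp_all add: G.a_ac)
  qed (simp_all add: G.add.int_pow_mult G.add.int_pow_distrib G.add.int_pow_pow mult.commute)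
qed

lemma homs_int:
  assumes A: "module \<Z> A" and B: "module \<Z> B"
    and f: "\<And>x. x \<in> carrier A \<Longrightarrow> f x \<in> carrier B"
    and add: "\<And>x y. x \<in> carrier A \<Longrightarrow> y \<in> carrier A \<Longrightarrow> f (x \<oplus>\<^bsub>A\<^esub> y) = f x \<oplus>\<^bsub>B\<^esub> f y"
  shows "f \<in> module_homs \<Z> A B"
proof (rule module_homsI)
  interpret A: module \<Z> A by fact
  interpret B: module \<Z> B by fact
  fix k :: int and x assume x: "x \<in> carrier A"
  have one: "(k + 1) \<odot>\<^bsub>A\<^esub> x = k \<odot>\<^bsub>A\<^esub> x \<oplus>\<^bsub>A\<^esub> x" for k :: int
    using A.smult_l_distr[of k 1 x] A.smult_one[OF x] x by simp
  have one': "(k + 1) \<odot>\<^bsub>B\<^esub> f x = k \<odot>\<^bsub>B\<^esub> f x \<oplus>\<^bsub>B\<^esub> f x" for k :: int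
    using B.smult_l_distr[of k 1 "f x"] B.smult_one[OF f[OF x]] f[OF x] by simp
  have cl: "k \<odot>\<^bsub>A\<^esub> x \<in> carrier A" "k \<odot>\<^bsub>B\<^esub> f x \<in> carrier B" for k :: int
    using A.smult_closed[of k x] B.smult_closed[of k "f x"] x f[OF x] by simp_all
  \<comment> \<open>The equivalence serves both directions of the induction on \<open>k\<close>,
    upward and downward from 0.\<close>
  have step: "f ((k + 1) \<odot>\<^bsub>A\<^esub> x) = (k + 1) \<odot>\<^bsub>B\<^esub> f x \<longleftrightarrow> f (k \<odot>\<^bsub>A\<^esub> x) = k \<odot>\<^bsub>B\<^esub> f x" for k :: int
    using one one' add[OF cl(1) x] cl f x by simp
  show "f (k \<odot>\<^bsub>A\<^esub> x) = k \<odot>\<^bsub>B\<^esub> f x"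
  proof (induction k rule: int_induct[where k = 0])
    case base
    have "f \<zero>\<^bsub>A\<^esub> = f \<zero>\<^bsub>A\<^esub> \<oplus>\<^bsub>B\<^esub> f \<zero>\<^bsub>A\<^esub>" using add[of "\<zero>\<^bsub>A\<^esub>" "\<zero>\<^bsub>A\<^esub>"] by simp
    then have "f \<zero>\<^bsub>A\<^esub> = \<zero>\<^bsub>B\<^esub>" using f[of "\<zero>\<^bsub>A\<^esub>"] by simp
    then show ?case using A.smult_l_null[OF x] B.smult_l_null[OF f[OF x]] by simp
  next
    case (step1 i) then show ?case using step by blast
  next
    case (step2 i) then show ?case using step[of "i - 1"] by simp
  qed
qed (use f add in auto)

text \<open>A nonzero ideal of the integers consists of the multiples of its least positive element
  \<open>n\<close>. Dividing the value of \<open>\<phi>\<close> at \<open>n\<close> by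
  \<open>n\<close> in \<open>D\<close> gives the element required.\<close>

lemma baer_int:
  assumes D: "module \<Z> D"
    and div: "\<And>n y. n \<noteq> 0 \<Longrightarrow> y \<in> carrier D \<Longrightarrow> \<exists>x\<in>carrier D. n \<odot>\<^bsub>D\<^esub> x = y"
  shows "baer \<Z> D"
  unfolding baer_def
proof (intro conjI allI impI D, elim conjE)
  interpret D: module \<Z> D by fact
  fix J \<phi> assume J: "submodule J \<Z> (ring_as_module \<Z>)"
    and \<phi>: "\<phi> \<in> module_homs \<Z> ((ring_as_module \<Z>)\<lparr>carrier := J\<rparr>) D"
  note mZ = module_ring_as_module[OF int_is_cring]
  have Jmul: "k * j \<in> J" if "j \<in> J" for j k using submoduleD(4)[OF J, of k j] that by simp
  have Jadd: "i + j \<in> J" if "i \<in> J" "j \<in> J" for i j using submoduleD(3)[OF J that] by simp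
  show "\<exists>e\<in>carrier D. \<forall>j\<in>J. \<phi> j = j \<odot>\<^bsub>D\<^esub> e"
  proof (cases "J \<subseteq> {0}")
    case True
    have "\<phi> 0 = \<zero>\<^bsub>D\<^esub>" using homs_zero[OF \<phi> restrict_module[OF J mZ] D] by simp
    then show ?thesis using True D.smult_l_null[of "\<zero>\<^bsub>D\<^esub>"] by (intro bexI[of _ "\<zero>\<^bsub>D\<^esub>"]) auto
  next
    case False
    then obtain j0 where j0: "j0 \<in> J" "j0 \<noteq> 0" by auto
    then have "\<bar>j0\<bar> \<in> J" using Jmul[OF j0(1), of "sgn j0"] by (simp add: abs_sgn mult.commute)
    then have ex: "\<exists>n::nat. n > 0 \<and> int n \<in> J" using j0(2) by (intro exI[of _ "nat \<bar>j0\<bar>"]) auto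
    define n where "n = (LEAST n::nat. n > 0 \<and> int n \<in> J)"
    have n: "n > 0" "int n \<in> J" using LeastI_ex[OF ex] unfolding n_def by auto
    have dvd: "int n dvd j" if j: "j \<in> J" for j
    proof (rule ccontr)
      assume "\<not> int n dvd j"
      then have "j mod int n \<noteq> 0" by (simp add: dvd_eq_mod_eq_0)
      then have m: "j mod int n > 0" "j mod int n < int n"
        using n(1) pos_mod_sign[of "int n" j] pos_mod_bound[of "int n" j] by linarith+
      have "j mod int n = j + (- (j div int n)) * int n"
        using div_mult_mod_eq[of j "int n"] by linarith
      then have "j mod int n \<in> J" using Jadd[OF j Jmul[OF n(2)]] by metis
      then have "0 < nat (j mod int n) \<and> int (nat (j mod int n)) \<in> J" using m(1) by simp
      then have "n \<le> nat (j mod int n)"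
        using Least_le[of "\<lambda>n. n > 0 \<and> int n \<in> J"] unfolding n_def[symmetric] by blast
      then show False using m by linarith
    qed
    have \<phi>n: "\<phi> (int n) \<in> carrier D" using homs_closed[OF \<phi>, of "int n"] n(2) by simp
    obtain e where e: "e \<in> carrier D" "int n \<odot>\<^bsub>D\<^esub> e = \<phi> (int n)" using div[of "int n" "\<phi> (int n)"] n(1) \<phi>n by auto
    have "\<phi> j = j \<odot>\<^bsub>D\<^esub> e" if j: "j \<in> J" for j
    proof -
      obtain k where k: "j = k * int n" using dvd[OF j] by (metis dvdE mult.commute)
      have "\<phi> j = k \<odot>\<^bsub>D\<^esub> \<phi> (int n)" using homs_smult[OF \<phi>, of k "int n"] n(2) k by simp
      then show ?thesis using e D.smult_assoc1[of k "int n" e] k by simp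
    qed
    then show ?thesis using e(1) by blast
  qed
qed

text \<open>The divisible hull of \<open>G\<close> is constructed as the quotient of the finitely supported functions
  \<open>G \<rightarrow> \<rat>\<close> by the kernel of the summation map on the integer-valued ones.\<close>

definition finsupp_module :: "'g set \<Rightarrow> (int, 'g \<Rightarrow> rat) module"
  where "finsupp_module X = \<lparr>carrier = {f. finite {x. f x \<noteq> 0} \<and> {x. f x \<noteq> 0} \<subseteq> X},
    monoid.mult = (\<lambda>_ _ _. 0), one = (\<lambda>_. 0), ring.zero = (\<lambda>_. 0),
    ring.add = (\<lambda>f g x. f x + g x), smult = (\<lambda>k f x. of_int k * f x)\<rparr>"

lemma finsupp_simps [simp]:
  "f \<in> carrier (finsupp_module X) \<longleftrightarrow> finite {x. f x \<noteq> 0} \<and> {x. f x \<noteq> 0} \<subseteq> X"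
  "\<zero>\<^bsub>finsupp_module X\<^esub> = (\<lambda>_. 0)"
  "f \<oplus>\<^bsub>finsupp_module X\<^esub> g = (\<lambda>x. f x + g x)"
  "k \<odot>\<^bsub>finsupp_module X\<^esub> f = (\<lambda>x. of_int k * f x)"
  unfolding finsupp_module_def by simp_all

lemma module_finsupp: "module \<Z> (finsupp_module X)"
proof (rule moduleI[OF int_is_cring])
  show "abelian_group (finsupp_module X)"
  proof (rule abelian_groupI)
    fix f g :: "'a \<Rightarrow> rat" assume "f \<in> carrier (finsupp_module X)" "g \<in> carrier (finsupp_module X)"
    then have fg: "finite ({x. f x \<noteq> 0} \<union> {x. g x \<noteq> 0})" "{x. f x \<noteq> 0} \<union> {x. g x \<noteq> 0} \<subseteq> X" by auto
    have "{x. f x + g x \<noteq> 0} \<subseteq> {x. f x \<noteq> 0} \<union> {x. g x \<noteq> 0}" by auto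
    then show "f \<oplus>\<^bsub>finsupp_module X\<^esub> g \<in> carrier (finsupp_module X)"
      using fg finite_subset[of "{x. f x + g x \<noteq> 0}"] by auto
  next
    fix f :: "'a \<Rightarrow> rat" assume "f \<in> carrier (finsupp_module X)"
    then show "\<exists>g\<in>carrier (finsupp_module X). g \<oplus>\<^bsub>finsupp_module X\<^esub> f = \<zero>\<^bsub>finsupp_module X\<^esub>"
      by (intro bexI[of _ "\<lambda>x. - f x"]) auto
  qed (auto simp: add.assoc add.commute)
next
  fix k :: int and f :: "'a \<Rightarrow> rat" assume "f \<in> carrier (finsupp_module X)"
  then have f: "finite {x. f x \<noteq> 0}" "{x. f x \<noteq> 0} \<subseteq> X" by auto
  have "{x. of_int k * f x \<noteq> 0} \<subseteq> {x. f x \<noteq> 0}" by auto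
  then show "k \<odot>\<^bsub>finsupp_module X\<^esub> f \<in> carrier (finsupp_module X)"
    using f finite_subset[of "{x. of_int k * f x \<noteq> 0}" "{x. f x \<noteq> 0}"] by auto
qed (auto simp: algebra_simps)

text \<open>The last clause bounds the size of \<open>D\<close>; it is used to embed
  \<open>D\<close> into the type of the resolutions.\<close>

lemma divisible_hull:
  fixes G :: "(int, 'g, 'c) module_scheme"
  assumes G: "module \<Z> G"
  obtains D :: "(int, ('g \<Rightarrow> rat) set) module" and \<iota> p where "baer \<Z> D" "\<iota> \<in> module_homs \<Z> G D"
    "\<And>x. x \<in> carrier G \<Longrightarrow> \<iota> x = \<zero>\<^bsub>D\<^esub> \<Longrightarrow> x = \<zero>\<^bsub>G\<^esub>"
    "carrier D = p ` carrier (finsupp_module (carrier G))"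
proof -
  interpret G: module \<Z> G by fact
  let ?F = "finsupp_module (carrier G)"
  note mF = module_finsupp[of "carrier G"]
  define V where "V = {f \<in> carrier ?F. \<forall>x. f x \<in> \<int>}"
  have V: "submodule V \<Z> ?F"
    using module.smult_closed[OF mF] abelian_monoid.a_closed[OF abelian_group.axioms(1)[OF module.axioms(2)[OF mF]]]
    by (intro submoduleI'[OF mF]) (auto simp: V_def)
  have mV: "module \<Z> (?F\<lparr>carrier := V\<rparr>)" by (rule restrict_module[OF V mF])
  \<comment> \<open>On \<open>V\<close> the floor only reads off an integer-valued rational
    coefficient as an element of type \<open>int\<close>.\<close>
  define \<sigma> where "\<sigma> f = (\<Oplus>\<^bsub>G\<^esub>x\<in>{x. f x \<noteq> 0}. \<lfloor>f x\<rfloor> \<odot>\<^bsub>G\<^esub> x)" for f :: "'g \<Rightarrow> rat"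
  have smc: "k \<odot>\<^bsub>G\<^esub> x \<in> carrier G" if "x \<in> carrier G" for k :: int and x
    using G.smult_closed[of k x] that by simp
  have \<sigma>_eq: "\<sigma> f = (\<Oplus>\<^bsub>G\<^esub>x\<in>S. \<lfloor>f x\<rfloor> \<odot>\<^bsub>G\<^esub> x)"
    if "finite S" "{x. f x \<noteq> 0} \<subseteq> S" "S \<subseteq> carrier G" for f S
    unfolding \<sigma>_def
    by (rule G.M.add.finprod_mono_neutral_cong_left[OF that(1,2)])
      (use that smc G.smult_l_null in \<open>auto simp: subset_eq\<close>)
  have \<sigma>: "\<sigma> \<in> module_homs \<Z> (?F\<lparr>carrier := V\<rparr>) G"
  proof (rule homs_int[OF mV G])
    fix f assume "f \<in> carrier (?F\<lparr>carrier := V\<rparr>)"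
    then show "\<sigma> f \<in> carrier G" unfolding \<sigma>_def V_def by (intro G.M.finsum_closed) (auto intro!: smc)
  next
    fix f g assume fg: "f \<in> carrier (?F\<lparr>carrier := V\<rparr>)" "g \<in> carrier (?F\<lparr>carrier := V\<rparr>)"
    let ?S = "{x. f x \<noteq> 0} \<union> {x. g x \<noteq> 0}"
    have S: "finite ?S" "?S \<subseteq> carrier G" using fg by (auto simp: V_def)
    have "\<sigma> (\<lambda>x. f x + g x) = (\<Oplus>\<^bsub>G\<^esub>x\<in>?S. \<lfloor>f x + g x\<rfloor> \<odot>\<^bsub>G\<^esub> x)" by (rule \<sigma>_eq[OF S(1) _ S(2)]) auto
    also have "\<dots> = (\<Oplus>\<^bsub>G\<^esub>x\<in>?S. \<lfloor>f x\<rfloor> \<odot>\<^bsub>G\<^esub> x \<oplus>\<^bsub>G\<^esub> \<lfloor>g x\<rfloor> \<odot>\<^bsub>G\<^esub> x)"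
    proof (rule G.M.finsum_cong'[OF refl])
      fix x assume "x \<in> ?S"
      then have x: "x \<in> carrier G" using S(2) by blast
      have "f x \<in> \<int>" "g x \<in> \<int>" using fg by (auto simp: V_def)
      then have "\<lfloor>f x + g x\<rfloor> = \<lfloor>f x\<rfloor> + \<lfloor>g x\<rfloor>" by (auto elim!: Ints_cases)
      then show "\<lfloor>f x + g x\<rfloor> \<odot>\<^bsub>G\<^esub> x = \<lfloor>f x\<rfloor> \<odot>\<^bsub>G\<^esub> x \<oplus>\<^bsub>G\<^esub> \<lfloor>g x\<rfloor> \<odot>\<^bsub>G\<^esub> x"
        using G.smult_l_distr[of "\<lfloor>f x\<rfloor>" "\<lfloor>g x\<rfloor>" x] x by simp
    qed (use S smc in \<open>auto intro!: G.M.a_closed\<close>)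
    also have "\<dots> = (\<Oplus>\<^bsub>G\<^esub>x\<in>?S. \<lfloor>f x\<rfloor> \<odot>\<^bsub>G\<^esub> x) \<oplus>\<^bsub>G\<^esub> (\<Oplus>\<^bsub>G\<^esub>x\<in>?S. \<lfloor>g x\<rfloor> \<odot>\<^bsub>G\<^esub> x)"
      by (rule G.M.finsum_addf) (use S smc in auto)
    also have "\<dots> = \<sigma> f \<oplus>\<^bsub>G\<^esub> \<sigma> g" using \<sigma>_eq[OF S(1) _ S(2)] by simp
    finally show "\<sigma> (f \<oplus>\<^bsub>?F\<lparr>carrier := V\<rparr>\<^esub> g) = \<sigma> f \<oplus>\<^bsub>G\<^esub> \<sigma> g" by simp
  qed
  \<comment> \<open>The basis functions: each is a preimage of its index under
    \<open>\<sigma>\<close>, which shows that \<open>\<sigma>\<close> is onto.\<close>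
  define \<delta> where "\<delta> x = (\<lambda>y. if y = x then 1 else 0 :: rat)" for x :: 'g
  have \<delta>V: "\<delta> x \<in> V" and \<sigma>\<delta>: "\<sigma> (\<delta> x) = x" if x: "x \<in> carrier G" for x
  proof -
    have supp: "{y. \<delta> x y \<noteq> 0} = {x}" by (auto simp: \<delta>_def)
    then show "\<delta> x \<in> V" using x by (auto simp: V_def) (simp add: \<delta>_def)
    have "\<sigma> (\<delta> x) = \<lfloor>\<delta> x x\<rfloor> \<odot>\<^bsub>G\<^esub> x \<oplus>\<^bsub>G\<^esub> (\<Oplus>\<^bsub>G\<^esub>y\<in>{}. \<lfloor>\<delta> x y\<rfloor> \<odot>\<^bsub>G\<^esub> y)"
      unfolding \<sigma>_def supp using smc x by (subst G.M.finsum_insert) auto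
    then show "\<sigma> (\<delta> x) = x" using x smc G.smult_one[OF x] by (simp add: \<delta>_def)
  qed
  \<comment> \<open>The quotient of \<open>?F\<close> by \<open>K\<close> is divisible because
    \<open>?F\<close> is, and its integer-valued part is the copy of \<open>G\<close>.\<close>
  define K where "K = {f \<in> V. \<sigma> f = \<zero>\<^bsub>G\<^esub>}"
  have "submodule {f \<in> carrier (?F\<lparr>carrier := V\<rparr>). \<sigma> f \<in> {\<zero>\<^bsub>G\<^esub>}} \<Z> (?F\<lparr>carrier := V\<rparr>)"
    by (rule submodule_vimage[OF mV G \<sigma> submodule_zero_set[OF G]])
  then have K: "submodule K \<Z> ?F" using submodule_trans[OF mF V] by (simp add: K_def)
  define D where "D = quotient_module ?F K"
  let ?p = "\<lambda>f. K +>\<^bsub>?F\<^esub> f"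
  have mD: "module \<Z> D" unfolding D_def by (rule module_quotient[OF mF K])
  have p: "?p \<in> module_homs \<Z> ?F D" unfolding D_def by (rule proj_hom[OF mF K])
  have cD: "carrier D = ?p ` carrier ?F" unfolding D_def by (rule carrier_quotient[OF mF K])
  have VF: "V \<subseteq> carrier ?F" by (auto simp: V_def)
  have p0: "?p f = \<zero>\<^bsub>D\<^esub> \<longleftrightarrow> f \<in> K" if "f \<in> carrier ?F" for f
    unfolding D_def using proj_zero_iff[OF mF K that] .
  have surj: "\<sigma> ` carrier (?F\<lparr>carrier := V\<rparr>) = carrier G"
    using homs_closed[OF \<sigma>] \<delta>V \<sigma>\<delta> by (auto simp: image_iff) metis
  obtain \<iota> where \<iota>: "\<iota> \<in> module_homs \<Z> G D" "\<And>f. f \<in> V \<Longrightarrow> \<iota> (\<sigma> f) = ?p f"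
    using hom_factor[OF mV G mD \<sigma> surj homs_restrict[OF p VF]] p0 VF by (auto simp: K_def subset_eq)
  have "x = \<zero>\<^bsub>G\<^esub>" if x: "x \<in> carrier G" "\<iota> x = \<zero>\<^bsub>D\<^esub>" for x
    using \<iota>(2)[OF \<delta>V[OF x(1)]] \<sigma>\<delta>[OF x(1)] x(2) p0[of "\<delta> x"] VF \<delta>V[OF x(1)] unfolding K_def by auto
  moreover have "baer \<Z> D"
  proof (rule baer_int[OF mD])
    fix n :: int and y assume n: "n \<noteq> 0" and "y \<in> carrier D"
    then obtain f where f: "y = ?p f" "f \<in> carrier ?F" using cD by auto
    have "{x. f x / of_int n \<noteq> 0} = {x. f x \<noteq> 0}" using n by auto
    then have g: "(\<lambda>x. f x / of_int n) \<in> carrier ?F" using f(2) by simp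
    have "n \<odot>\<^bsub>D\<^esub> ?p (\<lambda>x. f x / of_int n) = y"
      using homs_smult[OF p _ g, of n] n f(1) by simp
    then show "\<exists>x\<in>carrier D. n \<odot>\<^bsub>D\<^esub> x = y" using homs_closed[OF p g] by blast
  qed
  ultimately show ?thesis using that \<iota>(1) cD by blast
qed

text \<open>The module of additive maps from \<open>R\<close> to \<open>D\<close>, coinduced from
  the integers; a scalar acts through the argument.\<close>

definition coinduced_module :: "('a, 'r) ring_scheme \<Rightarrow> (int, 'd, 'c) module_scheme \<Rightarrow> ('a, 'a \<Rightarrow> 'd) module"
  where "coinduced_module R D =
    \<lparr>carrier = module_homs \<Z> (int_module R) D \<inter> extensional (carrier R),
     monoid.mult = (\<lambda>_ _. \<lambda>x\<in>carrier R. \<zero>\<^bsub>D\<^esub>), one = (\<lambda>x\<in>carrier R. \<zero>\<^bsub>D\<^esub>),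
     ring.zero = (\<lambda>x\<in>carrier R. \<zero>\<^bsub>D\<^esub>),
     ring.add = (\<lambda>f g. \<lambda>x\<in>carrier R. f x \<oplus>\<^bsub>D\<^esub> g x),
     smult = (\<lambda>r f. \<lambda>x\<in>carrier R. f (x \<otimes>\<^bsub>R\<^esub> r))\<rparr>"

context
  fixes R :: "('a, 'r) ring_scheme" and D :: "(int, 'd, 'c) module_scheme"
  assumes R: "cring R" and D: "baer \<Z> D"
begin

interpretation R: cring R by (fact R)
interpretation D: module \<Z> D by (rule baerD1[OF D])

private abbreviation "E \<equiv> coinduced_module R D"

private lemma mR: "module \<Z> (int_module R)"
  by (rule module_int_module) (rule R.abelian_group_axioms)

private lemma coinducedI:
  assumes "\<And>x. x \<in> carrier R \<Longrightarrow> f x \<in> carrier D"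
    "\<And>x y. x \<in> carrier R \<Longrightarrow> y \<in> carrier R \<Longrightarrow> f (x \<oplus>\<^bsub>R\<^esub> y) = f x \<oplus>\<^bsub>D\<^esub> f y"
  shows "restrict f (carrier R) \<in> carrier E"
proof -
  have "restrict f (carrier R) \<in> module_homs \<Z> (int_module R) D"
    using assms by (intro homs_int[OF mR baerD1[OF D]]) auto
  then show ?thesis by (simp add: coinduced_module_def)
qed

private lemma coinducedD:
  assumes "f \<in> carrier E"
  shows "\<And>x. x \<in> carrier R \<Longrightarrow> f x \<in> carrier D"
    "\<And>x y. x \<in> carrier R \<Longrightarrow> y \<in> carrier R \<Longrightarrow> f (x \<oplus>\<^bsub>R\<^esub> y) = f x \<oplus>\<^bsub>D\<^esub> f y"
    "f \<in> extensional (carrier R)"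
  using assms homs_closed[of f \<Z> "int_module R" D] homs_add[of f \<Z> "int_module R" D]
  by (auto simp: coinduced_module_def)

private lemma coinduced_ops:
  "\<zero>\<^bsub>E\<^esub> = (\<lambda>x\<in>carrier R. \<zero>\<^bsub>D\<^esub>)" "f \<oplus>\<^bsub>E\<^esub> g = (\<lambda>x\<in>carrier R. f x \<oplus>\<^bsub>D\<^esub> g x)"
  "r \<odot>\<^bsub>E\<^esub> f = (\<lambda>x\<in>carrier R. f (x \<otimes>\<^bsub>R\<^esub> r))"
  by (simp_all add: coinduced_module_def)

private lemma coinduced_eqI:
  "f \<in> extensional (carrier R) \<Longrightarrow> g \<in> extensional (carrier R) \<Longrightarrow> (\<And>x. x \<in> carrier R \<Longrightarrow> f x = g x) \<Longrightarrow> f = g"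
  by (rule extensionalityI)

lemma module_coinduced: "module R (coinduced_module R D)"
proof (rule moduleI[OF R])
  show "abelian_group E"
  proof (rule abelian_groupI)
    fix f assume f: "f \<in> carrier E"
    note f' = coinducedD[OF f]
    show "\<zero>\<^bsub>E\<^esub> \<oplus>\<^bsub>E\<^esub> f = f" by (rule coinduced_eqI[OF _ f'(3)]) (auto simp: coinduced_ops f')
    have "(\<lambda>x\<in>carrier R. \<ominus>\<^bsub>D\<^esub> f x) \<in> carrier E"
      by (rule coinducedI) (auto simp: f' D.M.minus_add)
    moreover have "(\<lambda>x\<in>carrier R. \<ominus>\<^bsub>D\<^esub> f x) \<oplus>\<^bsub>E\<^esub> f = \<zero>\<^bsub>E\<^esub>"
      by (rule coinduced_eqI) (auto simp: coinduced_ops f' D.M.l_neg)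
    ultimately show "\<exists>g\<in>carrier E. g \<oplus>\<^bsub>E\<^esub> f = \<zero>\<^bsub>E\<^esub>" by blast
    fix g assume g: "g \<in> carrier E"
    note g' = coinducedD[OF g]
    show "f \<oplus>\<^bsub>E\<^esub> g \<in> carrier E" unfolding coinduced_ops
      by (rule coinducedI) (auto simp: f' g' D.M.a_ac)
    show "f \<oplus>\<^bsub>E\<^esub> g = g \<oplus>\<^bsub>E\<^esub> f"
      by (rule coinduced_eqI) (auto simp: coinduced_ops f' g' D.M.a_comm)
    fix h assume h: "h \<in> carrier E"
    note h' = coinducedD[OF h]
    show "f \<oplus>\<^bsub>E\<^esub> g \<oplus>\<^bsub>E\<^esub> h = f \<oplus>\<^bsub>E\<^esub> (g \<oplus>\<^bsub>E\<^esub> h)"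
      by (rule coinduced_eqI) (auto simp: coinduced_ops f' g' h' D.M.a_assoc)
  next
    show "\<zero>\<^bsub>E\<^esub> \<in> carrier E" unfolding coinduced_ops by (rule coinducedI) auto
  qed
next
  fix r f assume r: "r \<in> carrier R" and f: "f \<in> carrier E"
  note f' = coinducedD[OF f]
  show "r \<odot>\<^bsub>E\<^esub> f \<in> carrier E" unfolding coinduced_ops
    by (rule coinducedI) (auto simp: f' r R.l_distr)
  fix s assume s: "s \<in> carrier R"
  show "(r \<oplus>\<^bsub>R\<^esub> s) \<odot>\<^bsub>E\<^esub> f = r \<odot>\<^bsub>E\<^esub> f \<oplus>\<^bsub>E\<^esub> s \<odot>\<^bsub>E\<^esub> f"
    by (rule coinduced_eqI) (auto simp: coinduced_ops f' r s R.r_distr)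
  show "(r \<otimes>\<^bsub>R\<^esub> s) \<odot>\<^bsub>E\<^esub> f = r \<odot>\<^bsub>E\<^esub> (s \<odot>\<^bsub>E\<^esub> f)"
    by (rule coinduced_eqI) (auto simp: coinduced_ops f' r s R.m_assoc)
next
  fix f assume f: "f \<in> carrier E"
  show "\<one>\<^bsub>R\<^esub> \<odot>\<^bsub>E\<^esub> f = f"
    by (rule coinduced_eqI[OF _ coinducedD(3)[OF f]]) (auto simp: coinduced_ops)
next
  fix r f g assume r: "r \<in> carrier R" and f: "f \<in> carrier E" and g: "g \<in> carrier E"
  show "r \<odot>\<^bsub>E\<^esub> (f \<oplus>\<^bsub>E\<^esub> g) = r \<odot>\<^bsub>E\<^esub> f \<oplus>\<^bsub>E\<^esub> r \<odot>\<^bsub>E\<^esub> g"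
    by (rule coinduced_eqI) (auto simp: coinduced_ops r)
qed

text \<open>By adjunction a linear map \<open>\<phi>\<close> from \<open>J\<close> to the coinduced
  module amounts to the additive map that sends \<open>j\<close> to the value of
  \<open>\<phi> j\<close> at one. This map extends to \<open>R\<close> because \<open>D\<close> is
  injective over the integers, and the extension is the element \<open>e\<close>.\<close>

lemma baer_coinduced: "baer R (coinduced_module R D)"
  unfolding baer_def
proof (intro conjI allI impI module_coinduced, elim conjE)
  fix J \<phi> assume J: "submodule J R (ring_as_module R)"
    and \<phi>: "\<phi> \<in> module_homs R ((ring_as_module R)\<lparr>carrier := J\<rparr>) E"
  note J' = submoduleD[OF J, simplified]
  have \<phi>E: "\<phi> j \<in> carrier E" if "j \<in> J" for j using homs_closed[OF \<phi>] that by simp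
  \<comment> \<open>An integer multiple \<open>k x\<close> is the product of \<open>x\<close> with
    the ring element \<open>k 1\<close>, so ideals are closed under it.\<close>
  have JZ: "submodule J \<Z> (int_module R)"
  proof (rule submoduleI'[OF mR])
    fix k :: int and x assume x: "x \<in> J"
    have "add_pow R k \<one>\<^bsub>R\<^esub> \<otimes>\<^bsub>R\<^esub> x = add_pow R k x"
      using R.add_pow_ldistr_int[of "\<one>\<^bsub>R\<^esub>" x k] J'(1)[OF x] by simp
    then show "k \<odot>\<^bsub>int_module R\<^esub> x \<in> J" using J'(4)[of "add_pow R k \<one>\<^bsub>R\<^esub>" x] x by simp
  qed (use J' in auto)
  have "(\<lambda>j. \<phi> j \<one>\<^bsub>R\<^esub>) \<in> module_homs \<Z> ((int_module R)\<lparr>carrier := J\<rparr>) D"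
    by (rule homs_int[OF restrict_module[OF JZ mR] baerD1[OF D]])
      (use coinducedD(1)[OF \<phi>E] homs_add[OF \<phi>] in \<open>auto simp: coinduced_ops\<close>)
  then obtain \<Theta> where \<Theta>: "\<Theta> \<in> module_homs \<Z> (int_module R) D" "\<And>j. j \<in> J \<Longrightarrow> \<Theta> j = \<phi> j \<one>\<^bsub>R\<^esub>"
    using baer_extend[OF D mR JZ] by blast
  define e where "e = restrict \<Theta> (carrier R)"
  have e: "e \<in> carrier E" unfolding e_def
    by (rule coinducedI) (use homs_closed[OF \<Theta>(1)] homs_add[OF \<Theta>(1)] in auto)
  have "\<phi> j = j \<odot>\<^bsub>E\<^esub> e" if j: "j \<in> J" for j
  proof (rule coinduced_eqI[OF coinducedD(3)[OF \<phi>E[OF j]]])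
    show "j \<odot>\<^bsub>E\<^esub> e \<in> extensional (carrier R)" by (simp add: coinduced_ops)
    fix x assume x: "x \<in> carrier R"
    \<comment> \<open>Linearity moves the argument \<open>x\<close> into \<open>\<phi>\<close>, so
      that values at one determine \<open>\<phi> j\<close>.\<close>
    have "\<phi> j x = (x \<odot>\<^bsub>E\<^esub> \<phi> j) \<one>\<^bsub>R\<^esub>" using x by (simp add: coinduced_ops)
    also have "\<dots> = \<phi> (x \<otimes>\<^bsub>R\<^esub> j) \<one>\<^bsub>R\<^esub>" using homs_smult[OF \<phi> x, of j] j by simp
    also have "\<dots> = \<Theta> (x \<otimes>\<^bsub>R\<^esub> j)" using \<Theta>(2) J'(4)[OF x j] by simp
    also have "\<dots> = (j \<odot>\<^bsub>E\<^esub> e) x" using x J'(1)[OF j] by (simp add: coinduced_ops e_def)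
    finally show "\<phi> j x = (j \<odot>\<^bsub>E\<^esub> e) x" .
  qed
  then show "\<exists>e\<in>carrier E. \<forall>j\<in>J. \<phi> j = j \<odot>\<^bsub>E\<^esub> e" using e by blast
qed

text \<open>The map is the adjoint of \<open>\<iota>\<close>. Evaluation at one returns
  \<open>\<iota> q\<close>, which gives injectivity.\<close>

lemma coinduced_embedding:
  assumes Q: "module R Q" and \<iota>: "\<iota> \<in> module_homs \<Z> (int_module Q) D"
    and inj: "\<And>x. x \<in> carrier Q \<Longrightarrow> \<iota> x = \<zero>\<^bsub>D\<^esub> \<Longrightarrow> x = \<zero>\<^bsub>Q\<^esub>"
  shows "(\<lambda>q. \<lambda>r\<in>carrier R. \<iota> (r \<odot>\<^bsub>Q\<^esub> q)) \<in> module_homs R Q (coinduced_module R D)"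
    and "q \<in> carrier Q \<Longrightarrow> (\<lambda>r\<in>carrier R. \<iota> (r \<odot>\<^bsub>Q\<^esub> q)) = \<zero>\<^bsub>coinduced_module R D\<^esub> \<Longrightarrow> q = \<zero>\<^bsub>Q\<^esub>"
proof -
  interpret Q: module R Q by fact
  have c: "\<iota> x \<in> carrier D" if "x \<in> carrier Q" for x using homs_closed[OF \<iota>] that by simp
  have a: "\<iota> (x \<oplus>\<^bsub>Q\<^esub> y) = \<iota> x \<oplus>\<^bsub>D\<^esub> \<iota> y" if "x \<in> carrier Q" "y \<in> carrier Q" for x y
    using homs_add[OF \<iota>] that by simp
  show "(\<lambda>q. \<lambda>r\<in>carrier R. \<iota> (r \<odot>\<^bsub>Q\<^esub> q)) \<in> module_homs R Q E"
  proof (rule module_homsI)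
    fix x assume x: "x \<in> carrier Q"
    show "(\<lambda>r\<in>carrier R. \<iota> (r \<odot>\<^bsub>Q\<^esub> x)) \<in> carrier E"
      by (rule coinducedI) (use x in \<open>auto simp: c a Q.smult_l_distr\<close>)
    fix y assume y: "y \<in> carrier Q"
    show "(\<lambda>r\<in>carrier R. \<iota> (r \<odot>\<^bsub>Q\<^esub> (x \<oplus>\<^bsub>Q\<^esub> y))) =
        (\<lambda>r\<in>carrier R. \<iota> (r \<odot>\<^bsub>Q\<^esub> x)) \<oplus>\<^bsub>E\<^esub> (\<lambda>r\<in>carrier R. \<iota> (r \<odot>\<^bsub>Q\<^esub> y))"
      by (rule coinduced_eqI) (use x y in \<open>auto simp: coinduced_ops a Q.smult_r_distr\<close>)
  next
    fix s x assume s: "s \<in> carrier R" and x: "x \<in> carrier Q"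
    show "(\<lambda>r\<in>carrier R. \<iota> (r \<odot>\<^bsub>Q\<^esub> (s \<odot>\<^bsub>Q\<^esub> x))) = s \<odot>\<^bsub>E\<^esub> (\<lambda>r\<in>carrier R. \<iota> (r \<odot>\<^bsub>Q\<^esub> x))"
      by (rule coinduced_eqI) (use s x in \<open>auto simp: coinduced_ops Q.smult_assoc1\<close>)
  qed
  assume q: "q \<in> carrier Q" and "(\<lambda>r\<in>carrier R. \<iota> (r \<odot>\<^bsub>Q\<^esub> q)) = \<zero>\<^bsub>E\<^esub>"
  then have "(\<lambda>r\<in>carrier R. \<iota> (r \<odot>\<^bsub>Q\<^esub> q)) \<one>\<^bsub>R\<^esub> = \<zero>\<^bsub>E\<^esub> \<one>\<^bsub>R\<^esub>" by simp
  then have "\<iota> q = \<zero>\<^bsub>D\<^esub>" using q by (simp add: coinduced_ops)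
  then show "q = \<zero>\<^bsub>Q\<^esub>" using inj q by blast
qed

end

subsection \<open>Cardinality\<close>

text \<open>The set of lists is infinite, so its square injects into it. The number \<open>n\<close>
  is stored as the length of a constant list.\<close>

lemma inj_nat_list:
  obtains g :: "nat \<times> 'a list \<Rightarrow> 'a list" where "inj g"
proof -
  have "infinite (UNIV :: 'a list set)" by (rule infinite_UNIV_listI)
  then obtain f :: "'a list \<times> 'a list \<Rightarrow> 'a list" where "bij_betw f (UNIV \<times> UNIV) UNIV"
    using card_of_Times_same_infinite[of "UNIV :: 'a list set"] unfolding card_of_ordIso[symmetric] by blast
  then have f: "inj f" by (simp add: bij_betw_def)
  have "inj (\<lambda>(n, l). f (replicate n undefined, l))"
  proof (rule injI, clarify)
    fix m n and k l :: "'a list"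
    assume "f (replicate m undefined, k) = f (replicate n undefined, l)"
    then have "(replicate m (undefined :: 'a), k) = (replicate n undefined, l)" by (rule injD[OF f])
    then show "m = n \<and> k = l" by simp
  qed
  then show ?thesis using that by blast
qed

text \<open>The entry \<open>s n l\<close> is stored at position \<open>g (n, l)\<close>, so a
  sequence of functions fits into one function.\<close>

lemma inj_sequences:
  obtains c :: "(nat \<Rightarrow> 'a list \<Rightarrow> 'm option) \<Rightarrow> 'a list \<Rightarrow> 'm option" where "inj c"
proof -
  obtain g :: "nat \<times> 'a list \<Rightarrow> 'a list" where g: "inj g" by (rule inj_nat_list)
  define c where "c s l = (case inv_into UNIV g l of (n, l') \<Rightarrow> s n l')" for s :: "nat \<Rightarrow> 'a list \<Rightarrow> 'm option" and l
  have c: "c s (g (n, l)) = s n l" for s n l unfolding c_def using g by simp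
  have "inj c"
  proof (rule injI)
    fix s t assume "c s = c t"
    then have "s n l = t n l" for n l using c[of s n l] c[of t n l] by simp
    then show "s = t" by blast
  qed
  then show ?thesis using that by blast
qed

lemma inj_finsupp:
  obtains c :: "(('a list \<Rightarrow> 'm option) \<Rightarrow> rat) \<Rightarrow> 'a list \<Rightarrow> 'm option"
    where "inj_on c {f. finite {x. f x \<noteq> 0}}"
proof -
  obtain s :: "(nat \<Rightarrow> 'a list \<Rightarrow> 'm option) \<Rightarrow> 'a list \<Rightarrow> 'm option" where s: "inj s" by (rule inj_sequences)
  \<comment> \<open>Codes \<open>n\<close> by the function whose only value other than
    \<open>None\<close> sits at the constant list of length \<open>n\<close>.\<close>
  define \<nu> :: "nat \<Rightarrow> 'a list \<Rightarrow> 'm option" where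
    "\<nu> n l = (if l = replicate n undefined then Some undefined else None)" for n l
  have \<nu>: "inj \<nu>"
  proof (rule injI)
    fix m n assume "\<nu> m = \<nu> n"
    then have "\<nu> n (replicate m undefined) = \<nu> m (replicate m undefined)" by simp
    then show "m = n" by (simp add: \<nu>_def split: if_splits)
  qed
  \<comment> \<open>Lays out a list of pairs as a sequence: entry 0 codes the length, entry
    \<open>2 * i + 1\<close> is the first component of pair \<open>i\<close>, and entry
    \<open>2 * i + 2\<close> codes the second.\<close>
  define e where "e xs n = (if n = 0 then \<nu> (length xs) else if odd n then fst (xs ! (n div 2))
    else \<nu> (to_nat (snd (xs ! (n div 2 - 1)))))" for xs :: "(('a list \<Rightarrow> 'm option) \<times> rat) list" and n
  have e: "inj e"
  proof (rule injI)
    fix xs ys assume eq: "e xs = e ys"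
    have len: "length xs = length ys" using fun_cong[OF eq, of 0] \<nu> by (simp add: e_def inj_eq)
    show "xs = ys"
    proof (rule nth_equalityI[OF len])
      fix i
      have "fst (xs ! i) = fst (ys ! i)" using fun_cong[OF eq, of "2 * i + 1"] by (simp add: e_def)
      moreover have "snd (xs ! i) = snd (ys ! i)"
        using fun_cong[OF eq, of "2 * i + 2"] \<nu> by (simp add: e_def inj_eq)
      ultimately show "xs ! i = ys ! i" by (rule prod_eqI)
    qed
  qed
  \<comment> \<open>A finitely supported function is determined by its graph over the support,
    listed in some order.\<close>
  define l where "l f = (SOME xs. set xs = (\<lambda>x. (x, f x)) ` {x. f x \<noteq> 0})"
    for f :: "('a list \<Rightarrow> 'm option) \<Rightarrow> rat"
  have l: "set (l f) = (\<lambda>x. (x, f x)) ` {x. f x \<noteq> 0}" if "finite {x. f x \<noteq> 0}" for f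
    unfolding l_def by (rule someI_ex) (use that in \<open>auto intro: finite_list\<close>)
  have "inj_on l {f. finite {x. f x \<noteq> 0}}"
  proof (rule inj_onI)
    fix f g :: "('a list \<Rightarrow> 'm option) \<Rightarrow> rat"
    assume "f \<in> {f. finite {x. f x \<noteq> 0}}" "g \<in> {f. finite {x. f x \<noteq> 0}}" "l f = l g"
    then have "(\<lambda>x. (x, f x)) ` {x. f x \<noteq> 0} = (\<lambda>x. (x, g x)) ` {x. g x \<noteq> 0}" using l[of f] l[of g] by simp
    then have *: "f x \<noteq> 0 \<and> f x = y \<longleftrightarrow> g x \<noteq> 0 \<and> g x = y" for x y by (auto simp: set_eq_iff image_iff)
    show "f = g"
    proof
      fix x show "f x = g x" using *[of x "f x"] *[of x "g x"] by auto
    qed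
  qed
  then have "inj_on (\<lambda>f. s (e (l f))) {f. finite {x. f x \<noteq> 0}}"
    using s e by (simp add: inj_on_def inj_def)
  then show ?thesis using that by blast
qed

text \<open>The injection \<open>k\<close> says that \<open>Q\<close> is small enough for the target
  type. Its additive group embeds into a divisible group \<open>D\<close>, hence \<open>Q\<close>
  embeds into the module coinduced from \<open>D\<close>, and the latter can be copied into the
  target type.\<close>

lemma enough_injectives:
  fixes R :: "('a, 'r) ring_scheme" and Q :: "('a, 'q, 'c) module_scheme" and k :: "'q \<Rightarrow> 'a list \<Rightarrow> 'm option"
  assumes Q: "module R Q" and k: "inj_on k (carrier Q)"
  obtains E :: "('a, 'a list \<Rightarrow> 'm option) module" and i where "baer R E" "i \<in> module_homs R Q E"
    "\<And>x. x \<in> carrier Q \<Longrightarrow> i x = \<zero>\<^bsub>E\<^esub> \<Longrightarrow> x = \<zero>\<^bsub>Q\<^esub>"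
proof -
  \<comment> \<open>The copy of \<open>Q\<close> has its carrier in the target type, which makes the
    coding of finitely supported functions by \<open>inj_finsupp\<close> applicable to its divisible
    hull.\<close>
  define G where "G = transport_module k Q"
  have G: "module R G" unfolding G_def by (rule module_transport[OF Q k])
  have kG: "k \<in> module_homs R Q G" unfolding G_def by (rule transport_hom[OF Q k])
  interpret Q: module R Q by (fact Q)
  interpret G: module R G by (fact G)
  have GZ: "module \<Z> (int_module G)" by (rule module_int_module) (rule G.M.abelian_group_axioms)
  obtain D :: "(int, (('a list \<Rightarrow> 'm option) \<Rightarrow> rat) set) module" and \<iota> p
    where D: "baer \<Z> D" "\<iota> \<in> module_homs \<Z> (int_module G) D"
    "\<And>x. x \<in> carrier (int_module G) \<Longrightarrow> \<iota> x = \<zero>\<^bsub>D\<^esub> \<Longrightarrow> x = \<zero>\<^bsub>int_module G\<^esub>"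
    and cD: "carrier D = p ` carrier (finsupp_module (carrier (int_module G)))"
    by (rule divisible_hull[OF GZ]) blast
  define E where "E = coinduced_module R D"
  have E: "baer R E" unfolding E_def by (rule baer_coinduced[OF Q.is_cring D(1)])
  obtain i where i: "i \<in> module_homs R G E" "\<And>x. x \<in> carrier G \<Longrightarrow> i x = \<zero>\<^bsub>E\<^esub> \<Longrightarrow> x = \<zero>\<^bsub>G\<^esub>"
    unfolding E_def using coinduced_embedding[OF Q.is_cring D(1) G D(2) D(3)[simplified]] by blast
  obtain c :: "(('a list \<Rightarrow> 'm option) \<Rightarrow> rat) \<Rightarrow> 'a list \<Rightarrow> 'm option"
    where c: "inj_on c {f. finite {x. f x \<noteq> 0}}" by (rule inj_finsupp)
  \<comment> \<open>Distinct elements of \<open>D\<close> have distinct chosen preimages under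
    \<open>p\<close>, and these are coded by \<open>c\<close>.\<close>
  define j where "j y = c (inv_into (carrier (finsupp_module (carrier (int_module G)))) p y)" for y
  have j: "x = y" if "j x = j y" "x \<in> carrier D" "y \<in> carrier D" for x y
  proof -
    let ?F = "carrier (finsupp_module (carrier (int_module G)))"
    have "inv_into ?F p x \<in> ?F" "inv_into ?F p y \<in> ?F"
      using that(2,3) unfolding cD by (blast intro: inv_into_into)+
    then have "inv_into ?F p x = inv_into ?F p y"
      using inj_onD[OF c, OF that(1)[unfolded j_def]] by simp
    then show ?thesis using f_inv_into_f[of x p ?F] f_inv_into_f[of y p ?F] that(2,3) unfolding cD by metis
  qed
  \<comment> \<open>Codes a function \<open>f\<close> with values in \<open>D\<close> by one
    function on lists: the head is the argument of \<open>f\<close>, the tail is the argument of the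
    code of its value.\<close>
  define t where "t f = (\<lambda>l. case l of [] \<Rightarrow> None | a # l' \<Rightarrow> j (f a) l')" for f :: "'a \<Rightarrow> (('a list \<Rightarrow> 'm option) \<Rightarrow> rat) set"
  have t: "inj_on t (carrier E)"
  proof (rule inj_onI)
    fix f g assume fg: "f \<in> carrier E" "g \<in> carrier E" "t f = t g"
    have ext: "f \<in> extensional (carrier R)" "g \<in> extensional (carrier R)"
      using fg(1,2) by (auto simp: E_def coinduced_module_def)
    have c: "f x \<in> carrier D" "g x \<in> carrier D" if "x \<in> carrier R" for x
      using fg(1,2) that homs_closed[of _ \<Z> "int_module R" D] by (auto simp: E_def coinduced_module_def)
    show "f = g"
    proof (rule extensionalityI[OF ext])
      fix x assume x: "x \<in> carrier R"
      have "j (f x) l = j (g x) l" for l using fun_cong[OF fg(3), of "x # l"] by (simp add: t_def)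
      then show "f x = g x" using j[of "f x" "g x"] c[OF x] by blast
    qed
  qed
  define F where "F = transport_module t E"
  have F: "module R F" unfolding F_def by (rule module_transport[OF baerD1[OF E] t])
  have tF: "t \<in> module_homs R E F" unfolding F_def by (rule transport_hom[OF baerD1[OF E] t])
  have "baer R F"
  proof (rule baer_retract[OF E F tF])
    show "inv_into (carrier E) t \<in> module_homs R F E" unfolding F_def by (rule transport_inv_hom[OF baerD1[OF E] t])
    fix x assume "x \<in> carrier F"
    then show "t (inv_into (carrier E) t x) = x"
      unfolding F_def carrier_transport[OF baerD1[OF E] t] by (rule f_inv_into_f)
  qed
  moreover have "(\<lambda>x. t (i (k x))) \<in> module_homs R Q F"
    by (rule homs_comp[OF homs_comp[OF kG i(1)] tF])
  moreover have "x = \<zero>\<^bsub>Q\<^esub>" if x: "x \<in> carrier Q" "t (i (k x)) = \<zero>\<^bsub>F\<^esub>" for x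
  proof -
    interpret E: module R E by (rule baerD1[OF E])
    have "t (i (k x)) = t \<zero>\<^bsub>E\<^esub>" using x(2) homs_zero[OF tF baerD1[OF E] F] by simp
    then have "i (k x) = \<zero>\<^bsub>E\<^esub>" using inj_onD[OF t] homs_closed[OF i(1) homs_closed[OF kG x(1)]] by simp
    then have "k x = k \<zero>\<^bsub>Q\<^esub>" using i(2) homs_closed[OF kG x(1)] homs_zero[OF kG Q G] by simp
    then show ?thesis using inj_onD[OF k] x(1) by simp
  qed
  ultimately show ?thesis using that by blast
qed

lemma injective_resolution_exists:
  fixes R :: "('a, 'r) ring_scheme" and M :: "('a, 'm, 'c) module_scheme"
  assumes M: "module R M"
  shows "\<exists>(I :: nat \<Rightarrow> ('a, 'a list \<Rightarrow> 'm option) module) d \<epsilon>. injective_resolution R M I d \<epsilon>"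
proof -
  \<comment> \<open>Constant functions give the first injection of the carrier of \<open>M\<close>
    into the target type.\<close>
  have "inj_on (\<lambda>x (l :: 'a list). Some x) (carrier M)" by (auto simp: inj_on_def fun_eq_iff)
  then obtain I0 :: "('a, 'a list \<Rightarrow> 'm option) module" and \<epsilon> where I0: "baer R I0"
    and \<epsilon>: "\<epsilon> \<in> module_homs R M I0" "\<And>x. x \<in> carrier M \<Longrightarrow> \<epsilon> x = \<zero>\<^bsub>I0\<^esub> \<Longrightarrow> x = \<zero>\<^bsub>M\<^esub>"
    using enough_injectives[OF M] by blast
  \<comment> \<open>A state pairs a term of the resolution with the image of the map into it. The
    next term is an injective module that contains the quotient by this image.\<close>
  define P where "P n X \<longleftrightarrow> baer R (fst X) \<and> submodule (snd X) R (fst X) \<and> (n = 0 \<longrightarrow> X = (I0, \<epsilon> ` carrier M))"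
    for n :: nat and X :: "('a, 'a list \<Rightarrow> 'm option) module \<times> ('a list \<Rightarrow> 'm option) set"
  define S where "S n X Y \<longleftrightarrow> (\<exists>d. d \<in> module_homs R (fst X) (fst Y) \<and>
      snd X = a_kernel (fst X) (fst Y) d \<and> snd Y = d ` carrier (fst X))"
    for n :: nat and X Y :: "('a, 'a list \<Rightarrow> 'm option) module \<times> ('a list \<Rightarrow> 'm option) set"
  have "P 0 (I0, \<epsilon> ` carrier M)"
    unfolding P_def using I0 submodule_image[OF M baerD1[OF I0] \<epsilon>(1) submodule_carrier[OF M]] by simp
  moreover have "\<exists>Y. P (Suc n) Y \<and> S n X Y" if "P n X" for n X
  proof -
    obtain I U where X: "X = (I, U)" by (cases X)
    have I: "baer R I" and U: "submodule U R I" using that X unfolding P_def by auto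
    note mI = baerD1[OF I]
    let ?Q = "quotient_module I U" and ?p = "\<lambda>x. U +>\<^bsub>I\<^esub> x"
    have Q: "module R ?Q" by (rule module_quotient[OF mI U])
    have p: "?p \<in> module_homs R I ?Q" by (rule proj_hom[OF mI U])
    \<comment> \<open>A quotient is no larger than the module: choosing a representative in each
      coset injects it into the same type.\<close>
    have "inj_on (inv_into (carrier I) ?p) (carrier ?Q)"
      unfolding carrier_quotient[OF mI U] by (rule inj_on_inv_into) simp
    then obtain E :: "('a, 'a list \<Rightarrow> 'm option) module" and i where E: "baer R E"
      and i: "i \<in> module_homs R ?Q E" "\<And>x. x \<in> carrier ?Q \<Longrightarrow> i x = \<zero>\<^bsub>E\<^esub> \<Longrightarrow> x = \<zero>\<^bsub>?Q\<^esub>"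
      using enough_injectives[OF Q] by blast
    let ?d = "\<lambda>x. i (?p x)"
    have d: "?d \<in> module_homs R I E" by (rule homs_comp[OF p i(1)])
    have "?d x = \<zero>\<^bsub>E\<^esub> \<longleftrightarrow> x \<in> U" if "x \<in> carrier I" for x
      using i(2)[OF homs_closed[OF p that]] proj_zero_iff[OF mI U that] homs_zero[OF i(1) Q baerD1[OF E]] by auto
    then have "U = a_kernel I E ?d" unfolding a_kernel_def' using submoduleD(1)[OF U] by auto
    then have "P (Suc n) (E, ?d ` carrier I) \<and> S n X (E, ?d ` carrier I)"
      unfolding P_def S_def X using E d submodule_image[OF mI baerD1[OF E] d submodule_carrier[OF mI]] by auto
    then show ?thesis by blast
  qed
  ultimately obtain X where X: "\<And>n. P n (X n)" "\<And>n. S n (X n) (X (Suc n))"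
    using dependent_nat_choice[of P S] by metis
  then obtain d where d: "\<And>n. d n \<in> module_homs R (fst (X n)) (fst (X (Suc n)))"
    "\<And>n. snd (X n) = a_kernel (fst (X n)) (fst (X (Suc n))) (d n)"
    "\<And>n. snd (X (Suc n)) = d n ` carrier (fst (X n))"
    unfolding S_def by metis
  have X0: "X 0 = (I0, \<epsilon> ` carrier M)" using X(1)[of 0] unfolding P_def by simp
  have "inj_on \<epsilon> (carrier M)"
  proof (rule inj_onI)
    interpret M: module R M by (fact M)
    fix x y assume "x \<in> carrier M" "y \<in> carrier M" "\<epsilon> x = \<epsilon> y"
    then have "\<epsilon> (x \<ominus>\<^bsub>M\<^esub> y) = \<zero>\<^bsub>I0\<^esub>"
      using homs_minus[OF \<epsilon>(1) M baerD1[OF I0], of x y] homs_closed[OF \<epsilon>(1)]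
        homs_eq_iff_diff[OF baerD1[OF I0], of "\<epsilon> x" "\<epsilon> y"] by simp
    then show "x = y" using \<epsilon>(2)[of "x \<ominus>\<^bsub>M\<^esub> y"] homs_eq_iff_diff[OF M] \<open>x \<in> _\<close> \<open>y \<in> _\<close> by simp
  qed
  then have "injective_resolution R M (\<lambda>n. fst (X n)) d \<epsilon>"
    unfolding injective_resolution_def injective_module_iff_baer
    using X(1) d d(2)[of 0] \<epsilon>(1) X0 unfolding P_def by auto
  then show ?thesis by blast
qed

text \<open>Existence turns the choice made by \<open>inj_res\<close> into an instance of the
  locale.\<close>

lemma inj_res_resolution:
  fixes R :: "('a, 'r) ring_scheme" and M :: "('a, 'm, 'c) module_scheme"
  assumes "module R M"
  obtains I d \<epsilon> where "inj_res R M = (I, d)" "inj_resolution R M I d \<epsilon>"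
proof -
  obtain I d where Id: "inj_res R M = (I, d)" by (cases "inj_res R M")
  have "\<exists>x :: (nat \<Rightarrow> ('a, 'a list \<Rightarrow> 'm option) module) \<times> (nat \<Rightarrow> ('a list \<Rightarrow> 'm option) \<Rightarrow> 'a list \<Rightarrow> 'm option).
      case x of (I, d) \<Rightarrow> \<exists>\<epsilon>. injective_resolution R M I d \<epsilon>"
  proof -
    obtain I d \<epsilon> where "injective_resolution R M (I :: nat \<Rightarrow> ('a, 'a list \<Rightarrow> 'm option) module) d \<epsilon>"
      using injective_resolution_exists[OF assms] by blast
    then show ?thesis by (intro exI[of _ "(I, d)"]) auto
  qed
  then have "case inj_res R M of (I, d) \<Rightarrow> \<exists>\<epsilon>. injective_resolution R M I d \<epsilon>"
    unfolding inj_res_def by (rule someI_ex)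
  then show ?thesis using that Id assms by (auto simp: inj_resolution_def)
qed

section \<open>Finite generation\<close>

text \<open>For submodules \<open>W \<subseteq> U\<close> this says that \<open>U/W\<close> is
  finitely generated. Testing on the submodules that contain \<open>W\<close> and the generators
  avoids both linear combinations and quotient records.\<close>

definition generated_mod where
  "generated_mod R M U W \<longleftrightarrow>
    (\<exists>S. finite S \<and> S \<subseteq> U \<and> (\<forall>Y. submodule Y R M \<and> W \<subseteq> Y \<and> S \<subseteq> Y \<longrightarrow> U \<subseteq> Y))"

text \<open>For submodules \<open>W \<subseteq> V\<close>: the quotient \<open>V/W\<close> is a Noetherian module.\<close>

definition noeth_mod where
  "noeth_mod R M V W \<longleftrightarrow> (\<forall>U. submodule U R M \<and> W \<subseteq> U \<and> U \<subseteq> V \<longrightarrow> generated_mod R M U W)"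

lemma generated_modI:
  assumes "finite S" "S \<subseteq> U" "\<And>Y. submodule Y R M \<Longrightarrow> W \<subseteq> Y \<Longrightarrow> S \<subseteq> Y \<Longrightarrow> U \<subseteq> Y"
  shows "generated_mod R M U W"
  unfolding generated_mod_def using assms by (intro exI[of _ S] conjI allI impI) (elim conjE, assumption | simp)+

lemma generated_modE:
  assumes "generated_mod R M U W"
  obtains S where "finite S" "S \<subseteq> U" "\<And>Y. submodule Y R M \<Longrightarrow> W \<subseteq> Y \<Longrightarrow> S \<subseteq> Y \<Longrightarrow> U \<subseteq> Y"
proof -
  obtain S where S: "finite S" "S \<subseteq> U" "\<forall>Y. submodule Y R M \<and> W \<subseteq> Y \<and> S \<subseteq> Y \<longrightarrow> U \<subseteq> Y"
    using assms unfolding generated_mod_def by (elim exE conjE)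
  show ?thesis by (rule that[OF S(1,2)]) (use S(3) in simp)
qed

lemma noeth_modE:
  assumes "noeth_mod R M V W" "submodule U R M" "W \<subseteq> U" "U \<subseteq> V"
  obtains S where "finite S" "S \<subseteq> U" "\<And>Y. submodule Y R M \<Longrightarrow> W \<subseteq> Y \<Longrightarrow> S \<subseteq> Y \<Longrightarrow> U \<subseteq> Y"
proof -
  have "generated_mod R M U W" using assms unfolding noeth_mod_def by simp
  then show ?thesis by (rule generated_modE) (rule that)
qed

lemma noeth_mod_mono: "noeth_mod R M V W \<Longrightarrow> V' \<subseteq> V \<Longrightarrow> noeth_mod R M V' W"
  unfolding noeth_mod_def by blast

lemma noeth_mod_trivial: "V \<subseteq> W \<Longrightarrow> noeth_mod R M V W"
  unfolding noeth_mod_def generated_mod_def by (intro allI impI exI[of _ "{}"]) blast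

text \<open>The map \<open>h\<close> induces a surjection from \<open>V/W\<close> to
  \<open>V'/W'\<close>. A submodule between \<open>W'\<close> and \<open>V'\<close> is generated
  modulo \<open>W'\<close> by the images of generators of its preimage in \<open>V\<close>.\<close>

lemma noeth_mod_image:
  assumes M: "module R M" and N: "module R N" and h: "h \<in> module_homs R M N"
    and V: "submodule V R M" and W: "submodule W R M" and V': "submodule V' R N" and W': "submodule W' R N"
    and WV: "W \<subseteq> V"
    and hW: "\<And>x. x \<in> W \<Longrightarrow> h x \<in> W'"
    and surj: "\<And>y. y \<in> V' \<Longrightarrow> \<exists>x\<in>V. y \<ominus>\<^bsub>N\<^esub> h x \<in> W'"
    and noeth: "noeth_mod R M V W"
  shows "noeth_mod R N V' W'"
  unfolding noeth_mod_def
proof (intro allI impI, elim conjE)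
  interpret N: module R N by fact
  fix U' assume U': "submodule U' R N" and WU: "W' \<subseteq> U'" and UV: "U' \<subseteq> V'"
  define U where "U = V \<inter> {x \<in> carrier M. h x \<in> U'}"
  have U: "submodule U R M" unfolding U_def by (rule submodule_inter[OF M V submodule_vimage[OF M N h U']])
  have WU1: "W \<subseteq> U" unfolding U_def using WV hW WU submoduleD(1)[OF W] by auto
  have UV1: "U \<subseteq> V" unfolding U_def by blast
  obtain S where S: "finite S" "S \<subseteq> U" "\<And>Y. submodule Y R M \<Longrightarrow> W \<subseteq> Y \<Longrightarrow> S \<subseteq> Y \<Longrightarrow> U \<subseteq> Y"
    by (rule noeth_modE[OF noeth U WU1 UV1]) (rule that)
  show "generated_mod R N U' W'"
  proof (rule generated_modI[of "h ` S"])
    show "finite (h ` S)" using S(1) by simp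
    show "h ` S \<subseteq> U'" using S(2) unfolding U_def by auto
    fix Y assume Y: "submodule Y R N" and "W' \<subseteq> Y" and SY: "h ` S \<subseteq> Y"
    have UY: "U \<subseteq> {x \<in> carrier M. h x \<in> Y}"
    proof (rule S(3)[OF submodule_vimage[OF M N h Y]])
      show "W \<subseteq> {x \<in> carrier M. h x \<in> Y}" using hW \<open>W' \<subseteq> Y\<close> submoduleD(1)[OF W] by auto
      show "S \<subseteq> {x \<in> carrier M. h x \<in> Y}" using SY S(2) unfolding U_def by auto
    qed
    show "U' \<subseteq> Y"
    proof
      fix y assume y: "y \<in> U'"
      then obtain x where x: "x \<in> V" "y \<ominus>\<^bsub>N\<^esub> h x \<in> W'" using surj UV by blast
      have c: "y \<in> carrier N" "x \<in> carrier M" "h x \<in> carrier N"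
        using y x submoduleD(1)[OF U'] submoduleD(1)[OF V] homs_closed[OF h] by auto
      have hx: "h x = y \<ominus>\<^bsub>N\<^esub> (y \<ominus>\<^bsub>N\<^esub> h x)"
        using c by (simp add: a_minus_def N.M.minus_add N.M.r_neg2)
      have "y \<ominus>\<^bsub>N\<^esub> (y \<ominus>\<^bsub>N\<^esub> h x) \<in> U'" using x(2) WU y by (blast intro: submoduleD(6)[OF U'])
      then have "x \<in> U" unfolding U_def using x(1) c hx by simp
      then have "h x \<in> Y" using UY by blast
      moreover have "y = (y \<ominus>\<^bsub>N\<^esub> h x) \<oplus>\<^bsub>N\<^esub> h x" using c by (simp add: a_minus_def N.M.a_assoc N.M.l_neg)
      ultimately show "y \<in> Y" using x(2) \<open>W' \<subseteq> Y\<close> submoduleD(3)[OF Y] by (metis subsetD)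
    qed
  qed
qed

text \<open>The map \<open>h\<close> induces a map from \<open>V/W\<close> to \<open>V'/W'\<close>,
  and \<open>n1\<close> speaks of its kernel. Generators of the part of \<open>U\<close> in the
  kernel together with lifts of generators of its image generate \<open>U\<close>.\<close>

lemma noeth_mod_extension:
  assumes M: "module R M" and N: "module R N" and h: "h \<in> module_homs R M N"
    and W': "submodule W' R N" and V': "submodule V' R N" and W'V': "W' \<subseteq> V'"
    and hW: "\<And>x. x \<in> W \<Longrightarrow> h x \<in> W'"
    and hV: "\<And>x. x \<in> V \<Longrightarrow> h x \<in> V'"
    and n1: "noeth_mod R M {x \<in> V. h x \<in> W'} W" and n2: "noeth_mod R N V' W'"
  shows "noeth_mod R M V W"
  unfolding noeth_mod_def
proof (intro allI impI, elim conjE)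
  interpret M: module R M by fact
  interpret N: module R N by fact
  fix U assume U: "submodule U R M" and WU: "W \<subseteq> U" and UV: "U \<subseteq> V"
  note Uc = submoduleD(1)[OF U]
  define U1 where "U1 = U \<inter> {x \<in> carrier M. h x \<in> W'}"
  have U1: "submodule U1 R M" unfolding U1_def by (rule submodule_inter[OF M U submodule_vimage[OF M N h W']])
  have WU1: "W \<subseteq> U1" unfolding U1_def using WU hW Uc by auto
  have UV1: "U1 \<subseteq> {x \<in> V. h x \<in> W'}" unfolding U1_def using UV by auto
  obtain S1 where S1: "finite S1" "S1 \<subseteq> U1"
    "\<And>Y. submodule Y R M \<Longrightarrow> W \<subseteq> Y \<Longrightarrow> S1 \<subseteq> Y \<Longrightarrow> U1 \<subseteq> Y"
    by (rule noeth_modE[OF n1 U1 WU1 UV1]) (rule that)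
  \<comment> \<open>The image of \<open>U\<close> is enlarged by \<open>W'\<close>, because
    \<open>n2\<close> speaks of submodules that contain \<open>W'\<close>.\<close>
  define U2 where "U2 = {x \<oplus>\<^bsub>N\<^esub> y | x y. x \<in> h ` U \<and> y \<in> W'}"
  have U2: "submodule U2 R N" unfolding U2_def
    by (rule submodule_set_add[OF N submodule_image[OF M N h U] W'])
  have hU2: "h x \<in> U2" if "x \<in> U" for x
  proof -
    have "h x = h x \<oplus>\<^bsub>N\<^esub> \<zero>\<^bsub>N\<^esub>" using homs_closed[OF h Uc[OF that]] by simp
    then show ?thesis unfolding U2_def using that submoduleD(2)[OF W'] by blast
  qed
  have WU2: "W' \<subseteq> U2"
  proof
    fix y assume y: "y \<in> W'"
    then have "y = h \<zero>\<^bsub>M\<^esub> \<oplus>\<^bsub>N\<^esub> y" using submoduleD(1)[OF W'] homs_zero[OF h M N] by simp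
    then show "y \<in> U2" unfolding U2_def using y submoduleD(2)[OF U] by blast
  qed
  have UV2: "U2 \<subseteq> V'"
  proof
    fix y assume "y \<in> U2"
    then obtain x w where "x \<in> U" "w \<in> W'" "y = h x \<oplus>\<^bsub>N\<^esub> w" unfolding U2_def by auto
    then show "y \<in> V'" using submoduleD(3)[OF V', of "h x" w] hV UV W'V' by auto
  qed
  obtain S2 where S2: "finite S2" "S2 \<subseteq> U2"
    "\<And>Y. submodule Y R N \<Longrightarrow> W' \<subseteq> Y \<Longrightarrow> S2 \<subseteq> Y \<Longrightarrow> U2 \<subseteq> Y"
    by (rule noeth_modE[OF n2 U2 WU2 UV2]) (rule that)
  have "\<forall>s\<in>S2. \<exists>u\<in>U. \<exists>w\<in>W'. s = h u \<oplus>\<^bsub>N\<^esub> w" using S2(2) unfolding U2_def by blast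
  then obtain t where t: "\<And>s. s \<in> S2 \<Longrightarrow> t s \<in> U" "\<And>s. s \<in> S2 \<Longrightarrow> \<exists>w\<in>W'. s = h (t s) \<oplus>\<^bsub>N\<^esub> w" by metis
  show "generated_mod R M U W"
  proof (rule generated_modI[of "S1 \<union> t ` S2"])
    show "finite (S1 \<union> t ` S2)" using S1(1) S2(1) by simp
    show "S1 \<union> t ` S2 \<subseteq> U" using S1(2) t(1) unfolding U1_def by auto
    fix Y assume Y: "submodule Y R M" and WY: "W \<subseteq> Y" and SY: "S1 \<union> t ` S2 \<subseteq> Y"
    \<comment> \<open>Intersecting with \<open>U\<close> keeps the difference \<open>u - x\<close>
      below inside \<open>U\<close>, so that it lies in \<open>U1\<close>.\<close>
    define X where "X = Y \<inter> U"
    have X: "submodule X R M" unfolding X_def by (rule submodule_inter[OF M Y U])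
    have U1Y: "U1 \<subseteq> Y" using S1(3)[OF Y WY] SY by blast
    define X2 where "X2 = {x \<oplus>\<^bsub>N\<^esub> y | x y. x \<in> h ` X \<and> y \<in> W'}"
    have X2: "submodule X2 R N" unfolding X2_def
      by (rule submodule_set_add[OF N submodule_image[OF M N h X] W'])
    have "U2 \<subseteq> X2"
    proof (rule S2(3)[OF X2])
      show "W' \<subseteq> X2"
      proof
        fix y assume y: "y \<in> W'"
        then have "y = h \<zero>\<^bsub>M\<^esub> \<oplus>\<^bsub>N\<^esub> y" using submoduleD(1)[OF W'] homs_zero[OF h M N] by simp
        then show "y \<in> X2" unfolding X2_def using y submoduleD(2)[OF X] by blast
      qed
      show "S2 \<subseteq> X2"
      proof
        fix s assume s: "s \<in> S2"
        then have "t s \<in> X" using t(1) SY unfolding X_def by auto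
        then show "s \<in> X2" using t(2)[OF s] unfolding X2_def by blast
      qed
    qed
    show "U \<subseteq> Y"
    proof
      fix u assume u: "u \<in> U"
      then have "h u \<in> X2" using hU2 \<open>U2 \<subseteq> X2\<close> by blast
      then obtain x w where xw: "x \<in> X" "w \<in> W'" "h u = h x \<oplus>\<^bsub>N\<^esub> w" unfolding X2_def by blast
      have c: "u \<in> carrier M" "x \<in> carrier M" "w \<in> carrier N" "x \<in> U" "x \<in> Y"
        using u xw Uc submoduleD(1)[OF W'] unfolding X_def by auto
      have "h (u \<ominus>\<^bsub>M\<^esub> x) = w"
        using homs_minus[OF h M N c(1,2)] xw(3) module_add_diff_cancel[OF N homs_closed[OF h c(2)] c(3)] by simp
      then have "u \<ominus>\<^bsub>M\<^esub> x \<in> U1" unfolding U1_def using submoduleD(6)[OF U u c(4)] xw(2) c by simp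
      moreover have "u = (u \<ominus>\<^bsub>M\<^esub> x) \<oplus>\<^bsub>M\<^esub> x" using c by (simp add: a_minus_def M.M.a_assoc M.M.l_neg)
      ultimately show "u \<in> Y" using U1Y c(5) submoduleD(3)[OF Y] by (metis subsetD)
    qed
  qed
qed

lemma noeth_ring_as_module:
  assumes "cring R" "noetherian_ring R"
  shows "noeth_mod R (ring_as_module R) (carrier R) {\<zero>\<^bsub>R\<^esub>}"
  unfolding noeth_mod_def
proof (intro allI impI, elim conjE)
  interpret R: cring R by fact
  fix U assume "submodule U R (ring_as_module R)"
  then have "ideal U R" by (simp add: ideal_iff_submodule[OF assms(1)])
  then obtain A where A: "A \<subseteq> carrier R" "finite A" "U = Idl\<^bsub>R\<^esub> A"
    using noetherian_ring.finetely_gen[OF assms(2)] by blast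
  show "generated_mod R (ring_as_module R) U {\<zero>\<^bsub>R\<^esub>}"
    using A R.genideal_self[OF A(1)] R.genideal_minimal
    by (intro generated_modI[of A]) (auto simp: ideal_iff_submodule[OF assms(1), symmetric])
qed

lemma submodule_finsum:
  assumes M: "module R M" and Y: "submodule Y R M" and S: "finite S" "\<And>s. s \<in> S \<Longrightarrow> f s \<in> Y"
  shows "(\<Oplus>\<^bsub>M\<^esub>s\<in>S. f s) \<in> Y"
proof -
  interpret M: module R M by fact
  show ?thesis using S
  proof (induction S)
    case empty then show ?case using submoduleD(2)[OF Y] by simp
  next
    case (insert x S)
    then show ?case using submoduleD(1,3)[OF Y] by (subst M.M.finsum_insert) auto
  qed
qed

text \<open>The linear combinations of \<open>S\<close> form a submodule \<open>L\<close> that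
  contains \<open>S\<close>, and every submodule that contains \<open>S\<close> contains
  \<open>L\<close>.\<close>

lemma finitely_generated_iff:
  assumes M: "module R M"
  shows "finitely_generated R M \<longleftrightarrow> generated_mod R M (carrier M) {\<zero>\<^bsub>M\<^esub>}"
proof
  interpret M: module R M by fact
  assume "finitely_generated R M"
  then obtain S where S: "finite S" "S \<subseteq> carrier M"
    "\<And>x. x \<in> carrier M \<Longrightarrow> \<exists>c\<in>S \<rightarrow> carrier R. x = (\<Oplus>\<^bsub>M\<^esub>s\<in>S. c s \<odot>\<^bsub>M\<^esub> s)"
    unfolding finitely_generated_def by blast
  show "generated_mod R M (carrier M) {\<zero>\<^bsub>M\<^esub>}"
  proof (rule generated_modI[OF S(1,2)], rule subsetI)
    fix Y x assume Y: "submodule Y R M" and SY: "S \<subseteq> Y" and "x \<in> carrier M"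
    then obtain c where c: "c \<in> S \<rightarrow> carrier R" "x = (\<Oplus>\<^bsub>M\<^esub>s\<in>S. c s \<odot>\<^bsub>M\<^esub> s)" using S(3) by blast
    show "x \<in> Y" unfolding c(2)
      by (rule submodule_finsum[OF M Y S(1)]) (use c(1) SY submoduleD(4)[OF Y] in auto)
  qed
next
  interpret M: module R M by fact
  assume "generated_mod R M (carrier M) {\<zero>\<^bsub>M\<^esub>}"
  then obtain S where S: "finite S" "S \<subseteq> carrier M"
    "\<And>Y. submodule Y R M \<Longrightarrow> {\<zero>\<^bsub>M\<^esub>} \<subseteq> Y \<Longrightarrow> S \<subseteq> Y \<Longrightarrow> carrier M \<subseteq> Y"
    by (rule generated_modE) (rule that)
  let ?l = "\<lambda>c. \<Oplus>\<^bsub>M\<^esub>s\<in>S. c s \<odot>\<^bsub>M\<^esub> s"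
  define L where "L = ?l ` (S \<rightarrow> carrier R)"
  have cl: "(\<lambda>s. c s \<odot>\<^bsub>M\<^esub> s) \<in> S \<rightarrow> carrier M" if "c \<in> S \<rightarrow> carrier R" for c
    using that S(2) by auto
  have L: "submodule L R M"
  proof (rule submoduleI'[OF M])
    fix x assume "x \<in> L" then show "x \<in> carrier M" unfolding L_def using cl by auto
  next
    have "?l (\<lambda>_. \<zero>\<^bsub>R\<^esub>) = (\<Oplus>\<^bsub>M\<^esub>s\<in>S. \<zero>\<^bsub>M\<^esub>)" by (rule M.M.finsum_cong') (use S(2) in auto)
    then show "\<zero>\<^bsub>M\<^esub> \<in> L" unfolding L_def by (intro image_eqI[of _ _ "\<lambda>_. \<zero>\<^bsub>R\<^esub>"]) auto
  next
    fix x y assume "x \<in> L" "y \<in> L"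
    then obtain c c' where c: "x = ?l c" "c \<in> S \<rightarrow> carrier R" "y = ?l c'" "c' \<in> S \<rightarrow> carrier R"
      unfolding L_def by auto
    have "?l (\<lambda>s. c s \<oplus>\<^bsub>R\<^esub> c' s) = (\<Oplus>\<^bsub>M\<^esub>s\<in>S. c s \<odot>\<^bsub>M\<^esub> s \<oplus>\<^bsub>M\<^esub> c' s \<odot>\<^bsub>M\<^esub> s)"
      by (rule M.M.finsum_cong') (use c cl S(2) in \<open>auto simp: M.smult_l_distr Pi_iff subset_eq\<close>)
    also have "\<dots> = x \<oplus>\<^bsub>M\<^esub> y" unfolding c by (rule M.M.finsum_addf[OF cl[OF c(2)] cl[OF c(4)]])
    finally show "x \<oplus>\<^bsub>M\<^esub> y \<in> L" unfolding L_def using c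
      by (intro image_eqI[of _ _ "\<lambda>s. c s \<oplus>\<^bsub>R\<^esub> c' s"]) auto
  next
    fix r x assume r: "r \<in> carrier R" and "x \<in> L"
    then obtain c where c: "x = ?l c" "c \<in> S \<rightarrow> carrier R" unfolding L_def by auto
    have "r \<odot>\<^bsub>M\<^esub> x = (\<Oplus>\<^bsub>M\<^esub>s\<in>S. r \<odot>\<^bsub>M\<^esub> (c s \<odot>\<^bsub>M\<^esub> s))"
      unfolding c by (rule M.finsum_smult_ldistr[OF S(1) r cl[OF c(2)]])
    also have "\<dots> = ?l (\<lambda>s. r \<otimes>\<^bsub>R\<^esub> c s)"
      by (rule M.M.finsum_cong') (use c r S(2) in \<open>auto simp: M.smult_assoc1 Pi_iff subset_eq\<close>)
    finally show "r \<odot>\<^bsub>M\<^esub> x \<in> L" unfolding L_def using c r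
      by (intro image_eqI[of _ _ "\<lambda>s. r \<otimes>\<^bsub>R\<^esub> c s"]) auto
  qed
  have "S \<subseteq> L"
  proof
    fix s assume s: "s \<in> S"
    let ?c = "\<lambda>s'. if s = s' then \<one>\<^bsub>R\<^esub> else \<zero>\<^bsub>R\<^esub>"
    have "?l ?c = (\<Oplus>\<^bsub>M\<^esub>s'\<in>S. if s = s' then s' else \<zero>\<^bsub>M\<^esub>)"
      by (rule M.M.finsum_cong') (use S(2) in auto)
    also have "\<dots> = s" by (rule M.M.add.finprod_singleton[OF s S(1)]) (use S(2) in auto)
    finally show "s \<in> L" unfolding L_def by (intro image_eqI[of _ _ ?c]) auto
  qed
  then have "carrier M \<subseteq> L" using S(3)[OF L] submoduleD(2)[OF L] by simp
  then show "finitely_generated R M" unfolding finitely_generated_def L_def using S(1,2) by blast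
qed

text \<open>Generators are added one at a time: \<open>(V + Rt)/V\<close> is an image of
  \<open>R\<close> under multiplication with \<open>t\<close>, hence noetherian, and so is an
  extension of it by a noetherian \<open>V\<close>.\<close>

lemma noeth_finitely_generated:
  assumes noeth: "noetherian_ring R" and M: "module R M" and fg: "finitely_generated R M"
  shows "noeth_mod R M (carrier M) {\<zero>\<^bsub>M\<^esub>}"
proof -
  interpret M: module R M by fact
  let ?R = "ring_as_module R"
  have mR: "module R ?R" by (rule module_ring_as_module[OF M.is_cring])
  have z: "submodule {\<zero>\<^bsub>M\<^esub>} R M" by (rule submodule_zero_set[OF M])
  obtain S where S: "finite S" "S \<subseteq> carrier M"
    "\<And>Y. submodule Y R M \<Longrightarrow> {\<zero>\<^bsub>M\<^esub>} \<subseteq> Y \<Longrightarrow> S \<subseteq> Y \<Longrightarrow> carrier M \<subseteq> Y"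
    by (rule generated_modE[OF fg[unfolded finitely_generated_iff[OF M]]]) (rule that)
  from S(1,2) have "\<exists>V. submodule V R M \<and> S \<subseteq> V \<and> noeth_mod R M V {\<zero>\<^bsub>M\<^esub>}"
  proof (induction S)
    case empty
    then show ?case using z noeth_mod_trivial by blast
  next
    case (insert t S)
    then obtain V where V: "submodule V R M" "S \<subseteq> V" "noeth_mod R M V {\<zero>\<^bsub>M\<^esub>}" by auto
    have t: "t \<in> carrier M" using insert by simp
    define X where "X = add_cyclic R M V t"
    have X: "submodule X R M" and VX: "V \<subseteq> X" and tX: "t \<in> X"
      unfolding X_def by (rule add_cyclic[OF M V(1) t])+
    have "noeth_mod R M X {\<zero>\<^bsub>M\<^esub>}"
    proof (rule noeth_mod_extension[OF M M homs_id V(1) X VX])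
      show "x \<in> V" if "x \<in> {\<zero>\<^bsub>M\<^esub>}" for x using that submoduleD(2)[OF V(1)] by simp
      show "noeth_mod R M {x \<in> X. x \<in> V} {\<zero>\<^bsub>M\<^esub>}" by (rule noeth_mod_mono[OF V(3)]) blast
      show "noeth_mod R M X V"
      proof (rule noeth_mod_image[OF mR M mult_hom[OF M t] submodule_carrier[OF mR] submodule_zero_set[OF mR] X V(1)])
        show "noeth_mod R ?R (carrier ?R) {\<zero>\<^bsub>?R\<^esub>}" using noeth_ring_as_module[OF M.is_cring noeth] by simp
        fix y assume "y \<in> X"
        then obtain x r where xr: "x \<in> V" "r \<in> carrier R" "y = x \<oplus>\<^bsub>M\<^esub> r \<odot>\<^bsub>M\<^esub> t" unfolding X_def add_cyclic_def by auto
        have xc: "x \<in> carrier M" using xr(1) submoduleD(1)[OF V(1)] by simp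
        have "y \<ominus>\<^bsub>M\<^esub> r \<odot>\<^bsub>M\<^esub> t = x"
          using module_add_diff_cancel[OF M, of "r \<odot>\<^bsub>M\<^esub> t" x] xr t xc by (simp add: M.M.a_comm)
        then show "\<exists>r\<in>carrier ?R. y \<ominus>\<^bsub>M\<^esub> r \<odot>\<^bsub>M\<^esub> t \<in> V"
          using xr by (intro bexI[of _ r]) auto
      qed (use t submoduleD(2)[OF V(1)] in auto)
    qed
    then show ?case using X V(2) VX tX by blast
  qed
  then obtain V where V: "submodule V R M" "S \<subseteq> V" "noeth_mod R M V {\<zero>\<^bsub>M\<^esub>}" by blast
  have "carrier M \<subseteq> V" using S(3)[OF V(1) _ V(2)] submoduleD(2)[OF V(1)] by simp
  then show ?thesis by (rule noeth_mod_mono[OF V(3)])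
qed

lemma finitely_generated_surj:
  assumes M: "module R M" and N: "module R N" and f: "f \<in> module_homs R M N"
    and surj: "f ` carrier M = carrier N" and fg: "finitely_generated R M"
  shows "finitely_generated R N"
proof -
  obtain S where S: "finite S" "S \<subseteq> carrier M"
    "\<And>Y. submodule Y R M \<Longrightarrow> {\<zero>\<^bsub>M\<^esub>} \<subseteq> Y \<Longrightarrow> S \<subseteq> Y \<Longrightarrow> carrier M \<subseteq> Y"
    by (rule generated_modE[OF fg[unfolded finitely_generated_iff[OF M]]]) (rule that)
  have "generated_mod R N (carrier N) {\<zero>\<^bsub>N\<^esub>}"
  proof (rule generated_modI[of "f ` S"])
    fix Y assume Y: "submodule Y R N" and SY: "f ` S \<subseteq> Y"
    have Z: "submodule {x \<in> carrier M. f x \<in> Y} R M" by (rule submodule_vimage[OF M N f Y])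
    have "carrier M \<subseteq> {x \<in> carrier M. f x \<in> Y}"
      by (rule S(3)[OF Z]) (use submoduleD(2)[OF Z] S(2) SY in auto)
    then show "carrier N \<subseteq> Y" by (force simp: surj[symmetric])
  qed (use S surj in auto)
  then show ?thesis by (simp add: finitely_generated_iff[OF N])
qed

lemma finitely_generated_iso:
  assumes M: "module R M" and N: "module R N" and iso: "module_iso R M N" and fg: "finitely_generated R M"
  shows "finitely_generated R N"
proof -
  obtain f where "f \<in> module_homs R M N" "bij_betw f (carrier M) (carrier N)"
    using iso unfolding module_iso_def by blast
  then show ?thesis using finitely_generated_surj[OF M N _ _ fg] by (auto simp: bij_betw_def)
qed

lemma finitely_generated_quotient:
  assumes M: "module R M" and V: "submodule V R M" and W: "submodule W R M" and WV: "W \<subseteq> V"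
    and noeth: "noeth_mod R M V W"
  shows "finitely_generated R (quotient_module (M\<lparr>carrier := V\<rparr>) W)"
proof -
  let ?V = "M\<lparr>carrier := V\<rparr>"
  have mV: "module R ?V" by (rule restrict_module[OF V M])
  have W': "submodule W R ?V" by (rule submodule_restrict[OF M V W WV])
  let ?Q = "quotient_module ?V W" and ?p = "\<lambda>x. W +>\<^bsub>?V\<^esub> x"
  note Q = module_quotient[OF mV W'] and p = proj_hom[OF mV W'] and cQ = carrier_quotient[OF mV W']
  obtain S where S: "finite S" "S \<subseteq> V" "\<And>Y. submodule Y R M \<Longrightarrow> W \<subseteq> Y \<Longrightarrow> S \<subseteq> Y \<Longrightarrow> V \<subseteq> Y"
    by (rule noeth_modE[OF noeth V WV order_refl]) (rule that)
  have "generated_mod R ?Q (carrier ?Q) {\<zero>\<^bsub>?Q\<^esub>}"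
  proof (rule generated_modI[of "?p ` S"])
    show "finite (?p ` S)" using S(1) by simp
    show "?p ` S \<subseteq> carrier ?Q" unfolding cQ using S(2) by auto
    fix Y assume Y: "submodule Y R ?Q" and SY: "?p ` S \<subseteq> Y"
    define Z where "Z = {x \<in> carrier ?V. ?p x \<in> Y}"
    have "submodule Z R ?V" unfolding Z_def by (rule submodule_vimage[OF mV Q p Y])
    then have "submodule Z R M" by (rule submodule_trans[OF M V])
    moreover have "W \<subseteq> Z"
    proof
      fix x assume x: "x \<in> W"
      then have "?p x = \<zero>\<^bsub>?Q\<^esub>" using proj_zero_iff[OF mV W', of x] WV by auto
      then show "x \<in> Z" unfolding Z_def using submoduleD(2)[OF Y] x WV by auto
    qed
    moreover have "S \<subseteq> Z" unfolding Z_def using S(2) SY by auto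
    ultimately have "V \<subseteq> Z" by (rule S(3))
    then show "carrier ?Q \<subseteq> Y" unfolding cQ Z_def by auto
  qed
  then show ?thesis by (simp add: finitely_generated_iff[OF Q])
qed

text \<open>A map \<open>R/(b : x) \<rightarrow> E\<close> extends along \<open>R/(b : x) \<cong> (b + Rx)/b \<subseteq> R/b\<close>.\<close>

lemma baer_divide:
  assumes E: "baer R E" and b: "submodule b R (ring_as_module R)" and x: "x \<in> carrier R"
    and w: "w \<in> annihilated {r \<in> carrier R. r \<otimes>\<^bsub>R\<^esub> x \<in> b} E"
  obtains v where "v \<in> annihilated b E" "x \<odot>\<^bsub>E\<^esub> v = w"
proof -
  interpret E: module R E by (rule baerD1[OF E])
  let ?R = "ring_as_module R"
  have mR: "module R ?R" by (rule module_ring_as_module[OF E.is_cring])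
  let ?Q = "quotient_module ?R b" and ?p = "\<lambda>r. b +>\<^bsub>?R\<^esub> r"
  note Q = module_quotient[OF mR b] and p = proj_hom[OF mR b]
  have wc: "w \<in> carrier E" using w by (simp add: annihilated_def)
  have m: "(\<lambda>r. r \<otimes>\<^bsub>R\<^esub> x) \<in> module_homs R ?R ?R" using mult_hom[OF mR, of x] x by simp
  obtain h where h: "h \<in> module_homs R ?Q E" "\<And>r. r \<in> carrier ?R \<Longrightarrow> h (?p (r \<otimes>\<^bsub>R\<^esub> x)) = r \<odot>\<^bsub>E\<^esub> w"
  proof (rule baer_factor[OF E mR Q homs_comp[OF m p] mult_hom[OF baerD1[OF E] wc]])
    fix r assume r: "r \<in> carrier ?R" "?p (r \<otimes>\<^bsub>R\<^esub> x) = \<zero>\<^bsub>?Q\<^esub>"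
    then have "r \<otimes>\<^bsub>R\<^esub> x \<in> b" using proj_zero_iff[OF mR b, of "r \<otimes>\<^bsub>R\<^esub> x"] x by simp
    then show "r \<odot>\<^bsub>E\<^esub> w = \<zero>\<^bsub>E\<^esub>" using w r by (simp add: annihilated_def)
  qed blast
  define v where "v = h (?p \<one>\<^bsub>R\<^esub>)"
  have hp: "(\<lambda>r. h (?p r)) \<in> module_homs R ?R E" by (rule homs_comp[OF p h(1)])
  have v: "r \<odot>\<^bsub>E\<^esub> v = h (?p r)" if "r \<in> carrier R" for r
    unfolding v_def using homs_smult[OF hp that, of "\<one>\<^bsub>R\<^esub>"] that by simp
  have "r \<odot>\<^bsub>E\<^esub> v = \<zero>\<^bsub>E\<^esub>" if r: "r \<in> b" for r
    using v[of r] submoduleD(1)[OF b r] proj_zero_iff[OF mR b, of r] r homs_zero[OF h(1) Q baerD1[OF E]] by simp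
  then have "v \<in> annihilated b E" unfolding annihilated_def v_def using homs_closed[OF hp, of "\<one>\<^bsub>R\<^esub>"] by simp
  moreover have "x \<odot>\<^bsub>E\<^esub> v = w" using v[OF x] h(2)[of "\<one>\<^bsub>R\<^esub>"] x wc by simp
  ultimately show ?thesis using that by blast
qed

text \<open>For an ideal \<open>b\<close>, the elements \<open>e\<close> of \<open>I j\<close> with \<open>b d e = 0\<close> modulo
  \<open>(0 : b) + d (I (j - 1))\<close> compute \<open>Ext j b M\<close>, because injectivity of \<open>I j\<close> identifies
  \<open>Hom(b, I j)\<close> with \<open>I j / (0 : b)\<close>. The two finiteness statements, for \<open>b\<close> and for \<open>R/b\<close>, are proved by
  a simultaneous induction along \<open>0 \<rightarrow> b \<rightarrow> R \<rightarrow> R/b \<rightarrow> 0\<close> and \<open>0 \<rightarrow> b \<rightarrow> b + Rx \<rightarrow> R/(b : x) \<rightarrow> 0\<close>.\<close>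

context inj_resolution
begin

definition ideal_cocycles where
  "ideal_cocycles b j = {e \<in> carrier (I j). d j e \<in> annihilated b (I (Suc j))}"

definition boundaries where
  "boundaries j = (case j of 0 \<Rightarrow> {\<zero>\<^bsub>I 0\<^esub>} | Suc k \<Rightarrow> d k ` carrier (I k))"

definition ideal_coboundaries where
  "ideal_coboundaries b j = {x \<oplus>\<^bsub>I j\<^esub> y | x y. x \<in> annihilated b (I j) \<and> y \<in> boundaries j}"

lemma boundaries_submodule: "submodule (boundaries j) R (I j)"
  unfolding boundaries_def
  using submodule_zero_set[OF module] submodule_image[OF module module d_hom submodule_carrier[OF module]]
  by (auto split: nat.split)

lemma d_boundaries: "y \<in> boundaries j \<Longrightarrow> d j y = \<zero>\<^bsub>I (Suc j)\<^esub>"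
  using d_d homs_zero[OF d_hom module module] by (auto simp: boundaries_def split: nat.splits)

context
  fixes b assumes b: "submodule b R (ring_as_module R)"
begin

private lemma b_sub: "b \<subseteq> carrier R"
  using submoduleD(1)[OF b] by auto

lemma ideal_cocycles_submodule: "submodule (ideal_cocycles b j) R (I j)"
  unfolding ideal_cocycles_def
  by (rule submodule_vimage[OF module module d_hom annihilated_submodule[OF module b_sub]])

lemma ideal_coboundaries_submodule: "submodule (ideal_coboundaries b j) R (I j)"
  unfolding ideal_coboundaries_def
  by (rule submodule_set_add[OF module annihilated_submodule[OF module b_sub] boundaries_submodule])

lemma ann_ideal_coboundaries: "annihilated b (I j) \<subseteq> ideal_coboundaries b j"
proof
  interpret Ij: module R "I j" by (rule module)
  fix x assume x: "x \<in> annihilated b (I j)"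
  then have "x = x \<oplus>\<^bsub>I j\<^esub> \<zero>\<^bsub>I j\<^esub>" by (simp add: annihilated_def)
  then show "x \<in> ideal_coboundaries b j"
    unfolding ideal_coboundaries_def using x submoduleD(2)[OF boundaries_submodule] by blast
qed

lemma boundaries_ideal_coboundaries: "boundaries j \<subseteq> ideal_coboundaries b j"
proof
  interpret Ij: module R "I j" by (rule module)
  fix x assume x: "x \<in> boundaries j"
  then have "x = \<zero>\<^bsub>I j\<^esub> \<oplus>\<^bsub>I j\<^esub> x" using submoduleD(1)[OF boundaries_submodule] by simp
  then show "x \<in> ideal_coboundaries b j"
    unfolding ideal_coboundaries_def using x submoduleD(2)[OF annihilated_submodule[OF module b_sub]] by blast
qed

lemma d_ideal_coboundaries:
  assumes "e \<in> ideal_coboundaries b j"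
  obtains x where "x \<in> annihilated b (I j)" "d j e = d j x"
proof -
  interpret Ij: module R "I (Suc j)" by (rule module)
  obtain x y where xy: "e = x \<oplus>\<^bsub>I j\<^esub> y" "x \<in> annihilated b (I j)" "y \<in> boundaries j"
    using assms unfolding ideal_coboundaries_def by blast
  have c: "x \<in> carrier (I j)" "y \<in> carrier (I j)"
    using xy submoduleD(1)[OF boundaries_submodule] by (auto simp: annihilated_def)
  then have "d j e = d j x" using xy(1) homs_add[OF d_hom c] d_boundaries[OF xy(3)] homs_closed[OF d_hom c(1)] by simp
  then show ?thesis using that xy(2) by blast
qed

lemma ideal_coboundaries_subset: "ideal_coboundaries b j \<subseteq> ideal_cocycles b j"
proof
  fix e assume e: "e \<in> ideal_coboundaries b j"
  obtain x where x: "x \<in> annihilated b (I j)" "d j e = d j x" by (rule d_ideal_coboundaries[OF e])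
  then show "e \<in> ideal_cocycles b j"
    unfolding ideal_cocycles_def
    using annihilated_hom[OF module module d_hom b_sub x(1)] submoduleD(1)[OF ideal_coboundaries_submodule e] by simp
qed

text \<open>The differential induces the connecting map from \<open>Ext j b M\<close> to
  \<open>Ext (j + 1) (R/b) M\<close>. It is onto because \<open>I\<close> is exact in degree
  \<open>j + 1\<close>.\<close>

lemma noeth_cocycles_step:
  assumes "noeth_mod R (I j) (ideal_cocycles b j) (ideal_coboundaries b j)"
  shows "noeth_mod R (I (Suc j)) (ann_cocycles b I d (Suc j)) (ann_coboundaries b I d (Suc j))"
proof (rule noeth_mod_image[OF module module d_hom ideal_cocycles_submodule ideal_coboundaries_submodule
      cocycles_submodule[OF b_sub] coboundaries_submodule[OF b_sub] ideal_coboundaries_subset _ _ assms])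
  fix x assume x: "x \<in> ideal_coboundaries b j"
  obtain x' where "x' \<in> annihilated b (I j)" "d j x = d j x'" by (rule d_ideal_coboundaries[OF x])
  then show "d j x \<in> ann_coboundaries b I d (Suc j)" by (simp add: ann_coboundaries_def)
next
  fix y assume y: "y \<in> ann_cocycles b I d (Suc j)"
  then have yc: "y \<in> carrier (I (Suc j))" "d (Suc j) y = \<zero>\<^bsub>I (Suc (Suc j))\<^esub>" "y \<in> annihilated b (I (Suc j))"
    by (auto simp: ann_cocycles_def annihilated_def)
  then obtain e where e: "e \<in> carrier (I j)" "y = d j e" using exact by auto
  have "y \<ominus>\<^bsub>I (Suc j)\<^esub> d j e = \<zero>\<^bsub>I (Suc j)\<^esub>" using homs_eq_iff_diff[OF module yc(1) yc(1)] e by simp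
  then show "\<exists>x\<in>ideal_cocycles b j. y \<ominus>\<^bsub>I (Suc j)\<^esub> d j x \<in> ann_coboundaries b I d (Suc j)"
    using e yc submoduleD(2)[OF coboundaries_submodule[OF b_sub, of "Suc j"]]
    by (intro bexI[of _ e]) (auto simp: ideal_cocycles_def)
qed

end

text \<open>With \<open>c = (b1 : x)\<close> the quotient \<open>b/b1\<close> is a copy of
  \<open>R/c\<close>. The proof reads the exactness of \<open>Ext j (R/c) M \<rightarrow> Ext j b M
  \<rightarrow> Ext j b1 M\<close> on elements: the second map is the identity on representatives,
  and multiplication by \<open>x\<close> compares its kernel with the cohomology for
  \<open>c\<close>.\<close>

lemma noeth_ideal_step:
  assumes b1: "submodule b1 R (ring_as_module R)" and b: "submodule b R (ring_as_module R)"
    and b1b: "b1 \<subseteq> b" and x: "x \<in> b"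
    and gen: "\<And>y. y \<in> b \<Longrightarrow> \<exists>p\<in>b1. \<exists>r\<in>carrier R. y = p \<oplus>\<^bsub>R\<^esub> r \<otimes>\<^bsub>R\<^esub> x"
    and IH: "noeth_mod R (I j) (ideal_cocycles b1 j) (ideal_coboundaries b1 j)"
    and Q: "\<And>c. submodule c R (ring_as_module R) \<Longrightarrow>
      noeth_mod R (I j) (ann_cocycles c I d j) (ann_coboundaries c I d j)"
  shows "noeth_mod R (I j) (ideal_cocycles b j) (ideal_coboundaries b j)"
proof -
  let ?R = "ring_as_module R"
  interpret Ij: module R "I j" by (rule module)
  have mR: "module R ?R" by (rule module_ring_as_module[OF Ij.is_cring])
  have xR: "x \<in> carrier R" using submoduleD(1)[OF b x] by simp
  have sub: "b1 \<subseteq> carrier R" "b \<subseteq> carrier R" using submoduleD(1)[OF b1] submoduleD(1)[OF b] by auto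
  define c where "c = {r \<in> carrier R. r \<otimes>\<^bsub>R\<^esub> x \<in> b1}"
  have c: "submodule c R ?R" unfolding c_def
    using submodule_vimage[OF mR mR mult_hom[OF mR, of x] b1] xR by simp
  have c_sub: "c \<subseteq> carrier R" unfolding c_def by auto
  have ann_mono: "annihilated b E \<subseteq> annihilated b1 E" for E :: "('a, 'e) module"
    using b1b unfolding annihilated_def by auto
  \<comment> \<open>Modulo coboundaries for \<open>b\<close>, every cocycle for \<open>b\<close>
    that is a coboundary for \<open>b1\<close> is represented in \<open>V\<close>. Multiplication by
    \<open>x\<close> maps \<open>V\<close> to cocycles killed by \<open>c\<close>.\<close>
  define V where "V = annihilated b1 (I j) \<inter> ideal_cocycles b j"
  have V: "submodule V R (I j)" unfolding V_def
    by (rule submodule_inter[OF module annihilated_submodule[OF module sub(1)] ideal_cocycles_submodule[OF b]])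
  have Vc: "u \<in> carrier (I j)" if "u \<in> V" for u using submoduleD(1)[OF V that] .
  let ?h = "\<lambda>u. x \<odot>\<^bsub>I j\<^esub> u"
  have h: "?h \<in> module_homs R (I j) (I j)" by (rule homs_smul[OF module homs_id xR])
  define W where "W = V \<inter> {u \<in> carrier (I j). ?h u \<in> ann_coboundaries c I d j}"
  have W: "submodule W R (I j)" unfolding W_def
    by (rule submodule_inter[OF module V submodule_vimage[OF module module h coboundaries_submodule[OF c_sub]]])
  have VW: "noeth_mod R (I j) V W"
  proof (rule noeth_mod_extension[OF module module h coboundaries_submodule[OF c_sub] cocycles_submodule[OF c_sub]
        coboundaries_subset[OF c_sub] _ _ _ Q[OF c]])
    show "noeth_mod R (I j) {u \<in> V. ?h u \<in> ann_coboundaries c I d j} W"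
      by (rule noeth_mod_trivial) (use Vc in \<open>auto simp: W_def\<close>)
    show "?h u \<in> ann_coboundaries c I d j" if "u \<in> W" for u using that unfolding W_def by simp
    fix u assume u: "u \<in> V"
    note uc = Vc[OF u]
    have "r \<odot>\<^bsub>I j\<^esub> (x \<odot>\<^bsub>I j\<^esub> u) = \<zero>\<^bsub>I j\<^esub>" if r: "r \<in> c" for r
    proof -
      have "(r \<otimes>\<^bsub>R\<^esub> x) \<odot>\<^bsub>I j\<^esub> u = \<zero>\<^bsub>I j\<^esub>" using r u unfolding c_def V_def annihilated_def by auto
      then show ?thesis using r xR uc by (simp add: c_def Ij.smult_assoc1)
    qed
    moreover have "d j (x \<odot>\<^bsub>I j\<^esub> u) = \<zero>\<^bsub>I (Suc j)\<^esub>"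
      using homs_smult[OF d_hom xR uc] u x unfolding V_def ideal_cocycles_def annihilated_def by auto
    ultimately show "?h u \<in> ann_cocycles c I d j"
      using xR uc unfolding ann_cocycles_def annihilated_def by simp
  qed
  \<comment> \<open>If \<open>x u\<close> is a coboundary for \<open>c\<close>, it equals
    \<open>x y\<close> for some boundary \<open>y\<close> killed by \<open>b1\<close>. Then
    \<open>u - y\<close> is killed by \<open>b1\<close> and by \<open>x\<close>, hence by
    \<open>b\<close>.\<close>
  have W_cob: "u \<in> ideal_coboundaries b j" if u: "u \<in> W" for u
  proof -
    have uV: "u \<in> V" and xu: "x \<odot>\<^bsub>I j\<^esub> u \<in> ann_coboundaries c I d j" using u unfolding W_def by auto
    note uc = Vc[OF uV]
    have "\<exists>y\<in>boundaries j \<inter> annihilated b1 (I j). x \<odot>\<^bsub>I j\<^esub> u = x \<odot>\<^bsub>I j\<^esub> y"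
    proof (cases j)
      case 0
      then have "x \<odot>\<^bsub>I j\<^esub> u = x \<odot>\<^bsub>I j\<^esub> \<zero>\<^bsub>I j\<^esub>" using xu xR Ij.smult_r_null by (simp add: ann_coboundaries_def)
      then show ?thesis
        using submoduleD(2)[OF boundaries_submodule, of j] submoduleD(2)[OF annihilated_submodule[OF module sub(1)], of j]
        by blast
    next
      case (Suc k)
      then obtain w where w: "x \<odot>\<^bsub>I j\<^esub> u = d k w" "w \<in> annihilated c (I k)" using xu by (auto simp: ann_coboundaries_def)
      \<comment> \<open>Division by \<open>x\<close> inside the injective module \<open>I k\<close>
        replaces \<open>w\<close>, killed by \<open>c\<close>, by an element \<open>v\<close> killed
        by \<open>b1\<close>.\<close>
      obtain v where v: "v \<in> annihilated b1 (I k)" "x \<odot>\<^bsub>I k\<^esub> v = w"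
        using baer_divide[OF baer b1 xR] w(2) unfolding c_def by blast
      have vc: "v \<in> carrier (I k)" using v(1) by (simp add: annihilated_def)
      have "x \<odot>\<^bsub>I j\<^esub> u = x \<odot>\<^bsub>I j\<^esub> d k v" using homs_smult[OF d_hom xR vc] w v(2) Suc by simp
      moreover have "d k v \<in> boundaries j" using vc Suc by (simp add: boundaries_def)
      moreover have "d k v \<in> annihilated b1 (I j)" using annihilated_hom[OF module module d_hom sub(1) v(1)] Suc by simp
      ultimately show ?thesis by blast
    qed
    then obtain y where y: "y \<in> boundaries j" "y \<in> annihilated b1 (I j)" "x \<odot>\<^bsub>I j\<^esub> u = x \<odot>\<^bsub>I j\<^esub> y" by blast
    have yc: "y \<in> carrier (I j)" using y(2) by (simp add: annihilated_def)
    have z: "u \<ominus>\<^bsub>I j\<^esub> y \<in> annihilated b1 (I j)"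
      using submoduleD(6)[OF annihilated_submodule[OF module sub(1)]] uV y(2) unfolding V_def by blast
    have zc: "u \<ominus>\<^bsub>I j\<^esub> y \<in> carrier (I j)" using z by (simp add: annihilated_def)
    have xz: "x \<odot>\<^bsub>I j\<^esub> (u \<ominus>\<^bsub>I j\<^esub> y) = \<zero>\<^bsub>I j\<^esub>"
      using homs_minus[OF h module module uc yc] y(3) homs_eq_iff_diff[OF module, of "x \<odot>\<^bsub>I j\<^esub> u" j "x \<odot>\<^bsub>I j\<^esub> y"] xR uc yc by simp
    have "r \<odot>\<^bsub>I j\<^esub> (u \<ominus>\<^bsub>I j\<^esub> y) = \<zero>\<^bsub>I j\<^esub>" if r: "r \<in> b" for r
    proof -
      obtain p s where ps: "p \<in> b1" "s \<in> carrier R" "r = p \<oplus>\<^bsub>R\<^esub> s \<otimes>\<^bsub>R\<^esub> x" using gen[OF r] by blast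
      have "p \<odot>\<^bsub>I j\<^esub> (u \<ominus>\<^bsub>I j\<^esub> y) = \<zero>\<^bsub>I j\<^esub>" using z ps(1) by (simp add: annihilated_def)
      then show ?thesis using ps sub(1) zc xz xR by (auto simp: Ij.smult_l_distr Ij.smult_assoc1)
    qed
    then have "u \<ominus>\<^bsub>I j\<^esub> y \<in> annihilated b (I j)" using zc by (simp add: annihilated_def)
    moreover have "u = (u \<ominus>\<^bsub>I j\<^esub> y) \<oplus>\<^bsub>I j\<^esub> y" using uc yc by (simp add: a_minus_def Ij.M.a_assoc Ij.M.l_neg)
    ultimately show ?thesis unfolding ideal_coboundaries_def using y(1) by blast
  qed
  have V2: "submodule (ideal_cocycles b j \<inter> ideal_coboundaries b1 j) R (I j)"
    by (rule submodule_inter[OF module ideal_cocycles_submodule[OF b] ideal_coboundaries_submodule[OF b1]])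
  have n1: "noeth_mod R (I j) (ideal_cocycles b j \<inter> ideal_coboundaries b1 j) (ideal_coboundaries b j)"
  proof (rule noeth_mod_image[OF module module homs_id V W V2 ideal_coboundaries_submodule[OF b] _ W_cob _ VW])
    show "W \<subseteq> V" unfolding W_def by blast
    fix e assume e: "e \<in> ideal_cocycles b j \<inter> ideal_coboundaries b1 j"
    then obtain u y where uy: "e = u \<oplus>\<^bsub>I j\<^esub> y" "u \<in> annihilated b1 (I j)" "y \<in> boundaries j"
      unfolding ideal_coboundaries_def by blast
    have yB: "y \<in> ideal_coboundaries b j" using boundaries_ideal_coboundaries[OF b] uy(3) by blast
    have uc: "u \<in> carrier (I j)" and yc: "y \<in> carrier (I j)"
      using uy submoduleD(1)[OF boundaries_submodule] by (auto simp: annihilated_def)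
    have "e \<ominus>\<^bsub>I j\<^esub> y = u" using module_add_diff_cancel[OF module yc uc] uy(1) uc yc by (simp add: Ij.M.a_comm)
    then have "u \<in> ideal_cocycles b j"
      using submoduleD(6)[OF ideal_cocycles_submodule[OF b], of e j y] e yB ideal_coboundaries_subset[OF b] by auto
    then have "u \<in> V" unfolding V_def using uy(2) by simp
    moreover have "e \<ominus>\<^bsub>I j\<^esub> u = y" using module_add_diff_cancel[OF module uc yc] uy(1) by simp
    ultimately show "\<exists>u\<in>V. e \<ominus>\<^bsub>I j\<^esub> u \<in> ideal_coboundaries b j" using yB by auto
  qed
  show ?thesis
  proof (rule noeth_mod_extension[OF module module homs_id ideal_coboundaries_submodule[OF b1]
        ideal_cocycles_submodule[OF b1] ideal_coboundaries_subset[OF b1] _ _ _ IH])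
    show "e \<in> ideal_coboundaries b1 j" if "e \<in> ideal_coboundaries b j" for e
      using that ann_mono unfolding ideal_coboundaries_def by blast
    show "e \<in> ideal_cocycles b1 j" if "e \<in> ideal_cocycles b j" for e
      using that ann_mono unfolding ideal_cocycles_def by blast
    show "noeth_mod R (I j) {e \<in> ideal_cocycles b j. e \<in> ideal_coboundaries b1 j} (ideal_coboundaries b j)"
      using n1 by (simp add: Int_def)
  qed
qed

text \<open>Finiteness of \<open>M\<close> enters in degree 0: elements killed by \<open>d 0\<close>
  come from \<open>M\<close> through the augmentation, so \<open>Z\<close> is the image of a
  submodule of \<open>M\<close>.\<close>

lemma noeth_aug:
  assumes noeth: "noetherian_ring R" and fg: "finitely_generated R M"
    and Z: "submodule Z R (I 0)" and dZ: "\<And>z. z \<in> Z \<Longrightarrow> d 0 z = \<zero>\<^bsub>I (Suc 0)\<^esub>"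
  shows "noeth_mod R (I 0) Z {\<zero>\<^bsub>I 0\<^esub>}"
proof -
  let ?V = "{m \<in> carrier M. \<epsilon> m \<in> Z}"
  have V: "submodule ?V R M" by (rule submodule_vimage[OF M module aug_hom Z])
  show ?thesis
  proof (rule noeth_mod_image[OF M module aug_hom V submodule_zero_set[OF M] Z submodule_zero_set[OF module]])
    show "{\<zero>\<^bsub>M\<^esub>} \<subseteq> ?V" using submoduleD(2)[OF V] by simp
    show "noeth_mod R M ?V {\<zero>\<^bsub>M\<^esub>}" by (rule noeth_mod_mono[OF noeth_finitely_generated[OF noeth M fg]]) blast
    show "\<epsilon> m \<in> {\<zero>\<^bsub>I 0\<^esub>}" if "m \<in> {\<zero>\<^bsub>M\<^esub>}" for m using that homs_zero[OF aug_hom M module] by simp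
    fix z assume z: "z \<in> Z"
    note zc = submoduleD(1)[OF Z z]
    then obtain m where m: "m \<in> carrier M" "z = \<epsilon> m" using exact0 dZ[OF z] by auto
    then have "z \<ominus>\<^bsub>I 0\<^esub> \<epsilon> m = \<zero>\<^bsub>I 0\<^esub>" using homs_eq_iff_diff[OF module zc zc] by simp
    then show "\<exists>m\<in>?V. z \<ominus>\<^bsub>I 0\<^esub> \<epsilon> m \<in> {\<zero>\<^bsub>I 0\<^esub>}" using m z by (intro bexI[of _ m]) auto
  qed
qed

text \<open>The outer induction on the degree runs over all ideals at once, because the step passes
  to ideals \<open>(b1 : x)\<close>. The inner induction is on a finite generating set of
  \<open>b\<close>.\<close>

lemma noeth_cocycles:
  assumes noeth: "noetherian_ring R" and fg: "finitely_generated R M"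
    and b: "submodule b R (ring_as_module R)"
  shows "noeth_mod R (I j) (ann_cocycles b I d j) (ann_coboundaries b I d j)"
  using b
proof (induction j arbitrary: b)
  case 0
  have b: "b \<subseteq> carrier R" using submoduleD(1)[OF 0] by auto
  show ?case
    using noeth_aug[OF noeth fg cocycles_submodule[OF b, of 0]] by (simp add: ann_cocycles_def ann_coboundaries_def)
next
  case (Suc j)
  interpret Ij: module R "I j" by (rule module)
  note R = Ij.is_cring
  have mR: "module R (ring_as_module R)" by (rule module_ring_as_module[OF R])
  have ideal_sub: "ideal J R \<longleftrightarrow> submodule J R (ring_as_module R)" for J by (rule ideal_iff_submodule[OF R])
  obtain S where S: "S \<subseteq> carrier R" "finite S" "b = Idl\<^bsub>R\<^esub> S"
    using noetherian_ring.finetely_gen[OF noeth] Suc.prems ideal_sub by metis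
  have "noeth_mod R (I j) (ideal_cocycles (Idl\<^bsub>R\<^esub> S) j) (ideal_coboundaries (Idl\<^bsub>R\<^esub> S) j)"
    using S(2,1)
  proof (induction S)
    case empty
    \<comment> \<open>For the zero ideal every element is annihilated, so all cocycles are
      coboundaries.\<close>
    have z: "Idl\<^bsub>R\<^esub> {} \<subseteq> {\<zero>\<^bsub>R\<^esub>}"
      by (rule Ij.R.genideal_minimal) (auto simp: Ij.R.zeroideal)
    have s: "submodule (Idl\<^bsub>R\<^esub> {}) R (ring_as_module R)" using Ij.R.genideal_ideal[of "{}"] ideal_sub by simp
    have "carrier (I j) \<subseteq> annihilated (Idl\<^bsub>R\<^esub> {}) (I j)" using z by (auto simp: annihilated_def)
    then show ?case
      using ann_ideal_coboundaries[OF s, of j] by (intro noeth_mod_trivial) (auto simp: ideal_cocycles_def)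
  next
    case (insert x S)
    let ?b1 = "Idl\<^bsub>R\<^esub> S" and ?b = "Idl\<^bsub>R\<^esub> (insert x S)"
    have xS: "insert x S \<subseteq> carrier R" "S \<subseteq> carrier R" "x \<in> carrier R" using insert by auto
    have b1: "submodule ?b1 R (ring_as_module R)" and b: "submodule ?b R (ring_as_module R)"
      using Ij.R.genideal_ideal[OF xS(1)] Ij.R.genideal_ideal[OF xS(2)] ideal_sub by auto
    have b_self: "insert x S \<subseteq> ?b" and b1_self: "S \<subseteq> ?b1"
      using Ij.R.genideal_self[OF xS(1)] Ij.R.genideal_self[OF xS(2)] by auto
    have xc: "x \<in> carrier (ring_as_module R)" using xS by simp
    define X where "X = add_cyclic R (ring_as_module R) ?b1 x"
    have X: "submodule X R (ring_as_module R)" "?b1 \<subseteq> X" "x \<in> X"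
      unfolding X_def by (rule add_cyclic[OF mR b1 xc])+
    then have bX: "?b \<subseteq> X" using Ij.R.genideal_minimal[of X "insert x S"] b1_self ideal_sub by auto
    show ?case
    proof (rule noeth_ideal_step[OF b1 b _ _ _ _ Suc.IH])
      show "?b1 \<subseteq> ?b" using Ij.R.genideal_minimal[of ?b S] b b_self ideal_sub by simp
      show "x \<in> ?b" using b_self by simp
      show "\<exists>p\<in>?b1. \<exists>r\<in>carrier R. y = p \<oplus>\<^bsub>R\<^esub> r \<otimes>\<^bsub>R\<^esub> x" if "y \<in> ?b" for y
      proof -
        have "y \<in> X" using bX that by blast
        then show ?thesis unfolding X_def add_cyclic_def by auto
      qed
      show "noeth_mod R (I j) (ideal_cocycles ?b1 j) (ideal_coboundaries ?b1 j)" using insert by simp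
    qed
  qed
  then show ?case using noeth_cocycles_step[OF Suc.prems] S(3) by simp
qed

end

lemma finitely_generated_Ext:
  assumes noeth: "noetherian_ring R" and ideal: "ideal \<aa> R" and N: "module R N" and fg: "finitely_generated R N"
  shows "finitely_generated R (Ext R i (residue_module R \<aa>) N)"
proof -
  obtain I d \<epsilon> where Id: "inj_res R N = (I, d)" and I: "inj_resolution R N I d \<epsilon>" by (rule inj_res_resolution[OF N])
  interpret I: inj_resolution R N I d \<epsilon> by (rule I)
  interpret N: module R N by (rule N)
  have sa: "submodule \<aa> R (ring_as_module R)" using ideal ideal_iff_submodule[OF N.is_cring] by simp
  have \<aa>: "\<aa> \<subseteq> carrier R" using submoduleD(1)[OF sa] by auto
  have "finitely_generated R (ann_cohomology \<aa> I d i)" unfolding ann_cohomology_def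
    by (rule finitely_generated_quotient[OF I.module I.cocycles_submodule[OF \<aa>] I.coboundaries_submodule[OF \<aa>]
          I.coboundaries_subset[OF \<aa>] I.noeth_cocycles[OF noeth fg sa]])
  then show ?thesis
    using finitely_generated_iso[OF I.module_ann_cohomology[OF \<aa>] Ext_iso_ann[OF ideal Id I]] by blast
qed

section \<open>Local cohomology\<close>

lemma baer_prod:
  assumes E: "baer R E" and F: "baer R F"
  shows "baer R (prod_module E F)"
  unfolding baer_def
proof (intro conjI allI impI module_prod[OF baerD1[OF E] baerD1[OF F]], elim conjE)
  fix J \<phi> assume J: "submodule J R (ring_as_module R)"
    and \<phi>: "\<phi> \<in> module_homs R ((ring_as_module R)\<lparr>carrier := J\<rparr>) (prod_module E F)"
  obtain e where e: "e \<in> carrier E" "\<And>j. j \<in> J \<Longrightarrow> fst (\<phi> j) = j \<odot>\<^bsub>E\<^esub> e"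
    using baerD2[OF E J homs_comp[OF \<phi> fst_hom]] by blast
  obtain f where f: "f \<in> carrier F" "\<And>j. j \<in> J \<Longrightarrow> snd (\<phi> j) = j \<odot>\<^bsub>F\<^esub> f"
    using baerD2[OF F J homs_comp[OF \<phi> snd_hom]] by blast
  show "\<exists>x\<in>carrier (prod_module E F). \<forall>j\<in>J. \<phi> j = j \<odot>\<^bsub>prod_module E F\<^esub> x"
    by (rule bexI[of _ "(e, f)"]) (use e f in \<open>auto intro!: prod_eqI\<close>)
qed

lemma baer_zero:
  assumes "module R E"
  shows "baer R (E\<lparr>carrier := {\<zero>\<^bsub>E\<^esub>}\<rparr>)"
  unfolding baer_def
proof (intro conjI allI impI restrict_module[OF submodule_zero_set[OF assms] assms], elim conjE)
  interpret E: module R E by fact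
  fix J \<phi> assume J: "submodule J R (ring_as_module R)"
    and \<phi>: "\<phi> \<in> module_homs R ((ring_as_module R)\<lparr>carrier := J\<rparr>) (E\<lparr>carrier := {\<zero>\<^bsub>E\<^esub>}\<rparr>)"
  show "\<exists>e\<in>carrier (E\<lparr>carrier := {\<zero>\<^bsub>E\<^esub>}\<rparr>). \<forall>j\<in>J. \<phi> j = j \<odot>\<^bsub>E\<lparr>carrier := {\<zero>\<^bsub>E\<^esub>}\<rparr>\<^esub> e"
    using homs_closed[OF \<phi>] submoduleD(1)[OF J] by auto
qed

lemma torsion_reflect:
  assumes ideal: "ideal \<aa> R" and M: "module R M" and N: "module R N" and f: "f \<in> module_homs R M N"
    and inj: "\<And>x. x \<in> carrier M \<Longrightarrow> f x = \<zero>\<^bsub>N\<^esub> \<Longrightarrow> x = \<zero>\<^bsub>M\<^esub>"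
    and x: "x \<in> carrier M" "f x \<in> torsion_submodule R \<aa> N"
  shows "x \<in> torsion_submodule R \<aa> M"
proof -
  interpret M: module R M by fact
  from x(2) obtain n :: nat where n: "\<forall>r\<in>\<aa> [^]\<^bsub>ideals_set R\<^esub> n. r \<odot>\<^bsub>N\<^esub> f x = \<zero>\<^bsub>N\<^esub>"
    unfolding torsion_submodule_def by auto
  have "r \<odot>\<^bsub>M\<^esub> x = \<zero>\<^bsub>M\<^esub>" if r: "r \<in> \<aa> [^]\<^bsub>ideals_set R\<^esub> n" for r
  proof -
    have rc: "r \<in> carrier R" using ideal.Icarr[OF ideal_power[OF M.R.ring_axioms ideal] r] .
    then have "f (r \<odot>\<^bsub>M\<^esub> x) = \<zero>\<^bsub>N\<^esub>" using n r homs_smult[OF f rc x(1)] by simp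
    then show ?thesis using inj rc x(1) by simp
  qed
  then show ?thesis unfolding torsion_submodule_def using x(1) by blast
qed

section \<open>The torsion subcomplex of an injective resolution\<close>

locale torsion_resolution = inj_resolution R M I d \<epsilon>
  for R :: "('a, 'r) ring_scheme" and M :: "('a, 'm, 'c) module_scheme"
    and I :: "nat \<Rightarrow> ('a, 'e) module" and d and \<epsilon> +
  fixes \<aa> :: "'a set"
  assumes noeth: "noetherian_ring R" and ideal: "ideal \<aa> R"
begin

abbreviation "T n \<equiv> torsion_submodule R \<aa> (I n)"

definition "tors_cocycles i = {x \<in> T i. d i x = \<zero>\<^bsub>I (Suc i)\<^esub>}"

definition "tors_coboundaries i = (case i of 0 \<Rightarrow> {\<zero>\<^bsub>I 0\<^esub>} | Suc j \<Rightarrow> d j ` T j)"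

text \<open>For the resolution chosen by \<open>inj_res\<close> this is
  \<open>local_cohomology\<close> by unfolding.\<close>

definition "tors_cohomology i = quotient_module ((I i)\<lparr>carrier := tors_cocycles i\<rparr>) (tors_coboundaries i)"

lemma T: "submodule (T n) R (I n)"
  by (rule torsion_submodule[OF ideal module])

lemma T_carrier: "x \<in> T n \<Longrightarrow> x \<in> carrier (I n)"
  by (rule submoduleD(1)[OF T])

lemma d_T: "x \<in> T n \<Longrightarrow> d n x \<in> T (Suc n)"
  by (rule torsion_hom[OF ideal module module d_hom])

lemma tors_cocycles_submodule: "submodule (tors_cocycles i) R (I i)"
proof -
  have "tors_cocycles i = T i \<inter> {x \<in> carrier (I i). d i x \<in> {\<zero>\<^bsub>I (Suc i)\<^esub>}}"
    unfolding tors_cocycles_def using T_carrier by auto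
  then show ?thesis
    using submodule_inter[OF module T submodule_vimage[OF module module d_hom submodule_zero_set[OF module]]] by simp
qed

lemma tors_coboundaries_submodule: "submodule (tors_coboundaries i) R (I i)"
  unfolding tors_coboundaries_def
  using submodule_zero_set[OF module] submodule_image[OF module module d_hom T]
  by (auto split: nat.split)

lemma tors_coboundaries_subset: "tors_coboundaries i \<subseteq> tors_cocycles i"
proof (cases i)
  case 0
  then show ?thesis using submoduleD(2)[OF tors_cocycles_submodule[of 0]] by (simp add: tors_coboundaries_def)
next
  case (Suc j)
  then show ?thesis
    using d_T d_d[OF T_carrier] by (auto simp: tors_coboundaries_def tors_cocycles_def)
qed

lemma module_tors_cocycles: "module R ((I i)\<lparr>carrier := tors_cocycles i\<rparr>)"
  by (rule restrict_module[OF tors_cocycles_submodule module])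

lemma tors_coboundaries_restrict: "submodule (tors_coboundaries i) R ((I i)\<lparr>carrier := tors_cocycles i\<rparr>)"
  by (rule submodule_restrict[OF module tors_cocycles_submodule tors_coboundaries_submodule tors_coboundaries_subset])

lemma module_tors_cohomology: "module R (tors_cohomology i)"
  unfolding tors_cohomology_def by (rule module_quotient[OF module_tors_cocycles tors_coboundaries_restrict])

definition "cls i x = tors_coboundaries i +>\<^bsub>(I i)\<lparr>carrier := tors_cocycles i\<rparr>\<^esub> x"

lemma cls_hom: "cls i \<in> module_homs R ((I i)\<lparr>carrier := tors_cocycles i\<rparr>) (tors_cohomology i)"
  using proj_hom[OF module_tors_cocycles tors_coboundaries_restrict]
  unfolding cls_def[abs_def] tors_cohomology_def .

lemma carrier_tors_cohomology: "carrier (tors_cohomology i) = cls i ` tors_cocycles i"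
  using carrier_quotient[OF module_tors_cocycles tors_coboundaries_restrict]
  unfolding cls_def[abs_def] tors_cohomology_def by simp

lemma cls_zero_iff: "x \<in> tors_cocycles i \<Longrightarrow> cls i x = \<zero>\<^bsub>tors_cohomology i\<^esub> \<longleftrightarrow> x \<in> tors_coboundaries i"
  using proj_zero_iff[OF module_tors_cocycles tors_coboundaries_restrict]
  unfolding cls_def tors_cohomology_def by simp

lemma cls_add:
  "x \<in> tors_cocycles i \<Longrightarrow> y \<in> tors_cocycles i \<Longrightarrow> cls i (x \<oplus>\<^bsub>I i\<^esub> y) = cls i x \<oplus>\<^bsub>tors_cohomology i\<^esub> cls i y"
  using homs_add[OF cls_hom] by simp

lemma zero_tors_cohomologyD:
  assumes "zero_module (tors_cohomology i)" "x \<in> tors_cocycles i"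
  shows "x \<in> tors_coboundaries i"
  using assms cls_zero_iff[of x i] carrier_tors_cohomology[of i] unfolding zero_module_def by blast

text \<open>Every class has a torsion representative. The statement is the hypothesis of
  \<open>Supp_torsion\<close>.\<close>

lemma tors_cohomology_power:
  assumes "h \<in> carrier (tors_cohomology i)" "r \<in> \<aa>"
  shows "\<exists>n::nat. (r [^]\<^bsub>R\<^esub> n) \<odot>\<^bsub>tors_cohomology i\<^esub> h = \<zero>\<^bsub>tors_cohomology i\<^esub>"
proof -
  interpret Ii: module R "I i" by (rule module)
  obtain x where x: "h = cls i x" "x \<in> tors_cocycles i" using assms(1) carrier_tors_cohomology by auto
  then obtain n :: nat where n: "(r [^]\<^bsub>R\<^esub> n) \<odot>\<^bsub>I i\<^esub> x = \<zero>\<^bsub>I i\<^esub>"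
    using torsion_power[OF ideal module _ assms(2)] unfolding tors_cocycles_def by blast
  have "r [^]\<^bsub>R\<^esub> n \<in> carrier R" using ideal.Icarr[OF ideal assms(2)] by simp
  then have "(r [^]\<^bsub>R\<^esub> n) \<odot>\<^bsub>tors_cohomology i\<^esub> h = cls i \<zero>\<^bsub>I i\<^esub>"
    using homs_smult[OF cls_hom, of "r [^]\<^bsub>R\<^esub> n" x i] x n by simp
  also have "\<dots> = \<zero>\<^bsub>tors_cohomology i\<^esub>"
    using cls_zero_iff[OF submoduleD(2)[OF tors_cocycles_submodule]] submoduleD(2)[OF tors_coboundaries_submodule] by simp
  finally show ?thesis by blast
qed

lemma finitely_generated_tors_cohomology_0:
  assumes fg: "finitely_generated R M"
  shows "finitely_generated R (tors_cohomology 0)"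
proof -
  have "noeth_mod R (I 0) (tors_cocycles 0) (tors_coboundaries 0)"
    using noeth_aug[OF noeth fg tors_cocycles_submodule[of 0]]
    by (simp add: tors_cocycles_def tors_coboundaries_def)
  then show ?thesis unfolding tors_cohomology_def
    by (rule finitely_generated_quotient[OF module tors_cocycles_submodule tors_coboundaries_submodule
          tors_coboundaries_subset])
qed

end

text \<open>\<open>\<rho> n\<close> is a retraction of \<open>I n\<close> onto its torsion submodule, which exists because the latter is
  injective; \<open>tfree n\<close> is the resulting torsion-free complement.\<close>

locale split_torsion_resolution = torsion_resolution R M I d \<epsilon> \<aa>
  for R :: "('a, 'r) ring_scheme" and M :: "('a, 'm, 'c) module_scheme"
    and I :: "nat \<Rightarrow> ('a, 'e) module" and d and \<epsilon> and \<aa> +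
  fixes \<rho> :: "nat \<Rightarrow> 'e \<Rightarrow> 'e"
  assumes \<rho>_hom: "\<rho> n \<in> module_homs R (I n) (I n)"
    and \<rho>_T: "x \<in> carrier (I n) \<Longrightarrow> \<rho> n x \<in> T n"
    and \<rho>_id: "x \<in> T n \<Longrightarrow> \<rho> n x = x"
    and vanish: "zero_module (tors_cohomology (Suc (Suc n)))"
begin

definition "proj n x = x \<ominus>\<^bsub>I n\<^esub> \<rho> n x"

definition "tfree n = (I n)\<lparr>carrier := {x \<in> carrier (I n). \<rho> n x = \<zero>\<^bsub>I n\<^esub>}\<rparr>"

text \<open>The differential \<open>d\<close> may leave the complements. Composed with the
  projection it makes them a copy of the quotient complex of \<open>I\<close> by its
  torsion.\<close>

definition "df n x = proj (Suc n) (d n x)"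

lemma tfree_simps:
  "carrier (tfree n) = {x \<in> carrier (I n). \<rho> n x = \<zero>\<^bsub>I n\<^esub>}" "\<zero>\<^bsub>tfree n\<^esub> = \<zero>\<^bsub>I n\<^esub>"
  "x \<oplus>\<^bsub>tfree n\<^esub> y = x \<oplus>\<^bsub>I n\<^esub> y" "r \<odot>\<^bsub>tfree n\<^esub> x = r \<odot>\<^bsub>I n\<^esub> x"
  unfolding tfree_def by simp_all

lemma tfree_submodule: "submodule (carrier (tfree n)) R (I n)"
  unfolding tfree_simps
  using submodule_vimage[OF module module \<rho>_hom submodule_zero_set[OF module]] by simp

lemma tfree_eq: "tfree n = (I n)\<lparr>carrier := carrier (tfree n)\<rparr>"
  unfolding tfree_def by simp

lemma module_tfree: "module R (tfree n)"
  by (subst tfree_eq) (rule restrict_module[OF tfree_submodule module])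

lemma proj_I: "proj n \<in> module_homs R (I n) (I n)"
  unfolding proj_def[abs_def] by (rule homs_diff[OF module homs_id \<rho>_hom])

lemma proj_tfree: "x \<in> carrier (I n) \<Longrightarrow> proj n x \<in> carrier (tfree n)"
  using homs_minus[OF \<rho>_hom module module, of x n "\<rho> n x"] \<rho>_id[OF \<rho>_T] homs_closed[OF \<rho>_hom]
    homs_eq_iff_diff[OF module] homs_closed[OF proj_I]
  by (simp add: tfree_simps proj_def)

lemma proj_into: "proj n \<in> module_homs R (I n) (tfree n)"
  by (subst tfree_eq) (rule homs_into[OF proj_I proj_tfree])

lemma proj_T: "x \<in> T n \<Longrightarrow> proj n x = \<zero>\<^bsub>I n\<^esub>"
  using homs_eq_iff_diff[OF module] T_carrier \<rho>_id by (simp add: proj_def)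

lemma proj_zeroD: "x \<in> carrier (I n) \<Longrightarrow> proj n x = \<zero>\<^bsub>I n\<^esub> \<Longrightarrow> x \<in> T n"
  using homs_eq_iff_diff[OF module, of x n "\<rho> n x"] homs_closed[OF \<rho>_hom] \<rho>_T[of x n] by (simp add: proj_def)

lemma proj_id: "x \<in> carrier (tfree n) \<Longrightarrow> proj n x = x"
proof -
  interpret In: module R "I n" by (rule module)
  show "x \<in> carrier (tfree n) \<Longrightarrow> ?thesis"
    unfolding proj_def tfree_simps a_minus_def by (simp add: In.M.r_zero)
qed

lemma tfree_incl: "(\<lambda>x. x) \<in> module_homs R (tfree n) (I n)"
  by (subst tfree_eq) (rule homs_restrict[OF homs_id], use submoduleD(1)[OF tfree_submodule] in blast)

lemma tfree_carrier: "x \<in> carrier (tfree n) \<Longrightarrow> x \<in> carrier (I n)"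
  by (simp add: tfree_simps)

lemma baer_tfree: "baer R (tfree n)"
  by (rule baer_retract[OF baer module_tfree proj_into tfree_incl]) (simp add: proj_id)

lemma tfree_torsion: "x \<in> carrier (tfree n) \<Longrightarrow> x \<in> T n \<Longrightarrow> x = \<zero>\<^bsub>I n\<^esub>"
  using \<rho>_id by (simp add: tfree_simps)

lemma annihilated_tfree: "annihilated \<aa> (tfree n) = {\<zero>\<^bsub>I n\<^esub>}"
proof
  show "annihilated \<aa> (tfree n) \<subseteq> {\<zero>\<^bsub>I n\<^esub>}"
  proof
    fix x assume "x \<in> annihilated \<aa> (tfree n)"
    then have x: "x \<in> carrier (tfree n)" "\<And>r. r \<in> \<aa> \<Longrightarrow> r \<odot>\<^bsub>I n\<^esub> x = \<zero>\<^bsub>I n\<^esub>"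
      by (auto simp: annihilated_def tfree_simps)
    then have "x \<in> T n" using torsionI_annihilated[OF ideal module tfree_carrier[OF x(1)]] by blast
    then show "x \<in> {\<zero>\<^bsub>I n\<^esub>}" using tfree_torsion x(1) by blast
  qed
  interpret In: module R "I n" by (rule module)
  show "{\<zero>\<^bsub>I n\<^esub>} \<subseteq> annihilated \<aa> (tfree n)"
    using submoduleD(2)[OF tfree_submodule, of n] ideal.Icarr[OF ideal] by (auto simp: annihilated_def tfree_simps)
qed

lemma df_hom: "df n \<in> module_homs R (tfree n) (tfree (Suc n))"
  unfolding df_def[abs_def] by (rule homs_comp[OF homs_comp[OF tfree_incl d_hom] proj_into])

lemma df_zero_iff: "x \<in> carrier (tfree n) \<Longrightarrow> df n x = \<zero>\<^bsub>I (Suc n)\<^esub> \<longleftrightarrow> d n x \<in> T (Suc n)"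
  unfolding df_def using proj_T proj_zeroD homs_closed[OF d_hom tfree_carrier] by blast

text \<open>Projecting changes \<open>z\<close> by the torsion element \<open>\<rho> n z\<close>,
  whose differential is torsion again and is killed by the next projection. So the projections form
  a chain map.\<close>

lemma df_proj:
  assumes z: "z \<in> carrier (I n)"
  shows "df n (proj n z) = proj (Suc n) (d n z)"
proof -
  interpret In: module R "I (Suc n)" by (rule module)
  have c: "\<rho> n z \<in> carrier (I n)" using homs_closed[OF \<rho>_hom z] .
  have "df n (proj n z) = proj (Suc n) (d n z) \<ominus>\<^bsub>I (Suc n)\<^esub> proj (Suc n) (d n (\<rho> n z))"
    unfolding df_def using homs_minus[OF homs_comp[OF d_hom proj_I] module module z c] by (simp add: proj_def)
  also have "proj (Suc n) (d n (\<rho> n z)) = \<zero>\<^bsub>I (Suc n)\<^esub>" by (rule proj_T[OF d_T[OF \<rho>_T[OF z]]])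
  finally show ?thesis using homs_closed[OF proj_I homs_closed[OF d_hom z]] by (simp add: a_minus_def)
qed

definition "D = {x \<in> carrier (tfree 0). df 0 x = \<zero>\<^bsub>I (Suc 0)\<^esub>}"

lemma D_submodule: "submodule D R (tfree 0)"
  using submodule_vimage[OF module_tfree module_tfree df_hom submodule_zero_set[OF module_tfree], of 0]
  unfolding D_def by (simp add: tfree_simps(2))

lemma df_df:
  assumes x: "x \<in> carrier (tfree n)"
  shows "df (Suc n) (df n x) = \<zero>\<^bsub>I (Suc (Suc n))\<^esub>"
proof -
  have c: "d n x \<in> carrier (I (Suc n))" using homs_closed[OF d_hom tfree_carrier[OF x]] .
  have "df (Suc n) (proj (Suc n) (d n x)) = proj (Suc (Suc n)) (d (Suc n) (d n x))" by (rule df_proj[OF c])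
  also have "\<dots> = \<zero>\<^bsub>I (Suc (Suc n))\<^esub>" using d_d[OF tfree_carrier[OF x]] homs_zero[OF proj_I module module] by simp
  finally show ?thesis by (simp add: df_def)
qed

text \<open>The element \<open>d x\<close> is a torsion cocycle of degree \<open>n + 2\<close>,
  hence \<open>d y\<close> for some torsion \<open>y\<close> by vanishing. Exactness of
  \<open>I\<close> gives \<open>x - y = d z\<close>, and the projection of \<open>z\<close> is the
  preimage sought.\<close>

lemma df_exact:
  assumes x: "x \<in> carrier (tfree (Suc n))" and dx: "df (Suc n) x = \<zero>\<^bsub>I (Suc (Suc n))\<^esub>"
  shows "x \<in> df n ` carrier (tfree n)"
proof -
  interpret In: module R "I (Suc n)" by (rule module)
  note xc = tfree_carrier[OF x]
  have "d (Suc n) x \<in> tors_cocycles (Suc (Suc n))"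
    using df_zero_iff[OF x] dx d_d[OF xc] by (simp add: tors_cocycles_def)
  then have "d (Suc n) x \<in> tors_coboundaries (Suc (Suc n))" by (rule zero_tors_cohomologyD[OF vanish])
  then obtain y where y: "y \<in> T (Suc n)" "d (Suc n) x = d (Suc n) y" by (auto simp: tors_coboundaries_def)
  note yc = T_carrier[OF y(1)]
  have "d (Suc n) (x \<ominus>\<^bsub>I (Suc n)\<^esub> y) = \<zero>\<^bsub>I (Suc (Suc n))\<^esub>"
    using homs_minus[OF d_hom module module xc yc] y(2) homs_eq_iff_diff[OF module] homs_closed[OF d_hom yc] by simp
  then obtain z where z: "z \<in> carrier (I n)" "x \<ominus>\<^bsub>I (Suc n)\<^esub> y = d n z" using exact xc yc by auto
  have "df n (proj n z) = proj (Suc n) (x \<ominus>\<^bsub>I (Suc n)\<^esub> y)" using df_proj[OF z(1)] z(2) by simp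
  also have "\<dots> = x" using homs_minus[OF proj_I module module xc yc] proj_id[OF x] proj_T[OF y(1)] xc
    by (simp add: a_minus_def)
  finally show ?thesis using proj_tfree[OF z(1)] by (metis imageI)
qed

abbreviation "Dm \<equiv> (tfree 0)\<lparr>carrier := D\<rparr>"

lemma module_D: "module R Dm"
  by (rule restrict_module[OF D_submodule module_tfree])

lemma tfree_resolution: "inj_resolution R Dm tfree df (\<lambda>x. x)"
proof (rule inj_resolution.intro[OF module_D])
  have Dsub: "D \<subseteq> carrier (tfree 0)" unfolding D_def by blast
  have "df n ` carrier (tfree n) = a_kernel (tfree (Suc n)) (tfree (Suc (Suc n))) (df (Suc n))" for n
    unfolding a_kernel_def' tfree_simps(2) using df_exact df_df homs_closed[OF df_hom] by blast
  moreover have "D = a_kernel (tfree 0) (tfree (Suc 0)) (df 0)" unfolding a_kernel_def' D_def by (simp add: tfree_simps(2))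
  ultimately show "injective_resolution R Dm tfree df (\<lambda>x. x)"
    unfolding injective_resolution_def injective_module_iff_baer
    using baer_tfree df_hom homs_restrict[OF homs_id Dsub] by simp
qed

text \<open>The connecting map in degree 0 for the torsion subcomplex of \<open>I\<close> and its
  quotient complex. An element of \<open>D\<close> is its own lift to \<open>I 0\<close>.\<close>

definition "conn x = cls (Suc 0) (d 0 x)"

lemma d_D: "x \<in> D \<Longrightarrow> d 0 x \<in> tors_cocycles (Suc 0)"
  using df_zero_iff[of x 0] d_d[OF tfree_carrier, of x 0] by (simp add: D_def tors_cocycles_def)

lemma conn_hom: "conn \<in> module_homs R Dm (tors_cohomology (Suc 0))"
proof -
  have "d 0 \<in> module_homs R Dm (I (Suc 0))"
    using homs_restrict[OF homs_comp[OF tfree_incl[of 0] d_hom[of 0]], of D] by (auto simp: D_def)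
  then have "d 0 \<in> module_homs R Dm ((I (Suc 0))\<lparr>carrier := tors_cocycles (Suc 0)\<rparr>)"
    by (rule homs_into) (simp add: d_D)
  then show ?thesis unfolding conn_def[abs_def] by (rule homs_comp[OF _ cls_hom])
qed

text \<open>Exactness of \<open>I\<close> in degree 1 writes a torsion cocycle as
  \<open>z = d x\<close>. Replacing \<open>x\<close> by its projection changes \<open>z\<close> by
  the coboundary \<open>d (\<rho> x)\<close> only.\<close>

lemma conn_surj: "conn ` D = carrier (tors_cohomology (Suc 0))"
proof
  show "conn ` D \<subseteq> carrier (tors_cohomology (Suc 0))" using homs_closed[OF conn_hom] by auto
  show "carrier (tors_cohomology (Suc 0)) \<subseteq> conn ` D"
  proof
    fix h assume "h \<in> carrier (tors_cohomology (Suc 0))"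
    then obtain z where z: "z \<in> tors_cocycles (Suc 0)" "h = cls (Suc 0) z" unfolding carrier_tors_cohomology by auto
    interpret I1: module R "I (Suc 0)" by (rule module)
    have zT: "z \<in> T (Suc 0)" and zc: "z \<in> carrier (I (Suc 0))" "d (Suc 0) z = \<zero>\<^bsub>I (Suc 1)\<^esub>"
      using z(1) T_carrier by (auto simp: tors_cocycles_def)
    then obtain x where x: "x \<in> carrier (I 0)" "z = d 0 x" using exact[of z 0] by auto
    have \<rho>x: "\<rho> 0 x \<in> T 0" by (rule \<rho>_T[OF x(1)])
    have px: "proj 0 x \<in> D" unfolding D_def using df_proj[OF x(1)] proj_T[of z "Suc 0"] zT x(2) proj_tfree[OF x(1)] by simp
    have eq: "d 0 (proj 0 x) = z \<ominus>\<^bsub>I (Suc 0)\<^esub> d 0 (\<rho> 0 x)"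
      unfolding proj_def using homs_minus[OF d_hom module module x(1) T_carrier[OF \<rho>x]] x(2) by simp
    have dr: "d 0 (\<rho> 0 x) \<in> tors_coboundaries (Suc 0)" using \<rho>x by (simp add: tors_coboundaries_def)
    have drZ: "d 0 (\<rho> 0 x) \<in> tors_cocycles (Suc 0)" using dr tors_coboundaries_subset by blast
    have drc: "d 0 (\<rho> 0 x) \<in> carrier (I (Suc 0))" using submoduleD(1)[OF tors_cocycles_submodule drZ] .
    have "z = d 0 (proj 0 x) \<oplus>\<^bsub>I (Suc 0)\<^esub> d 0 (\<rho> 0 x)"
      unfolding eq using zc(1) drc by (simp add: a_minus_def I1.M.a_assoc I1.M.l_neg)
    then have "h = conn (proj 0 x) \<oplus>\<^bsub>tors_cohomology (Suc 0)\<^esub> cls (Suc 0) (d 0 (\<rho> 0 x))"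
      using cls_add[OF d_D[OF px] drZ] z(2) unfolding conn_def by simp
    also have "cls (Suc 0) (d 0 (\<rho> 0 x)) = \<zero>\<^bsub>tors_cohomology (Suc 0)\<^esub>" using cls_zero_iff[OF drZ] dr by simp
    also have "conn (proj 0 x) \<oplus>\<^bsub>tors_cohomology (Suc 0)\<^esub> \<zero>\<^bsub>tors_cohomology (Suc 0)\<^esub> = conn (proj 0 x)"
    proof -
      interpret H: module R "tors_cohomology (Suc 0)" by (rule module_tors_cohomology)
      show ?thesis using homs_closed[OF conn_hom, of "proj 0 x"] px by simp
    qed
    finally show "h \<in> conn ` D" using px by blast
  qed
qed

text \<open>If \<open>d x = d y\<close> with \<open>y\<close> torsion, then \<open>x - y\<close>
  comes from \<open>M\<close> and its projection is \<open>x\<close>. Conversely \<open>d\<close>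
  kills the augmentation, so the projection of such an element has the differential of a torsion
  element.\<close>

lemma conn_zero_iff:
  assumes x: "x \<in> D"
  shows "conn x = \<zero>\<^bsub>tors_cohomology (Suc 0)\<^esub> \<longleftrightarrow> (\<exists>m\<in>carrier M. x = proj 0 (\<epsilon> m))"
proof
  interpret I0: module R "I 0" by (rule module)
  have xt: "x \<in> carrier (tfree 0)" using x by (simp add: D_def)
  note xc = tfree_carrier[OF xt]
  assume "conn x = \<zero>\<^bsub>tors_cohomology (Suc 0)\<^esub>"
  then have "d 0 x \<in> tors_coboundaries (Suc 0)" using cls_zero_iff[OF d_D[OF x]] by (simp add: conn_def)
  then obtain y where y: "y \<in> T 0" "d 0 x = d 0 y" by (auto simp: tors_coboundaries_def)
  note yc = T_carrier[OF y(1)]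
  have "d 0 (x \<ominus>\<^bsub>I 0\<^esub> y) = \<zero>\<^bsub>I (Suc 0)\<^esub>"
    using homs_minus[OF d_hom module module xc yc] y(2) homs_eq_iff_diff[OF module] homs_closed[OF d_hom yc] by simp
  then obtain m where m: "m \<in> carrier M" "x \<ominus>\<^bsub>I 0\<^esub> y = \<epsilon> m" using exact0 xc yc by auto
  have "proj 0 (x \<ominus>\<^bsub>I 0\<^esub> y) = x"
    using homs_minus[OF proj_I module module xc yc] proj_id[OF xt] proj_T[OF y(1)] xc by (simp add: a_minus_def)
  then show "\<exists>m\<in>carrier M. x = proj 0 (\<epsilon> m)" using m by metis
next
  assume "\<exists>m\<in>carrier M. x = proj 0 (\<epsilon> m)"
  then obtain m where m: "m \<in> carrier M" "x = proj 0 (\<epsilon> m)" by blast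
  interpret I1: module R "I (Suc 0)" by (rule module)
  have mc: "\<epsilon> m \<in> carrier (I 0)" by (rule homs_closed[OF aug_hom m(1)])
  have \<rho>m: "\<rho> 0 (\<epsilon> m) \<in> T 0" by (rule \<rho>_T[OF mc])
  have "d 0 x = d 0 (\<epsilon> m) \<ominus>\<^bsub>I (Suc 0)\<^esub> d 0 (\<rho> 0 (\<epsilon> m))"
    unfolding m(2) proj_def using homs_minus[OF d_hom module module mc T_carrier[OF \<rho>m]] by simp
  moreover have "d 0 (\<rho> 0 (\<epsilon> m)) \<in> tors_coboundaries (Suc 0)" using \<rho>m by (simp add: tors_coboundaries_def)
  moreover have "d 0 (\<epsilon> m) \<in> tors_coboundaries (Suc 0)"
    using d_aug[OF m(1)] submoduleD(2)[OF tors_coboundaries_submodule, of "Suc 0"] by simp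
  ultimately have "d 0 x \<in> tors_coboundaries (Suc 0)" using submoduleD(6)[OF tors_coboundaries_submodule] by metis
  then show "conn x = \<zero>\<^bsub>tors_cohomology (Suc 0)\<^esub>" using cls_zero_iff[OF d_D[OF x]] by (simp add: conn_def)
qed

lemma proj_aug_D: "m \<in> carrier M \<Longrightarrow> proj 0 (\<epsilon> m) \<in> D"
  unfolding D_def using homs_closed[OF aug_hom] proj_tfree df_proj d_aug homs_zero[OF proj_I module module] by simp

text \<open>With \<open>conn_zero_iff\<close> this identifies the kernel of \<open>conn\<close> with
  \<open>M/\<Gamma>(M)\<close>.\<close>

lemma proj_aug_zero_iff:
  assumes "m \<in> carrier M"
  shows "proj 0 (\<epsilon> m) = \<zero>\<^bsub>I 0\<^esub> \<longleftrightarrow> m \<in> torsion_submodule R \<aa> M"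
  using proj_T[of "\<epsilon> m" 0] proj_zeroD[of "\<epsilon> m" 0] homs_closed[OF aug_hom assms]
    torsion_hom[OF ideal M module aug_hom, of m]
    torsion_reflect[OF ideal M module aug_hom _ assms] aug_zero_iff by blast

text \<open>The shifted mapping cone of a chain map \<open>\<phi>\<close> from the torsion-free part of \<open>I\<close>, which resolves \<open>D\<close>,
  to a resolution \<open>P\<close> of the first local cohomology, covering \<open>conn\<close>. It resolves the kernel
  \<open>M/\<Gamma>(M)\<close> of \<open>conn\<close>. Since no nonzero element of the torsion-free part is annihilated by \<open>\<aa>\<close>, its
  elements annihilated by \<open>\<aa>\<close> are those of \<open>P\<close> shifted by one degree.\<close>

context
  fixes P :: "nat \<Rightarrow> ('a, 'p) module" and \<delta> :: "nat \<Rightarrow> 'p \<Rightarrow> 'p" and \<eta> :: "'e set \<Rightarrow> 'p"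
    and \<phi> :: "nat \<Rightarrow> 'e \<Rightarrow> 'p"
  assumes P: "inj_resolution R (tors_cohomology (Suc 0)) P \<delta> \<eta>"
    and \<phi>: "\<And>n. \<phi> n \<in> module_homs R (tfree n) (P n)"
    and \<phi>_chain: "\<And>n x. x \<in> carrier (tfree n) \<Longrightarrow> \<phi> (Suc n) (df n x) = \<delta> n (\<phi> n x)"
    and \<phi>_aug: "\<And>x. x \<in> D \<Longrightarrow> \<phi> 0 x = \<eta> (conn x)"
begin

interpretation P: inj_resolution R "tors_cohomology (Suc 0)" P \<delta> \<eta> by (rule P)

text \<open>The zero module in degree 0 is taken inside \<open>P 0\<close>, so that all terms share
  one type.\<close>

definition shifted where
  "shifted n = (case n of 0 \<Rightarrow> (P 0)\<lparr>carrier := {\<zero>\<^bsub>P 0\<^esub>}\<rparr> | Suc m \<Rightarrow> P m)"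

definition shifted_d where
  "shifted_d n = (case n of 0 \<Rightarrow> (\<lambda>_. \<zero>\<^bsub>P 0\<^esub>) | Suc m \<Rightarrow> \<delta> m)"

definition cone where
  "cone n = prod_module (tfree n) (shifted n)"

text \<open>With this sign the square of \<open>cone_d\<close> vanishes: its second component is
  \<open>\<phi> (df x) - \<delta> (\<phi> x)\<close>.\<close>

definition cone_d where
  "cone_d n z = (df n (fst z), \<phi> n (fst z) \<ominus>\<^bsub>P n\<^esub> shifted_d n (snd z))"

private lemma baer_shifted: "baer R (shifted n)"
  unfolding shifted_def using baer_zero[OF P.module] P.baer by (auto split: nat.split)

private lemma baer_cone: "baer R (cone n)"
  unfolding cone_def by (rule baer_prod[OF baer_tfree baer_shifted])

private lemma shifted_d_hom: "shifted_d n \<in> module_homs R (shifted n) (P n)"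
  unfolding shifted_d_def shifted_def using homs_zero_map[OF P.module] P.d_hom by (auto split: nat.split)

private lemma \<delta>_shifted_d: "p \<in> carrier (shifted n) \<Longrightarrow> \<delta> n (shifted_d n p) = \<zero>\<^bsub>P (Suc n)\<^esub>"
  unfolding shifted_d_def shifted_def
  using homs_zero[OF P.d_hom P.module P.module] P.d_d by (auto split: nat.splits)

private lemma cone_d_hom: "cone_d n \<in> module_homs R (cone n) (cone (Suc n))"
proof -
  have "(\<lambda>z. (df n (fst z), \<phi> n (fst z) \<ominus>\<^bsub>P n\<^esub> shifted_d n (snd z))) \<in>
      module_homs R (prod_module (tfree n) (shifted n)) (prod_module (tfree (Suc n)) (P n))"
    by (intro homs_pair homs_comp[OF fst_hom df_hom] homs_diff[OF P.module]
        homs_comp[OF fst_hom \<phi>] homs_comp[OF snd_hom shifted_d_hom])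
  then show ?thesis unfolding cone_def cone_d_def[abs_def] by (simp add: shifted_def)
qed

private lemma cone_carrier: "z \<in> carrier (cone n) \<longleftrightarrow> fst z \<in> carrier (tfree n) \<and> snd z \<in> carrier (shifted n)"
  by (cases z) (simp add: cone_def)

private lemma cone_zero: "\<zero>\<^bsub>cone (Suc n)\<^esub> = (\<zero>\<^bsub>I (Suc n)\<^esub>, \<zero>\<^bsub>P n\<^esub>)"
  by (simp add: cone_def tfree_simps shifted_def)

private lemma cone_d_zero_iff:
  assumes "z \<in> carrier (cone n)"
  shows "cone_d n z = \<zero>\<^bsub>cone (Suc n)\<^esub> \<longleftrightarrow>
    df n (fst z) = \<zero>\<^bsub>I (Suc n)\<^esub> \<and> \<phi> n (fst z) = shifted_d n (snd z)"
  unfolding cone_zero cone_d_def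
  using homs_eq_iff_diff[OF P.module, of "\<phi> n (fst z)" n "shifted_d n (snd z)"] assms
    homs_closed[OF \<phi>] homs_closed[OF shifted_d_hom] by (simp add: cone_carrier)

private lemma cone_exact:
  assumes z: "z \<in> carrier (cone (Suc n))"
  shows "cone_d (Suc n) z = \<zero>\<^bsub>cone (Suc (Suc n))\<^esub> \<longleftrightarrow> z \<in> cone_d n ` carrier (cone n)"
proof
  interpret Pn: module R "P n" by (rule P.module)
  interpret In: module R "tfree n" by (rule module_tfree)
  assume z0: "cone_d (Suc n) z = \<zero>\<^bsub>cone (Suc (Suc n))\<^esub>"
  define x p where "x = fst z" and "p = snd z"
  have x: "x \<in> carrier (tfree (Suc n))" and p: "p \<in> carrier (P n)"
    using z by (simp_all add: cone_carrier x_def p_def shifted_def)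
  have dx: "df (Suc n) x = \<zero>\<^bsub>I (Suc (Suc n))\<^esub>" and \<phi>x: "\<phi> (Suc n) x = \<delta> n p"
    using z0 cone_d_zero_iff[OF z] by (simp_all add: x_def p_def shifted_d_def)
  \<comment> \<open>Subtracting the differential of \<open>(x0, 0)\<close> from \<open>z\<close>
    leaves \<open>(0, q)\<close> with \<open>q\<close> a cocycle of \<open>P\<close>.\<close>
  obtain x0 where x0: "x0 \<in> carrier (tfree n)" "x = df n x0" using df_exact[OF x dx] by auto
  have c0: "\<phi> n x0 \<in> carrier (P n)" by (rule homs_closed[OF \<phi> x0(1)])
  define q where "q = p \<ominus>\<^bsub>P n\<^esub> \<phi> n x0"
  have q: "q \<in> carrier (P n)" unfolding q_def using p c0 by simp
  have pq: "p = q \<oplus>\<^bsub>P n\<^esub> \<phi> n x0" unfolding q_def using p c0 by (simp add: a_minus_def Pn.M.a_assoc Pn.M.l_neg)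
  have "\<delta> n p = \<delta> n (\<phi> n x0)" using \<phi>x \<phi>_chain[OF x0(1)] x0(2) by simp
  then have dq: "\<delta> n q = \<zero>\<^bsub>P (Suc n)\<^esub>"
    unfolding q_def using homs_minus[OF P.d_hom P.module P.module p c0]
      homs_eq_iff_diff[OF P.module] homs_closed[OF P.d_hom c0] by simp
  show "z \<in> cone_d n ` carrier (cone n)"
  proof (cases n)
    \<comment> \<open>The shifted part contributes nothing here, so \<open>q\<close> must come from
      the complements: it is \<open>\<eta> (conn x1)\<close> because \<open>conn\<close> is onto,
      and \<open>x0\<close> is corrected by \<open>x1\<close>.\<close>
    case 0
    then obtain h where h: "h \<in> carrier (tors_cohomology (Suc 0))" "q = \<eta> h" using P.exact0 q dq by auto
    then obtain x1 where x1: "x1 \<in> D" "h = conn x1" using conn_surj by auto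
    have x1t: "x1 \<in> carrier (tfree n)" and dx1: "df n x1 = \<zero>\<^bsub>I (Suc n)\<^esub>" using x1(1) 0 by (simp_all add: D_def)
    have \<phi>1: "\<phi> n x1 = q" using \<phi>_aug[OF x1(1)] x1(2) h(2) 0 by simp
    interpret Is: module R "I (Suc n)" by (rule module)
    let ?z = "(x0 \<oplus>\<^bsub>tfree n\<^esub> x1, \<zero>\<^bsub>P 0\<^esub>)"
    have "df n (x0 \<oplus>\<^bsub>tfree n\<^esub> x1) = x"
      using homs_add[OF df_hom x0(1) x1t] dx1 x0(2) tfree_carrier[OF x] by (simp add: tfree_simps)
    moreover have "\<phi> n (x0 \<oplus>\<^bsub>tfree n\<^esub> x1) \<ominus>\<^bsub>P n\<^esub> \<zero>\<^bsub>P n\<^esub> = p"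
      using homs_add[OF \<phi> x0(1) x1t] \<phi>1 c0 q pq by (simp add: a_minus_def Pn.M.a_comm)
    ultimately have "cone_d n ?z = z" unfolding cone_d_def using 0 by (simp add: shifted_d_def x_def p_def)
    moreover have "?z \<in> carrier (cone n)"
      using In.M.a_closed[OF x0(1) x1t] 0 by (simp add: cone_carrier shifted_def)
    ultimately show ?thesis by (metis imageI)
  next
    \<comment> \<open>The preimage \<open>s\<close> of \<open>q\<close> enters with a minus sign,
      which cancels the one in \<open>cone_d\<close>.\<close>
    case (Suc m)
    interpret Pm: module R "P m" by (rule P.module)
    interpret Ps: module R "P (Suc m)" by (rule P.module)
    obtain s where s: "s \<in> carrier (P m)" "q = \<delta> m s" using P.exact[of q m] q dq Suc by auto
    have "\<phi> n x0 \<ominus>\<^bsub>P n\<^esub> \<delta> m (\<ominus>\<^bsub>P m\<^esub> s) = p"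
      using homs_neg[OF P.d_hom P.module P.module s(1)] s(2) q c0 pq Suc by (simp add: a_minus_def Ps.M.a_comm)
    then have "cone_d n (x0, \<ominus>\<^bsub>P m\<^esub> s) = z"
      unfolding cone_d_def using x0(2) Suc by (intro prod_eqI) (simp_all add: shifted_d_def x_def p_def)
    moreover have "(x0, \<ominus>\<^bsub>P m\<^esub> s) \<in> carrier (cone n)" using x0(1) s(1) Suc by (simp add: cone_carrier shifted_def)
    ultimately show ?thesis by (metis imageI)
  qed
next
  interpret Pn: module R "P (Suc n)" by (rule P.module)
  assume "z \<in> cone_d n ` carrier (cone n)"
  then obtain w where w: "w \<in> carrier (cone n)" "z = cone_d n w" by auto
  have c: "fst w \<in> carrier (tfree n)" "snd w \<in> carrier (shifted n)" using w(1) by (simp_all add: cone_carrier)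
  have c': "\<phi> n (fst w) \<in> carrier (P n)" "shifted_d n (snd w) \<in> carrier (P n)"
    using homs_closed[OF \<phi> c(1)] homs_closed[OF shifted_d_hom c(2)] .
  have "\<delta> n (\<phi> n (fst w) \<ominus>\<^bsub>P n\<^esub> shifted_d n (snd w)) = \<delta> n (\<phi> n (fst w))"
    using homs_minus[OF P.d_hom P.module P.module c'] \<delta>_shifted_d[OF c(2)] homs_closed[OF P.d_hom c'(1)]
    by (simp add: a_minus_def)
  then show "cone_d (Suc n) z = \<zero>\<^bsub>cone (Suc (Suc n))\<^esub>"
    unfolding cone_d_zero_iff[OF z] using w(2) df_df[OF c(1)] \<phi>_chain[OF c(1)]
    by (simp add: cone_d_def shifted_d_def)
qed

text \<open>Since \<open>\<eta>\<close> is injective, the cocycles of degree 0 are the elements of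
  \<open>D\<close> that \<open>conn\<close> kills. These are the projections of elements of
  \<open>M\<close>, and such a projection is zero exactly on the torsion of
  \<open>M\<close>.\<close>

lemma cone_resolution:
  obtains \<alpha> where "inj_resolution R (quotient_module M (torsion_submodule R \<aa> M)) cone cone_d \<alpha>"
proof -
  interpret M: module R M by (rule M)
  let ?T = "torsion_submodule R \<aa> M" and ?g = "\<lambda>m. (proj 0 (\<epsilon> m), \<zero>\<^bsub>P 0\<^esub>)"
  have sT: "submodule ?T R M" by (rule torsion_submodule[OF ideal M])
  let ?Y = "quotient_module M ?T" and ?p = "\<lambda>x. ?T +>\<^bsub>M\<^esub> x"
  note Y = module_quotient[OF M sT] and p = proj_hom[OF M sT] and cY = carrier_quotient[OF M sT]
  note mC = baerD1[OF baer_cone]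
  have sh0: "shifted 0 = (P 0)\<lparr>carrier := {\<zero>\<^bsub>P 0\<^esub>}\<rparr>" by (simp add: shifted_def)
  have z0: "\<zero>\<^bsub>cone 0\<^esub> = (\<zero>\<^bsub>I 0\<^esub>, \<zero>\<^bsub>P 0\<^esub>)" by (simp add: cone_def tfree_simps shifted_def)
  have "(\<lambda>m. \<zero>\<^bsub>P 0\<^esub>) \<in> module_homs R M (shifted 0)"
    using homs_zero_map[OF baerD1[OF baer_shifted[of 0]], of M] by (simp add: sh0)
  then have g: "?g \<in> module_homs R M (cone 0)"
    unfolding cone_def by (intro homs_pair homs_comp[OF aug_hom proj_into])
  have g0: "?g m = \<zero>\<^bsub>cone 0\<^esub> \<longleftrightarrow> m \<in> ?T" if "m \<in> carrier M" for m
    unfolding z0 using proj_aug_zero_iff[OF that] by simp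
  obtain \<alpha> where \<alpha>: "\<alpha> \<in> module_homs R ?Y (cone 0)" "\<And>m. m \<in> carrier M \<Longrightarrow> \<alpha> (?p m) = ?g m"
    using hom_factor[OF M Y mC p cY[symmetric] g] g0 proj_zero_iff[OF M sT] by metis
  have inj: "inj_on \<alpha> (carrier ?Y)"
  proof (rule inj_onI)
    fix x y assume xy: "x \<in> carrier ?Y" "y \<in> carrier ?Y" "\<alpha> x = \<alpha> y"
    then obtain m n where mn: "x = ?p m" "y = ?p n" "m \<in> carrier M" "n \<in> carrier M" unfolding cY by auto
    have "?g m = ?g n" using xy(3) \<alpha>(2) mn by simp
    then have "?g (m \<ominus>\<^bsub>M\<^esub> n) = \<zero>\<^bsub>cone 0\<^esub>"
      using homs_minus[OF g M mC mn(3,4)] homs_eq_iff_diff[OF mC] homs_closed[OF g mn(4)] by simp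
    then have "m \<ominus>\<^bsub>M\<^esub> n \<in> ?T" using g0 mn(3,4) by simp
    then show "x = y" using proj_eq_iff[OF M sT mn(3,4)] mn(1,2) by simp
  qed
  have "\<alpha> ` carrier ?Y = a_kernel (cone 0) (cone (Suc 0)) (cone_d 0)"
  proof -
    have "\<alpha> ` carrier ?Y = ?g ` carrier M" unfolding cY using \<alpha>(2) by (simp add: image_image)
    also have "\<dots> = {z \<in> carrier (cone 0). cone_d 0 z = \<zero>\<^bsub>cone (Suc 0)\<^esub>}"
    proof (rule Set.set_eqI, rule iffI)
      fix z assume "z \<in> ?g ` carrier M"
      then obtain m where m: "m \<in> carrier M" "z = ?g m" by auto
      have zc: "z \<in> carrier (cone 0)" using homs_closed[OF g m(1)] m(2) by simp
      note D = proj_aug_D[OF m(1)]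
      have "conn (proj 0 (\<epsilon> m)) = \<zero>\<^bsub>tors_cohomology (Suc 0)\<^esub>" using conn_zero_iff[OF D] m(1) by blast
      then have "\<phi> 0 (fst z) = \<zero>\<^bsub>P 0\<^esub>"
        using \<phi>_aug[OF D] m(2) homs_zero[OF P.aug_hom P.M P.module] by simp
      then show "z \<in> {z \<in> carrier (cone 0). cone_d 0 z = \<zero>\<^bsub>cone (Suc 0)\<^esub>}"
        using zc cone_d_zero_iff[OF zc] D m(2) by (simp add: shifted_d_def D_def)
    next
      fix z assume "z \<in> {z \<in> carrier (cone 0). cone_d 0 z = \<zero>\<^bsub>cone (Suc 0)\<^esub>}"
      then have zc: "z \<in> carrier (cone 0)" and "cone_d 0 z = \<zero>\<^bsub>cone (Suc 0)\<^esub>" by auto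
      then have z: "df 0 (fst z) = \<zero>\<^bsub>I (Suc 0)\<^esub>" "\<phi> 0 (fst z) = \<zero>\<^bsub>P 0\<^esub>"
        using cone_d_zero_iff[OF zc] by (simp_all add: shifted_d_def)
      have D: "fst z \<in> D" and s: "snd z = \<zero>\<^bsub>P 0\<^esub>" using z(1) zc by (simp_all add: D_def cone_carrier sh0)
      have "conn (fst z) = \<zero>\<^bsub>tors_cohomology (Suc 0)\<^esub>"
        using \<phi>_aug[OF D] z(2) P.aug_zero_iff[of "conn (fst z)"] homs_closed[OF conn_hom, of "fst z"] D by simp
      then obtain m where "m \<in> carrier M" "fst z = proj 0 (\<epsilon> m)" using conn_zero_iff[OF D] by blast
      then show "z \<in> ?g ` carrier M" using s by (intro image_eqI[of _ _ m]) (auto intro: prod_eqI)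
    qed
    finally show ?thesis by (simp add: a_kernel_def')
  qed
  moreover have "cone_d n ` carrier (cone n) = a_kernel (cone (Suc n)) (cone (Suc (Suc n))) (cone_d (Suc n))" for n
    unfolding a_kernel_def' using cone_exact homs_closed[OF cone_d_hom] by blast
  ultimately have "injective_resolution R ?Y cone cone_d \<alpha>"
    unfolding injective_resolution_def injective_module_iff_baer
    using baer_cone \<alpha>(1) cone_d_hom inj by simp
  then have "inj_resolution R ?Y cone cone_d \<alpha>" using Y by (simp add: inj_resolution_def)
  then show ?thesis by (rule that)
qed

private lemma annihilated_cone: "annihilated \<aa> (cone n) = {\<zero>\<^bsub>I n\<^esub>} \<times> annihilated \<aa> (shifted n)"
  using annihilated_tfree[of n] by (auto simp: annihilated_def cone_def tfree_simps)

text \<open>Under the map from \<open>p\<close> to \<open>(0, p)\<close> the differentials of the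
  two annihilated complexes agree up to sign, and a sign changes neither cocycles nor
  coboundaries.\<close>

lemma ann_cohomology_cone:
  "module_iso R (ann_cohomology \<aa> P \<delta> i) (ann_cohomology \<aa> cone cone_d (Suc i))"
proof -
  obtain \<alpha> where "inj_resolution R (quotient_module M (torsion_submodule R \<aa> M)) cone cone_d \<alpha>"
    by (rule cone_resolution)
  then interpret C: inj_resolution R "quotient_module M (torsion_submodule R \<aa> M)" cone cone_d \<alpha> .
  have \<aa>: "\<aa> \<subseteq> carrier R" using ideal.Icarr[OF ideal] by blast
  interpret Pi: module R "P i" by (rule P.module)
  let ?Z = "ann_cocycles \<aa> P \<delta> i" and ?B = "ann_coboundaries \<aa> P \<delta> i"
  let ?Z' = "ann_cocycles \<aa> cone cone_d (Suc i)" and ?B' = "ann_coboundaries \<aa> cone cone_d (Suc i)"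
  note Z = P.cocycles_submodule[OF \<aa>, of i] and B = P.coboundaries_submodule[OF \<aa>, of i]
  note Z' = C.cocycles_submodule[OF \<aa>, of "Suc i"] and B' = C.coboundaries_submodule[OF \<aa>, of "Suc i"]
  have mZ: "module R ((P i)\<lparr>carrier := ?Z\<rparr>)" by (rule restrict_module[OF Z P.module])
  have mZ': "module R ((cone (Suc i))\<lparr>carrier := ?Z'\<rparr>)" by (rule restrict_module[OF Z' C.module])
  have BZ: "submodule ?B R ((P i)\<lparr>carrier := ?Z\<rparr>)"
    by (rule submodule_restrict[OF P.module Z B P.coboundaries_subset[OF \<aa>]])
  have BZ': "submodule ?B' R ((cone (Suc i))\<lparr>carrier := ?Z'\<rparr>)"
    by (rule submodule_restrict[OF C.module Z' B' C.coboundaries_subset[OF \<aa>]])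
  let ?h = "\<lambda>p. (\<zero>\<^bsub>I (Suc i)\<^esub>, p)"
  have df0: "df n \<zero>\<^bsub>I n\<^esub> = \<zero>\<^bsub>I (Suc n)\<^esub>" and \<phi>0: "\<phi> n \<zero>\<^bsub>I n\<^esub> = \<zero>\<^bsub>P n\<^esub>" for n
    using homs_zero[OF df_hom module_tfree module_tfree, of n] homs_zero[OF \<phi> module_tfree P.module, of n]
    by (simp_all add: tfree_simps(2))
  have Z'_eq: "?Z' = ?h ` ?Z"
  proof -
    have "cone_d (Suc i) (?h p) = \<zero>\<^bsub>cone (Suc (Suc i))\<^esub> \<longleftrightarrow> \<delta> i p = \<zero>\<^bsub>P (Suc i)\<^esub>" if p: "p \<in> annihilated \<aa> (P i)" for p
    proof -
      have "?h p \<in> annihilated \<aa> (cone (Suc i))" using p by (simp add: annihilated_cone shifted_def)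
      then have c: "?h p \<in> carrier (cone (Suc i))" by (simp add: annihilated_def)
      show ?thesis unfolding cone_d_zero_iff[OF c] using df0 \<phi>0 by (auto simp: shifted_d_def)
    qed
    then show ?thesis unfolding ann_cocycles_def annihilated_cone by (auto simp: shifted_def)
  qed
  \<comment> \<open>For \<open>i = 0\<close> both sides are zero, because the shifted complex begins
    with the zero module.\<close>
  have neg_shift: "shifted_d i ` annihilated \<aa> (shifted i) = ?B"
  proof (cases i)
    case 0
    interpret P0: module R "P 0" by (rule P.module)
    have "\<zero>\<^bsub>P 0\<^esub> \<in> annihilated \<aa> (shifted i)"
      using 0 \<aa> by (auto simp: annihilated_def shifted_def subset_eq)
    then show ?thesis using 0 by (auto simp: shifted_d_def ann_coboundaries_def)
  next
    case (Suc m)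
    then show ?thesis by (simp add: shifted_d_def shifted_def ann_coboundaries_def)
  qed
  have B'_eq: "?B' = (\<lambda>p. ?h (\<ominus>\<^bsub>P i\<^esub> p)) ` ?B"
  proof -
    have "cone_d i (\<zero>\<^bsub>I i\<^esub>, p) = ?h (\<ominus>\<^bsub>P i\<^esub> shifted_d i p)" if p: "p \<in> annihilated \<aa> (shifted i)" for p
    proof -
      have "shifted_d i p \<in> carrier (P i)" using p homs_closed[OF shifted_d_hom] by (simp add: annihilated_def)
      then show ?thesis unfolding cone_d_def using df0 \<phi>0 by (simp add: a_minus_def)
    qed
    then have "?B' = (\<lambda>p. ?h (\<ominus>\<^bsub>P i\<^esub> shifted_d i p)) ` annihilated \<aa> (shifted i)"
      by (auto simp: ann_coboundaries_def annihilated_cone image_iff)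
    then show ?thesis unfolding neg_shift[symmetric] by (simp add: image_image)
  qed
  show ?thesis unfolding ann_cohomology_def
  proof (rule quotient_iso[OF mZ mZ' BZ BZ', of ?h])
    interpret Is: module R "I (Suc i)" by (rule module)
    show "?h \<in> module_homs R ((P i)\<lparr>carrier := ?Z\<rparr>) ((cone (Suc i))\<lparr>carrier := ?Z'\<rparr>)"
      by (rule module_homsI) (simp_all add: Z'_eq cone_def tfree_simps shifted_def)
    fix p assume "p \<in> carrier ((P i)\<lparr>carrier := ?Z\<rparr>)"
    then have pc: "p \<in> carrier (P i)" using submoduleD(1)[OF Z] by simp
    show "?h p \<in> ?B' \<longleftrightarrow> p \<in> ?B"
    proof
      assume "?h p \<in> ?B'"
      then obtain b where "b \<in> ?B" "p = \<ominus>\<^bsub>P i\<^esub> b" unfolding B'_eq by auto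
      then show "p \<in> ?B" using submoduleD(5)[OF B] by simp
    next
      assume "p \<in> ?B"
      then have "\<ominus>\<^bsub>P i\<^esub> p \<in> ?B" "p = \<ominus>\<^bsub>P i\<^esub> (\<ominus>\<^bsub>P i\<^esub> p)" using submoduleD(5)[OF B] pc by simp_all
      then show "?h p \<in> ?B'" unfolding B'_eq by (metis imageI)
    qed
  next
    fix y assume y: "y \<in> carrier ((cone (Suc i))\<lparr>carrier := ?Z'\<rparr>)"
    then obtain p where p: "p \<in> ?Z" "y = ?h p" unfolding Z'_eq by auto
    have "y \<ominus>\<^bsub>(cone (Suc i))\<lparr>carrier := ?Z'\<rparr>\<^esub> ?h p = \<zero>\<^bsub>(cone (Suc i))\<lparr>carrier := ?Z'\<rparr>\<^esub>"
      using homs_eq_iff_diff[OF mZ' y y] p(2) by simp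
    then show "\<exists>p\<in>carrier ((P i)\<lparr>carrier := ?Z\<rparr>). y \<ominus>\<^bsub>(cone (Suc i))\<lparr>carrier := ?Z'\<rparr>\<^esub> ?h p \<in> ?B'"
      using p(1) submoduleD(2)[OF BZ'] by (intro bexI[of _ p]) simp_all
  qed
qed

end

text \<open>The cone and the chosen resolution \<open>Q\<close> of \<open>M/\<Gamma>(M)\<close> lie
  in different types; \<open>ann_cohomology_iso\<close> links them.\<close>

lemma Ext_tors_cohomology:
  "module_iso R (Ext R i (residue_module R \<aa>) (tors_cohomology (Suc 0)))
    (Ext R (i + 1) (residue_module R \<aa>) (quotient_module M (torsion_submodule R \<aa> M)))"
proof -
  let ?Y = "quotient_module M (torsion_submodule R \<aa> M)"
  have \<aa>: "\<aa> \<subseteq> carrier R" using ideal.Icarr[OF ideal] by blast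
  have Y: "module R ?Y" by (rule module_quotient[OF M torsion_submodule[OF ideal M]])
  obtain P \<delta> \<eta> where P: "inj_res R (tors_cohomology (Suc 0)) = (P, \<delta>)" "inj_resolution R (tors_cohomology (Suc 0)) P \<delta> \<eta>"
    by (rule inj_res_resolution[OF module_tors_cohomology])
  obtain Q \<gamma> \<beta> where Q: "inj_res R ?Y = (Q, \<gamma>)" "inj_resolution R ?Y Q \<gamma> \<beta>"
    by (rule inj_res_resolution[OF Y])
  interpret P: inj_resolution R "tors_cohomology (Suc 0)" P \<delta> \<eta> by (rule P)
  interpret Q: inj_resolution R ?Y Q \<gamma> \<beta> by (rule Q)
  interpret K: inj_resolution R Dm tfree df "\<lambda>x. x" by (rule tfree_resolution)
  obtain \<phi> where \<phi>: "\<And>n. \<phi> n \<in> module_homs R (tfree n) (P n)"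
    "\<And>n x. x \<in> carrier (tfree n) \<Longrightarrow> \<phi> (Suc n) (df n x) = \<delta> n (\<phi> n x)"
    "\<And>x. x \<in> carrier Dm \<Longrightarrow> \<phi> 0 x = \<eta> (conn x)"
    by (rule K.lift[OF P.baer P.d_hom P.d_d homs_comp[OF conn_hom P.aug_hom]])
      (use P.d_aug homs_closed[OF conn_hom] in \<open>blast+\<close>)
  have \<phi>_aug: "\<phi> 0 x = \<eta> (conn x)" if "x \<in> D" for x using \<phi>(3) that by simp
  note cone = P(2) \<phi>(1,2) \<phi>_aug
  obtain \<alpha> where C: "inj_resolution R ?Y (cone P) (cone_d P \<delta> \<phi>) \<alpha>"
    by (rule cone_resolution[OF cone])
  have 1: "module_iso R (Ext R i (residue_module R \<aa>) (tors_cohomology (Suc 0))) (ann_cohomology \<aa> P \<delta> i)"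
    by (rule module_iso_sym[OF P.module_ann_cohomology[OF \<aa>] Ext_iso_ann(2)[OF ideal P]])
  have 2: "module_iso R (ann_cohomology \<aa> P \<delta> i) (ann_cohomology \<aa> (cone P) (cone_d P \<delta> \<phi>) (Suc i))"
    by (rule ann_cohomology_cone[OF cone])
  have 3: "module_iso R (ann_cohomology \<aa> (cone P) (cone_d P \<delta> \<phi>) (Suc i)) (ann_cohomology \<aa> Q \<gamma> (Suc i))"
    by (rule ann_cohomology_iso[OF C Q(2) \<aa>])
  have 4: "module_iso R (ann_cohomology \<aa> Q \<gamma> (Suc i)) (Ext R (i + 1) (residue_module R \<aa>) ?Y)"
    using Ext_iso_ann(2)[OF ideal Q] by simp
  show ?thesis by (rule module_iso_trans[OF 1 module_iso_trans[OF 2 module_iso_trans[OF 3 4]]])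
qed

end

text \<open>An element of \<aa> outside \<pp> has all its powers outside \<pp>. One such power kills
  the numerators of two given fractions, so all fractions are equal and the localization is
  zero.\<close>

lemma Supp_torsion:
  assumes M: "module R M" and ideal: "ideal \<aa> R"
    and tors: "\<And>r x. r \<in> \<aa> \<Longrightarrow> x \<in> carrier M \<Longrightarrow> \<exists>n::nat. (r [^]\<^bsub>R\<^esub> n) \<odot>\<^bsub>M\<^esub> x = \<zero>\<^bsub>M\<^esub>"
  shows "Supp R M \<subseteq> vanishing_locus R \<aa>"
proof
  interpret M: module R M by (rule M)
  fix \<pp> assume "\<pp> \<in> Supp R M"
  then have prime: "primeideal \<pp> R" and nz: "\<not> zero_module (localization R (carrier R - \<pp>) M)"
    unfolding Supp_def by auto
  have "\<aa> \<subseteq> \<pp>"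
  proof (rule ccontr)
    assume "\<not> \<aa> \<subseteq> \<pp>"
    then obtain r where r: "r \<in> \<aa>" "r \<notin> \<pp>" by blast
    have rc: "r \<in> carrier R" by (rule ideal.Icarr[OF ideal r(1)])
    let ?S = "carrier R - \<pp>"
    have one: "\<one>\<^bsub>R\<^esub> \<notin> \<pp>"
      using primeideal.I_notcarr[OF prime] ideal.one_imp_carrier[OF primeideal.axioms(1)[OF prime]] by auto
    have pow: "r [^]\<^bsub>R\<^esub> n \<in> ?S" for n :: nat
    proof (induction n)
      case 0 then show ?case using one by simp
    next
      case (Suc n)
      then show ?case using primeideal.I_prime[OF prime, of "r [^]\<^bsub>R\<^esub> n" r] r(2) rc by auto
    qed
    have rel: "((x, s), (y, t)) \<in> fraction_rel ?S M"
      if xy: "x \<in> carrier M" "y \<in> carrier M" "s \<in> ?S" "t \<in> ?S" for x y s t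
    proof -
      obtain m where m: "(r [^]\<^bsub>R\<^esub> (m::nat)) \<odot>\<^bsub>M\<^esub> x = \<zero>\<^bsub>M\<^esub>" using tors[OF r(1) xy(1)] by blast
      obtain n where n: "(r [^]\<^bsub>R\<^esub> (n::nat)) \<odot>\<^bsub>M\<^esub> y = \<zero>\<^bsub>M\<^esub>" using tors[OF r(1) xy(2)] by blast
      have "(r [^]\<^bsub>R\<^esub> (m + n)) \<odot>\<^bsub>M\<^esub> (t \<odot>\<^bsub>M\<^esub> x) = (t \<otimes>\<^bsub>R\<^esub> r [^]\<^bsub>R\<^esub> n) \<odot>\<^bsub>M\<^esub> ((r [^]\<^bsub>R\<^esub> m) \<odot>\<^bsub>M\<^esub> x)"
        using xy rc by (simp add: M.smult_assoc1[symmetric] M.R.nat_pow_mult[symmetric] M.R.m_ac)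
      moreover have "(r [^]\<^bsub>R\<^esub> (m + n)) \<odot>\<^bsub>M\<^esub> (s \<odot>\<^bsub>M\<^esub> y) = (s \<otimes>\<^bsub>R\<^esub> r [^]\<^bsub>R\<^esub> m) \<odot>\<^bsub>M\<^esub> ((r [^]\<^bsub>R\<^esub> n) \<odot>\<^bsub>M\<^esub> y)"
        using xy rc by (simp add: M.smult_assoc1[symmetric] M.R.nat_pow_mult[symmetric] M.R.m_ac)
      ultimately have "(r [^]\<^bsub>R\<^esub> (m + n)) \<odot>\<^bsub>M\<^esub> (t \<odot>\<^bsub>M\<^esub> x) = (r [^]\<^bsub>R\<^esub> (m + n)) \<odot>\<^bsub>M\<^esub> (s \<odot>\<^bsub>M\<^esub> y)"
        using m n xy rc by simp
      then show ?thesis using xy pow[of "m + n"] unfolding fraction_rel_def by blast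
    qed
    have z: "(\<zero>\<^bsub>M\<^esub>, \<one>\<^bsub>R\<^esub>) \<in> carrier M \<times> ?S" using one by simp
    have cls: "fraction_rel ?S M `` {z} = carrier M \<times> ?S" if "z \<in> carrier M \<times> ?S" for z
    proof
      show "fraction_rel ?S M `` {z} \<subseteq> carrier M \<times> ?S" unfolding fraction_rel_def by auto
      show "carrier M \<times> ?S \<subseteq> fraction_rel ?S M `` {z}" using that rel by auto
    qed
    have "(carrier M \<times> ?S) // fraction_rel ?S M = {carrier M \<times> ?S}"
    proof
      show "(carrier M \<times> ?S) // fraction_rel ?S M \<subseteq> {carrier M \<times> ?S}" unfolding quotient_def using cls by auto
      show "{carrier M \<times> ?S} \<subseteq> (carrier M \<times> ?S) // fraction_rel ?S M"
        using quotientI[OF z, of "fraction_rel ?S M"] cls[OF z] by simp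
    qed
    then have "zero_module (localization R ?S M)"
      unfolding zero_module_def localization_def using cls[OF z] by simp
    then show False using nz by simp
  qed
  then show "\<pp> \<in> vanishing_locus R \<aa>" unfolding vanishing_locus_def using prime by simp
qed

theorem proposition3p5:
  fixes R :: "('a, 'r) ring_scheme" and \<aa> :: "'a set" and M :: "('a, 'b, 'c) module_scheme"
  assumes "cring R" and "noetherian_ring R"
    and "ideal \<aa> R"
    and "module R M"
    and "cd R \<aa> M = 1"
  shows "(\<forall>i. module_iso R
            (Ext R i (residue_module R \<aa>) (local_cohomology R \<aa> 1 M))
            (Ext R (i + 1) (residue_module R \<aa>) (quotient_module M (torsion_submodule R \<aa> M)))) \<and>
         (finitely_generated R M \<longrightarrow> (\<forall>i. cofinite_module R \<aa> (local_cohomology R \<aa> i M)))"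
proof -
  obtain I d \<epsilon> where Id: "inj_res R M = (I, d)" and res: "inj_resolution R M I d \<epsilon>"
    by (rule inj_res_resolution[OF \<open>module R M\<close>])
  interpret torsion_resolution R M I d \<epsilon> \<aa>
    by (rule torsion_resolution.intro[OF res torsion_resolution_axioms.intro[OF assms(2,3)]])
  have lc: "local_cohomology R \<aa> i M = tors_cohomology i" for i
    unfolding local_cohomology_def Id cohomology_def tors_cohomology_def torsion_functor_def
      tors_cocycles_def tors_coboundaries_def a_kernel_def' by (simp split: nat.split)
  \<comment> \<open>\<open>cd\<close> is a supremum over the degrees with non-zero cohomology, so
    the value 1 excludes every degree from 2 on.\<close>
  have vanish: "zero_module (tors_cohomology (Suc (Suc n)))" for n
  proof (rule ccontr)
    assume "\<not> zero_module (tors_cohomology (Suc (Suc n)))"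
    then have "ereal (real (Suc (Suc n))) \<le> cd R \<aa> M" unfolding cd_def lc by (intro Sup_upper) blast
    then show False unfolding assms(5) by (simp add: one_ereal_def)
  qed
  \<comment> \<open>The identity of the torsion submodule extends to \<open>I n\<close>, because
    this submodule is injective.\<close>
  have "\<exists>\<rho>. \<rho> \<in> module_homs R (I n) (I n) \<and> (\<forall>x\<in>carrier (I n). \<rho> x \<in> T n) \<and> (\<forall>x\<in>T n. \<rho> x = x)" for n
  proof -
    have bT: "baer R ((I n)\<lparr>carrier := T n\<rparr>)"
      using baer_torsion[OF noeth ideal baer] unfolding torsion_functor_def .
    obtain \<rho> where \<rho>: "\<rho> \<in> module_homs R (I n) ((I n)\<lparr>carrier := T n\<rparr>)" "\<And>x. x \<in> T n \<Longrightarrow> \<rho> x = x"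
      using baer_extend[OF bT module T homs_id] by blast
    have "T n \<subseteq> carrier (I n)" using T_carrier by blast
    then have "\<rho> \<in> module_homs R (I n) (I n)" by (rule homs_out[OF \<rho>(1)])
    moreover have "\<rho> x \<in> T n" if "x \<in> carrier (I n)" for x using homs_closed[OF \<rho>(1) that] by simp
    ultimately show ?thesis using \<rho>(2) by blast
  qed
  then obtain \<rho> where \<rho>: "\<And>n. \<rho> n \<in> module_homs R (I n) (I n)"
    "\<And>n x. x \<in> carrier (I n) \<Longrightarrow> \<rho> n x \<in> T n" "\<And>n x. x \<in> T n \<Longrightarrow> \<rho> n x = x" by metis
  interpret split_torsion_resolution R M I d \<epsilon> \<aa> \<rho>
    by (rule split_torsion_resolution.intro[OF torsion_resolution_axioms split_torsion_resolution_axioms.intro])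
      (rule \<rho> vanish; assumption)+
  have iso: "module_iso R (Ext R i (residue_module R \<aa>) (tors_cohomology (Suc 0)))
      (Ext R (i + 1) (residue_module R \<aa>) (quotient_module M (torsion_submodule R \<aa> M)))" for i
    by (rule Ext_tors_cohomology)
  have "cofinite_module R \<aa> (tors_cohomology i)" if fg: "finitely_generated R M" for i
    unfolding cofinite_module_def
  proof (intro conjI allI)
    note H = module_tors_cohomology
    show "Supp R (tors_cohomology i) \<subseteq> vanishing_locus R \<aa>"
      by (rule Supp_torsion[OF H ideal tors_cohomology_power])
    fix j
    \<comment> \<open>In degree 1 the isomorphism is read backwards: Ext of the cohomology in degree
      \<open>j\<close> is Ext of the finitely generated module \<open>M/\<Gamma>(M)\<close> in
      degree \<open>j + 1\<close>. In the other degrees the cohomology itself is finitely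
      generated.\<close>
    show "finitely_generated R (Ext R j (residue_module R \<aa>) (tors_cohomology i))"
    proof (cases "i = 1")
      case True
      have sT: "submodule (torsion_submodule R \<aa> M) R M" by (rule torsion_submodule[OF ideal M])
      let ?Y = "quotient_module M (torsion_submodule R \<aa> M)"
      have Y: "module R ?Y" by (rule module_quotient[OF M sT])
      have "finitely_generated R ?Y"
        by (rule finitely_generated_surj[OF M Y proj_hom[OF M sT] carrier_quotient[OF M sT, symmetric] fg])
      then have fgE: "finitely_generated R (Ext R (j + 1) (residue_module R \<aa>) ?Y)"
        by (rule finitely_generated_Ext[OF noeth ideal Y])
      have mE: "module R (Ext R k (residue_module R \<aa>) N)" if "module R N" for k and N :: "('a, 'x) module"
        using inj_res_resolution[OF that] Ext_iso_ann(1)[OF ideal] by metis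
      have "module_iso R (Ext R (j + 1) (residue_module R \<aa>) ?Y) (Ext R j (residue_module R \<aa>) (tors_cohomology (Suc 0)))"
        by (rule module_iso_sym[OF mE[OF H] iso])
      then show ?thesis using finitely_generated_iso[OF mE[OF Y] mE[OF H] _ fgE] True by simp
    next
      case False
      have "finitely_generated R (tors_cohomology i)"
      proof (cases i)
        case 0
        then show ?thesis using finitely_generated_tors_cohomology_0[OF fg] by simp
      next
        case (Suc k)
        then obtain n where n: "i = Suc (Suc n)" using False by (cases k) auto
        show ?thesis unfolding finitely_generated_iff[OF H]
          by (rule generated_modI[of "{}"]) (use vanish[of n] n in \<open>auto simp: zero_module_def\<close>)
      qed
      then show ?thesis by (rule finitely_generated_Ext[OF noeth ideal H])
    qed
  qed
  moreover have "module_iso R (Ext R i (residue_module R \<aa>) (tors_cohomology 1))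
      (Ext R (i + 1) (residue_module R \<aa>) (quotient_module M (torsion_submodule R \<aa> M)))" for i
    using iso[of i] unfolding One_nat_def .
  ultimately show ?thesis unfolding lc by blast
qed

end
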